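(* The commuting variety $\mathfrak C(\mathfrak g_1)=\{(x,y)\in\mathfrak g_1\times\mathfrak g_1\mid [x,y]=0\}$ is reducible for each of the following symmetric pairs $(\mathfrak g,\mathfrak g_0)$: (1) $(\mathfrak{sl}_{n+m},\mathfrak{sl}_n\oplus\mathfrak{sl}_m\oplus\mathfrak t_1)$ with $n,m\ge1$ and $n\ne m$; (2) $(\mathfrak{so}_{2n},\mathfrak{gl}_n)$ with $n$ odd, $n\ge 3$; (3) $(\mathcal E_6,\mathfrak{so}_{10}\oplus\mathfrak t_1)$.
   Context: The ground field $\Bbbk$ is algebraically closed of characteristic zero. A symmetric pair $(\mathfrak g,\mathfrak g_0)$ consists of a reductive algebraic Lie algebra $\mathfrak g$ over $\Bbbk$ with an involutory automorphism $\sigma$; $\mathfrak g=\mathfrak g_0\oplus\mathfrak g_1$ is the decomposition into the $(+1)$- and $(-1)$-eigenspaces of $\sigma$. $\mathfrak t_1$ denotes a one-dimensional central torus. In (1), $\sigma$ is conjugation by the diagonal matrix with $n$ entries $-1$ followed by $m$ entries $1$, so $\mathfrak g_0$ consists of the trace-zero block-diagonal matrices with blocks of sizes $n$ and $m$. In (2), $\mathfrak g=\mathfrak{so}(V)$ with $\dim V=2n$, $V=V_+\oplus V_-$ is a decomposition into two (maximal) isotropic subspaces, and $\sigma$ is conjugation by the linear map equal to $\mathrm{id}$ on $V_+$ and $-\mathrm{id}$ on $V_-$; then $\mathfrak g_0\cong\mathfrak{gl}(V_+)\cong\mathfrak{gl}_n$. In (3), $\mathcal E_6$ is the simple Lie algebra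 of type $E_6$ and $\sigma$ is an involution of it whose fixed subalgebra is isomorphic to $\mathfrak{so}_{10}\oplus\mathfrak t_1$ (unique up to conjugation). Reducibility is in the Zariski topology. *)

theory Defs
  imports
    "HOL-Analysis.Analysis"
    "HOL-Computational_Algebra.Polynomial"
begin

section \<open>The Zariski topology of a vector space\<close>

text \<open>
  Polynomial functions without a choice of coordinates: the algebra of functions generated by the
  constants and the linear functionals.
\<close>

inductive_set polynomial_functions :: "('k::field \<Rightarrow> 'v::ab_group_add \<Rightarrow> 'v) \<Rightarrow> ('v \<Rightarrow> 'k) set"
  for smul :: "'k \<Rightarrow> 'v \<Rightarrow> 'v" where
  const: "(\<lambda>_. c) \<in> polynomial_functions smul"
| linear: "Vector_Spaces.linear smul (*) f \<Longrightarrow> f \<in> polynomial_functions smul"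
| add: "f \<in> polynomial_functions smul \<Longrightarrow> g \<in> polynomial_functions smul \<Longrightarrow>
    (\<lambda>v. f v + g v) \<in> polynomial_functions smul"
| mult: "f \<in> polynomial_functions smul \<Longrightarrow> g \<in> polynomial_functions smul \<Longrightarrow>
    (\<lambda>v. f v * g v) \<in> polynomial_functions smul"

definition zero_locus :: "('v \<Rightarrow> 'k::zero) set \<Rightarrow> 'v set" where
  "zero_locus F = {v. \<forall>f\<in>F. f v = 0}"

definition zariski_topology :: "('k::field \<Rightarrow> 'v::ab_group_add \<Rightarrow> 'v) \<Rightarrow> 'v topology" where
  "zariski_topology smul =
     topology (\<lambda>U. \<exists>F \<subseteq> polynomial_functions smul. - U = zero_locus F)"

lemma istopology_zariski:
  "istopology (\<lambda>U. \<exists>F \<subseteq> polynomial_functions smul. - U = zero_locus F)"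
  unfolding istopology_def
proof (intro conjI allI impI)
  fix S T
  assume "\<exists>F \<subseteq> polynomial_functions smul. - S = zero_locus F"
    and "\<exists>F \<subseteq> polynomial_functions smul. - T = zero_locus F"
  then obtain F G where F: "F \<subseteq> polynomial_functions smul" "- S = zero_locus F"
    and G: "G \<subseteq> polynomial_functions smul" "- T = zero_locus G" by blast
  let ?H = "{\<lambda>v. f v * g v | f g. f \<in> F \<and> g \<in> G}"
  have "?H \<subseteq> polynomial_functions smul"
    using F(1) G(1) by (auto intro: polynomial_functions.mult)
  moreover have "zero_locus ?H = zero_locus F \<union> zero_locus G"
    unfolding zero_locus_def by fastforce
  then have "- (S \<inter> T) = zero_locus ?H"
    using F(2) G(2) by auto
  ultimately show "\<exists>F \<subseteq> polynomial_functions smul. - (S \<inter> T) = zero_locus F" by blast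
next
  fix K
  assume "\<forall>U\<in>K. \<exists>F \<subseteq> polynomial_functions smul. - U = zero_locus F"
  then obtain F where F: "\<And>U. U \<in> K \<Longrightarrow> F U \<subseteq> polynomial_functions smul"
    "\<And>U. U \<in> K \<Longrightarrow> - U = zero_locus (F U)" by metis
  have "- \<Union>K = zero_locus (\<Union>(F ` K))"
    using F(2) unfolding zero_locus_def by blast
  then show "\<exists>F \<subseteq> polynomial_functions smul. - \<Union>K = zero_locus F"
    using F(1) by (metis UN_least)
qed

lemma closedin_zariski:
  "closedin (zariski_topology smul) C \<longleftrightarrow>
     (\<exists>F \<subseteq> polynomial_functions smul. C = zero_locus F)"
proof -
  have o: "openin (zariski_topology smul) U \<longleftrightarrow>
      (\<exists>F \<subseteq> polynomial_functions smul. - U = zero_locus F)" for U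
    unfolding zariski_topology_def by (simp add: topology_inverse'[OF istopology_zariski])
  have "openin (zariski_topology smul) UNIV"
    unfolding o
    by (rule exI[of _ "{\<lambda>_. 1}"]) (auto simp: zero_locus_def intro: polynomial_functions.const)
  then have t: "topspace (zariski_topology smul) = UNIV"
    using openin_subset by blast
  show ?thesis
    unfolding closedin_def t o by (simp add: Compl_eq_Diff_UNIV[symmetric])
qed

definition reducible_space :: "'a topology \<Rightarrow> bool" where
  "reducible_space X \<longleftrightarrow>
     (\<exists>C D. closedin X C \<and> closedin X D \<and> C \<noteq> topspace X \<and> D \<noteq> topspace X \<and>
            topspace X = C \<union> D)"

section \<open>Lie algebras and commuting varieties\<close>

text \<open>The Lie algebra is a subspace \<open>L\<close> of an ambient space; the bracket is only relevant on \<open>L\<close>.\<close>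

locale lie_algebra = vector_space smul
  for smul :: "'k::field \<Rightarrow> 'v::ab_group_add \<Rightarrow> 'v" +
  fixes L :: "'v set" and br :: "'v \<Rightarrow> 'v \<Rightarrow> 'v"
  assumes subspace_carrier: "subspace L"
    and br_closed: "x \<in> L \<Longrightarrow> y \<in> L \<Longrightarrow> br x y \<in> L"
    and br_add_left: "x \<in> L \<Longrightarrow> y \<in> L \<Longrightarrow> z \<in> L \<Longrightarrow> br (x + y) z = br x z + br y z"
    and br_add_right: "x \<in> L \<Longrightarrow> y \<in> L \<Longrightarrow> z \<in> L \<Longrightarrow> br x (y + z) = br x y + br x z"
    and br_scale_left: "x \<in> L \<Longrightarrow> y \<in> L \<Longrightarrow> br (smul c x) y = smul c (br x y)"
    and br_scale_right: "x \<in> L \<Longrightarrow> y \<in> L \<Longrightarrow> br x (smul c y) = smul c (br x y)"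
    and br_self: "x \<in> L \<Longrightarrow> br x x = 0"
    and jacobi: "x \<in> L \<Longrightarrow> y \<in> L \<Longrightarrow> z \<in> L \<Longrightarrow>
      br x (br y z) + br y (br z x) + br z (br x y) = 0"

definition lie_isomorphism ::
  "('k \<Rightarrow> 'v::ab_group_add \<Rightarrow> 'v) \<Rightarrow> 'v set \<Rightarrow> ('v \<Rightarrow> 'v \<Rightarrow> 'v) \<Rightarrow>
   ('k \<Rightarrow> 'w::ab_group_add \<Rightarrow> 'w) \<Rightarrow> 'w set \<Rightarrow> ('w \<Rightarrow> 'w \<Rightarrow> 'w) \<Rightarrow> ('v \<Rightarrow> 'w) \<Rightarrow> bool" where
  "lie_isomorphism smul L br smul' L' br' f \<longleftrightarrow>
     bij_betw f L L' \<and>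
     (\<forall>x\<in>L. \<forall>y\<in>L. f (x + y) = f x + f y) \<and>
     (\<forall>c. \<forall>x\<in>L. f (smul c x) = smul' c (f x)) \<and>
     (\<forall>x\<in>L. \<forall>y\<in>L. f (br x y) = br' (f x) (f y))"

definition involutory_automorphism ::
  "('k \<Rightarrow> 'v::ab_group_add \<Rightarrow> 'v) \<Rightarrow> 'v set \<Rightarrow> ('v \<Rightarrow> 'v \<Rightarrow> 'v) \<Rightarrow> ('v \<Rightarrow> 'v) \<Rightarrow> bool" where
  "involutory_automorphism smul L br \<sigma> \<longleftrightarrow>
     lie_isomorphism smul L br smul L br \<sigma> \<and> (\<forall>x\<in>L. \<sigma> (\<sigma> x) = x)"

definition plus_part :: "'v set \<Rightarrow> ('v \<Rightarrow> 'v) \<Rightarrow> 'v set" where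
  "plus_part L \<sigma> = {x \<in> L. \<sigma> x = x}"

definition minus_part :: "'v::uminus set \<Rightarrow> ('v \<Rightarrow> 'v) \<Rightarrow> 'v set" where
  "minus_part L \<sigma> = {x \<in> L. \<sigma> x = - x}"

definition commuting_variety :: "('v \<Rightarrow> 'v \<Rightarrow> 'v::zero) \<Rightarrow> 'v set \<Rightarrow> ('v \<times> 'v) set" where
  "commuting_variety br M = {(x, y). x \<in> M \<and> y \<in> M \<and> br x y = 0}"

definition pair_scale ::
  "('k \<Rightarrow> 'v \<Rightarrow> 'v) \<Rightarrow> ('k \<Rightarrow> 'w \<Rightarrow> 'w) \<Rightarrow> 'k \<Rightarrow> 'v \<times> 'w \<Rightarrow> 'v \<times> 'w" where
  "pair_scale s t c p = (s c (fst p), t c (snd p))"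

definition commuting_variety_reducible ::
  "('k::field \<Rightarrow> 'v::ab_group_add \<Rightarrow> 'v) \<Rightarrow> ('v \<Rightarrow> 'v \<Rightarrow> 'v) \<Rightarrow> 'v set \<Rightarrow> bool" where
  "commuting_variety_reducible smul br M \<longleftrightarrow>
     reducible_space (subtopology (zariski_topology (pair_scale smul smul))
       (commuting_variety br M))"

section \<open>Matrix Lie algebras\<close>

definition mat_scale :: "'k::times \<Rightarrow> 'k^'a::finite^'b::finite \<Rightarrow> 'k^'a^'b" where
  "mat_scale c X = (\<chi> i j. c * X $ i $ j)"

definition commutator :: "'k::ring_1^'a::finite^'a \<Rightarrow> 'k^'a^'a \<Rightarrow> 'k^'a^'a" where
  "commutator X Y = X ** Y - Y ** X"

definition conjugation :: "'k::semiring_1^'a::finite^'a \<Rightarrow> 'k^'a^'a \<Rightarrow> 'k^'a^'a" where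
  "conjugation S X = S ** X ** matrix_inv S"

definition sl_algebra :: "('k::field^'a::finite^'a) set" where
  "sl_algebra = {X. trace X = 0}"

definition block_sign_matrix :: "'k::field^('n::finite + 'm::finite)^('n + 'm)" where
  "block_sign_matrix =
     (\<chi> i j. if i = j then (case i of Inl _ \<Rightarrow> - 1 | Inr _ \<Rightarrow> 1) else 0)"

definition nondegenerate_symmetric_form :: "('k::field^'a::finite \<Rightarrow> 'k^'a \<Rightarrow> 'k) \<Rightarrow> bool" where
  "nondegenerate_symmetric_form B \<longleftrightarrow>
     (\<forall>u. Vector_Spaces.linear (*s) (*) (B u)) \<and>
     (\<forall>u v. B u v = B v u) \<and>
     (\<forall>u. (\<forall>v. B u v = 0) \<longrightarrow> u = 0)"

definition so_algebra :: "('k::field^'a::finite \<Rightarrow> 'k^'a \<Rightarrow> 'k) \<Rightarrow> ('k^'a^'a) set" where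
  "so_algebra B = {X. \<forall>u v. B (X *v u) v + B u (X *v v) = 0}"

definition isotropic_subspace ::
  "('k::field^'a::finite \<Rightarrow> 'k^'a \<Rightarrow> 'k) \<Rightarrow> ('k^'a) set \<Rightarrow> bool" where
  "isotropic_subspace B W \<longleftrightarrow> vec.subspace W \<and> (\<forall>u\<in>W. \<forall>v\<in>W. B u v = 0)"

definition dot_form :: "'k::field^'a::finite \<Rightarrow> 'k^'a \<Rightarrow> 'k" where
  "dot_form u v = (\<Sum>i\<in>UNIV. u $ i * v $ i)"

lemma vector_space_mat_scale:
  "vector_space (mat_scale :: 'k::field \<Rightarrow> 'k^'a::finite^'b::finite \<Rightarrow> 'k^'a^'b)"
  by (simp add: vector_space_def mat_scale_def vec_eq_iff distrib_left distrib_right mult.assoc)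

lemma mat_scale_mult:
  fixes X :: "'k::field^'a::finite^'b::finite" and Y :: "'k^'c::finite^'a"
  shows "mat_scale c X ** Y = mat_scale c (X ** Y)" "X ** mat_scale c Y = mat_scale c (X ** Y)"
  by (simp_all add: mat_scale_def matrix_matrix_mult_def vec_eq_iff sum_distrib_left mult_ac)

lemma mat_scale_mult_vec:
  fixes X :: "'k::field^'a::finite^'b::finite"
  shows "mat_scale c X *v u = c *s (X *v u)"
  by (simp add: mat_scale_def matrix_vector_mult_def vec_eq_iff sum_distrib_left mult_ac)

lemma lie_algebra_matrices:
  fixes L :: "('k::field^'a::finite^'a) set"
  assumes L: "module.subspace mat_scale L"
    and closed: "\<And>X Y. X \<in> L \<Longrightarrow> Y \<in> L \<Longrightarrow> commutator X Y \<in> L"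
  shows "lie_algebra mat_scale L commutator"
proof -
  interpret M: vector_space "mat_scale :: 'k \<Rightarrow> 'k^'a^'a \<Rightarrow> 'k^'a^'a"
    by (rule vector_space_mat_scale)
  have add: "(X + Y) ** Z = X ** Z + Y ** Z" "Z ** (X + Y) = Z ** X + Z ** Y"
    for X Y Z :: "'k^'a^'a"
    by (simp_all add: matrix_matrix_mult_def vec_eq_iff sum.distrib distrib_left distrib_right)
  have sub: "(X - Y) ** Z = X ** Z - Y ** Z" "Z ** (X - Y) = Z ** X - Z ** Y"
    for X Y Z :: "'k^'a^'a"
    by (simp_all add: matrix_matrix_mult_def vec_eq_iff sum_subtractf left_diff_distrib
        right_diff_distrib)
  show ?thesis
    by unfold_locales
      (simp_all add: L closed[unfolded commutator_def] commutator_def add sub mat_scale_mult M.scale_right_diff_distrib matrix_mul_assoc)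
qed

lemma lie_algebra_sl:
  "lie_algebra mat_scale (sl_algebra :: ('k::field^'a::finite^'a) set) commutator"
proof (rule lie_algebra_matrices)
  interpret M: vector_space "mat_scale :: 'k \<Rightarrow> 'k^'a^'a \<Rightarrow> 'k^'a^'a"
    by (rule vector_space_mat_scale)
  show "M.subspace (sl_algebra :: ('k^'a^'a) set)"
    by (rule M.subspaceI)
      (simp_all add: sl_algebra_def trace_def mat_scale_def sum.distrib sum_distrib_left[symmetric])
  fix X Y :: "'k^'a^'a"
  show "commutator X Y \<in> sl_algebra"
    using trace_mul_sym[of X Y] by (simp add: sl_algebra_def commutator_def trace_sub)
qed

lemma lie_algebra_so:
  fixes B :: "'k::field^'a::finite \<Rightarrow> 'k^'a \<Rightarrow> 'k"
  assumes "nondegenerate_symmetric_form B"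
  shows "lie_algebra mat_scale (so_algebra B) commutator"
proof (rule lie_algebra_matrices)
  interpret M: vector_space "mat_scale :: 'k \<Rightarrow> 'k^'a^'a \<Rightarrow> 'k^'a^'a"
    by (rule vector_space_mat_scale)
  have lin: "Vector_Spaces.linear (*s) (*) (B u)" and sym: "B u v = B v u" for u v
    using assms by (auto simp: nondegenerate_symmetric_form_def)
  have r: "B u (v + w) = B u v + B u w" "B u (c *s v) = c * B u v" for u v w c
    using lin[of u] by (simp_all add: Vector_Spaces.linear_def module_hom_def module_hom_axioms_def)
  have l: "B (v + w) u = B v u + B w u" "B (c *s v) u = c * B v u" for u v w c
    using r sym by metis+
  have d: "B (v - w) u = B v u - B w u" "B u (v - w) = B u v - B u w" for u v w
    using l(1)[of "v - w" w u] r(1)[of u "v - w" w] by simp_all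
  show "M.subspace (so_algebra B)"
  proof (rule M.subspaceI, goal_cases)
    case 1
    have "B 0 v = 0" "B v 0 = 0" for v
      using l(2)[of 0 0 v] r(2)[of v 0 0] by simp_all
    then show ?case by (simp add: so_algebra_def)
  next
    case (2 X Y)
    have "B ((X + Y) *v u) v + B u ((X + Y) *v v) =
        (B (X *v u) v + B u (X *v v)) + (B (Y *v u) v + B u (Y *v v))" for u v
      by (simp add: matrix_vector_mult_add_rdistrib l r)
    with 2 show ?case by (simp add: so_algebra_def)
  next
    case (3 c X)
    have "B (mat_scale c X *v u) v + B u (mat_scale c X *v v) =
        c * (B (X *v u) v + B u (X *v v))" for u v
      by (simp add: mat_scale_mult_vec l r distrib_left)
    with 3 show ?case by (simp add: so_algebra_def)
  qed
  fix X Y assume "X \<in> so_algebra B" "Y \<in> so_algebra B"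
  then have *: "B (X *v u) v = - B u (X *v v)" "B (Y *v u) v = - B u (Y *v v)" for u v
    by (simp_all add: so_algebra_def eq_neg_iff_add_eq_0)
  have "commutator X Y *v u = X *v (Y *v u) - Y *v (X *v u)" for u
    by (simp add: commutator_def matrix_vector_mult_diff_rdistrib matrix_vector_mul_assoc)
  then show "commutator X Y \<in> so_algebra B"
    by (simp add: so_algebra_def d *)
qed

text \<open>
  The direct sum \<open>so\<^sub>1\<^sub>0 \<oplus> t\<^sub>1\<close>. As a Lie algebra the one-dimensional torus is the ground field with
  zero bracket.
\<close>

definition so10_t1_carrier :: "(('k::field^10^10) \<times> 'k) set" where
  "so10_t1_carrier = so_algebra dot_form \<times> UNIV"

definition so10_t1_bracket :: "('k::field^10^10) \<times> 'k \<Rightarrow> ('k^10^10) \<times> 'k \<Rightarrow> ('k^10^10) \<times> 'k" where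
  "so10_t1_bracket x y = (commutator (fst x) (fst y), 0)"

definition so10_t1_scale :: "'k::field \<Rightarrow> ('k^10^10) \<times> 'k \<Rightarrow> ('k^10^10) \<times> 'k" where
  "so10_t1_scale = pair_scale mat_scale (*)"

section \<open>The simple Lie algebra of type \<open>E\<^sub>6\<close>\<close>

context lie_algebra
begin

definition ideal :: "'v set \<Rightarrow> bool" where
  "ideal I \<longleftrightarrow> subspace I \<and> I \<subseteq> L \<and> (\<forall>x\<in>L. \<forall>y\<in>I. br x y \<in> I)"

definition simple :: bool where
  "simple \<longleftrightarrow> (\<exists>x\<in>L. \<exists>y\<in>L. br x y \<noteq> 0) \<and> (\<forall>I. ideal I \<longrightarrow> I = {0} \<or> I = L)"

definition finite_dimensional :: bool where
  "finite_dimensional \<longleftrightarrow> (\<exists>S. finite S \<and> L = span S)"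

text \<open>
  Cartan subalgebras of semisimple Lie algebras over an algebraically closed field of
  characteristic zero: self-centralizing abelian subalgebras consisting of elements \<open>h\<close> with
  diagonalizable \<open>ad h\<close>.
\<close>

definition cartan_subalgebra :: "'v set \<Rightarrow> bool" where
  "cartan_subalgebra H \<longleftrightarrow>
     subspace H \<and> H \<subseteq> L \<and>
     (\<forall>h\<in>H. \<forall>h'\<in>H. br h h' = 0) \<and>
     (\<forall>x\<in>L. (\<forall>h\<in>H. br h x = 0) \<longrightarrow> x \<in> H) \<and>
     (\<forall>h\<in>H. span {x \<in> L. \<exists>c. br h x = smul c x} = L)"

text \<open>Functionals on \<open>H\<close> are represented by functions whose values outside \<open>H\<close> are irrelevant.\<close>

definition root :: "'v set \<Rightarrow> ('v \<Rightarrow> 'k) \<Rightarrow> bool" where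
  "root H \<beta> \<longleftrightarrow>
     (\<exists>h\<in>H. \<beta> h \<noteq> 0) \<and> (\<exists>x\<in>L. x \<noteq> 0 \<and> (\<forall>h\<in>H. br h x = smul (\<beta> h) x))"

end

text \<open>Bourbaki's labelling of the Dynkin diagram by \<open>1, \<dots>, 6\<close>.\<close>

definition E6_edges :: "(nat \<times> nat) set" where
  "E6_edges = {(1, 3), (3, 4), (4, 5), (5, 6), (2, 4)}"

definition E6_cartan :: "nat \<Rightarrow> nat \<Rightarrow> int" where
  "E6_cartan i j =
     (if i = j then 2 else if (i, j) \<in> E6_edges \<or> (j, i) \<in> E6_edges then - 1 else 0)"

text \<open>
  The root system of type \<open>E\<^sub>6\<close> in coordinates with respect to its simple roots: the orbits of the
  simple roots under the simple reflections \<open>\<beta> \<mapsto> \<beta> - \<langle>\<beta>, \<alpha>\<^sub>i\<^sup>\<or>\<rangle> \<alpha>\<^sub>i\<close> (the Cartan matrix is symmetric).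
\<close>

inductive_set E6_roots :: "(nat \<Rightarrow> int) set" where
  simple_root: "i \<in> {1..6} \<Longrightarrow> (\<lambda>j. of_bool (j = i)) \<in> E6_roots"
| reflection: "m \<in> E6_roots \<Longrightarrow> i \<in> {1..6} \<Longrightarrow>
    m(i := m i - (\<Sum>j = 1..6. m j * E6_cartan i j)) \<in> E6_roots"

text \<open>
  The root system with respect to \<open>H\<close> is of type \<open>E\<^sub>6\<close> if mapping the simple roots to suitable
  linearly independent functionals \<open>\<alpha> 1, \<dots>, \<alpha> 6\<close> identifies it with \<open>E6_roots\<close>.
\<close>

definition (in lie_algebra) roots_of_type_E6 :: "'v set \<Rightarrow> bool" where
  "roots_of_type_E6 H \<longleftrightarrow>
     (\<exists>\<alpha> :: nat \<Rightarrow> 'v \<Rightarrow> 'k.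
        (\<forall>c. (\<forall>h\<in>H. (\<Sum>i = 1..6. c i * \<alpha> i h) = 0) \<longrightarrow> (\<forall>i\<in>{1..6}. c i = 0)) \<and>
        (\<forall>\<beta>. root H \<beta> \<longleftrightarrow>
               (\<exists>m\<in>E6_roots. \<forall>h\<in>H. \<beta> h = (\<Sum>i = 1..6. of_int (m i) * \<alpha> i h))))"

definition simple_lie_algebra_E6 ::
  "('k::field \<Rightarrow> 'v::ab_group_add \<Rightarrow> 'v) \<Rightarrow> 'v set \<Rightarrow> ('v \<Rightarrow> 'v \<Rightarrow> 'v) \<Rightarrow> bool" where
  "simple_lie_algebra_E6 smul L br \<longleftrightarrow>
     lie_algebra smul L br \<and>
     lie_algebra.finite_dimensional smul L \<and>
     lie_algebra.simple smul L br \<and>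
     (\<exists>H. lie_algebra.cartan_subalgebra smul L br H \<and>
          lie_algebra.roots_of_type_E6 smul L br H)"

end

theory Submission
  imports Defs
begin

text \<open>
  In each of the three symmetric pairs, \<open>g\<^sub>1\<close> is the sum of two subspaces \<open>V\<^sub>+\<close> and \<open>V\<^sub>-\<close> with
  \<open>[V\<^sub>+, V\<^sub>+] = [V\<^sub>-, V\<^sub>-] = 0\<close>: the eigenspaces of a central element of \<open>g\<^sub>0\<close>. So \<open>V\<^sub>+ \<times> V\<^sub>+\<close> lies in the commuting
  variety, and reducibility follows once it contains a nonempty open subset of that variety, because
  the pairs whose first component is not in \<open>V\<^sub>+\<close> form another one. A pair with plus parts \<open>a, a'\<close> and minus
  parts \<open>\<xi>, \<eta>\<close> commutes iff \<open>[\<xi>, a'] + [a, \<eta>] = 0\<close>. If \<open>(\<xi>, \<eta>) \<mapsto> [\<xi>, a'] + [a, \<eta>]\<close> is injective for one pair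
  \<open>(a, a')\<close>, which means that \<open>g\<^sub>0\<close> has an open orbit on \<open>V\<^sub>+ \<times> V\<^sub>+\<close>, then it is injective for all pairs in a
  neighbourhood, and there the minus parts of a commuting pair vanish. This is
  \<open>graded_commuting_variety_reducible\<close>; it remains to find \<open>(a, a')\<close>.

  For \<open>sl\<^sub>n\<^sub>+\<^sub>m\<close> take \<open>V\<^sub>+\<close> to be the maps from the smaller block to the larger one; \<open>a\<close> and \<open>a'\<close> embed the smaller
  block as the first and as the last coordinates (\<open>block_commuting_variety_reducible\<close>). For \<open>so\<^sub>2\<^sub>n\<close> the space
  \<open>V\<^sub>+\<close> consists of skew forms in an odd number \<open>n\<close> of variables, and \<open>a\<close>, \<open>a'\<close> is a generic pencil of them in
  Kronecker's normal form (\<open>commuting_variety_reducible_polarized\<close>).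

  For \<open>E\<^sub>6\<close> the module \<open>V\<^sub>+\<close> is a half-spin representation of \<open>so\<^sub>1\<^sub>0\<close>, which has to be derived from the abstract
  hypotheses. The Cartan subalgebra provides an element with integral eigenvalues; it shows that the
  Killing form is nondegenerate and that the dimension is at least \<open>67\<close> (\<open>integral_element\<close>). By simplicity,
  the square of \<open>ad z\<close> is a scalar on \<open>g\<^sub>1\<close>, where \<open>z\<close> spans the centre of \<open>g\<^sub>0\<close> (\<open>ad_z_square\<close>), and the Killing form
  excludes the scalar \<open>0\<close>; this yields \<open>V\<^sub>+\<close> and \<open>V\<^sub>-\<close>, both irreducible. A short computation with
  a weight vector in \<open>V\<^sub>+\<close>, its dual in \<open>V\<^sub>-\<close> and a root vector shows that the inner
  products of a weight with the roots of \<open>so\<^sub>1\<^sub>0\<close> are among \<open>0\<close>, \<open>d\<close>, \<open>-d\<close> for some \<open>d\<close> (\<open>weight_trichotomy\<close>). Hence the weights are zero, or those of the vector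
  representation, or half-spin weights (\<open>zero_or_vector_or_spin\<close>). The first two cases
  give dimension at most \<open>66\<close>. In the half-spin case, \<open>a\<close> and \<open>a'\<close> are sums of two weight vectors each, chosen so that
  every other weight is reached from exactly one of the four by a root that kills the other
  three (\<open>reach_table\<close>); this makes the injectivity independent of structure constants.
\<close>

section \<open>Linear functionals and the criterion for reducibility\<close>

context vector_space
begin

lemma vector_space_pair_self: "vector_space_pair scale ((*) :: 'a \<Rightarrow> 'a \<Rightarrow> 'a)"
  by (intro vector_space_pair.intro vector_space_axioms vector_space_over_itself.vector_space_axioms)

lemma functional_iff:
  "Vector_Spaces.linear scale (*) f \<longleftrightarrow> (\<forall>x y. f (x + y) = f x + f y) \<and> (\<forall>c x. f (scale c x) = c * f x)"
  by (auto simp: Vector_Spaces.linear_iff vector_space_axioms vector_space_over_itself.vector_space_axioms)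

lemma extend_functional:
  assumes W: "subspace W"
    and add: "\<And>x y. x \<in> W \<Longrightarrow> y \<in> W \<Longrightarrow> f (x + y) = f x + f y"
    and hom: "\<And>c x. x \<in> W \<Longrightarrow> f (scale c x) = c * f x"
  obtains g where "Vector_Spaces.linear scale (*) g" "\<And>x. x \<in> W \<Longrightarrow> g x = f x"
proof -
  obtain B where B: "B \<subseteq> W" "independent B" "W \<subseteq> span B"
    using basis_exists[of W] by metis
  obtain g where g: "Vector_Spaces.linear scale (*) g" "\<And>x. x \<in> B \<Longrightarrow> g x = f x"
    using vector_space_pair.linear_independent_extend[OF vector_space_pair_self B(2)] by metis
  interpret l: Vector_Spaces.linear scale "(*)" g by (rule g(1))
  have "x \<in> W \<and> g x = f x" if "x \<in> span B" for x
    using that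
  proof (induction rule: span_induct_alt)
    case base
    have "f 0 = 0" using hom[of 0 0] W by (simp add: subspace_0)
    then show ?case using W l.zero by (simp add: subspace_0)
  next
    case (step c x y)
    then have "x \<in> W" "y \<in> W" "scale c x \<in> W" using B W by (auto simp: subspace_scale)
    with step g W show ?case
      by (simp add: l.add l.scale add hom subspace_add)
  qed
  then show thesis using that[of g] g(1) B(3) by blast
qed

lemma separating_functional:
  assumes "v \<noteq> 0"
  obtains g where "Vector_Spaces.linear scale (*) g" "g v \<noteq> 0"
proof -
  have "independent {v}" using assms by simp
  then obtain g where "Vector_Spaces.linear scale (*) g" "\<forall>x\<in>{v}. g x = 1"
    using vector_space_pair.linear_independent_extend[OF vector_space_pair_self, of "{v}" "\<lambda>_. 1"] by blast
  then show thesis using that by auto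
qed

end

text \<open>
  Linear independence is an open condition. Gaussian elimination replaces the usual argument with
  minors: the vector \<open>v n\<close> is eliminated from the others by means of a functional that does not vanish
  on it, and this functional contributes one factor of \<open>P\<close>.
\<close>

lemma independence_open:
  fixes sw :: "'k::field \<Rightarrow> 'w::ab_group_add \<Rightarrow> 'w" and sp :: "'k \<Rightarrow> 'p::ab_group_add \<Rightarrow> 'p"
    and v :: "'i \<Rightarrow> 'p \<Rightarrow> 'w"
  assumes sw: "vector_space sw"
    and "finite I"
    and "\<And>i l. i \<in> I \<Longrightarrow> Vector_Spaces.linear sw (*) l \<Longrightarrow>
           \<exists>P\<in>polynomial_functions sp. \<forall>p\<in>M. P p = l (v i p)"
    and "p0 \<in> M"
    and "\<And>c. (\<Sum>i\<in>I. sw (c i) (v i p0)) = 0 \<Longrightarrow> \<forall>i\<in>I. c i = 0"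
  shows "\<exists>P\<in>polynomial_functions sp. P p0 \<noteq> 0 \<and>
    (\<forall>p\<in>M. P p \<noteq> 0 \<longrightarrow> (\<forall>c. (\<Sum>i\<in>I. sw (c i) (v i p)) = 0 \<longrightarrow> (\<forall>i\<in>I. c i = 0)))"
  using assms(2,3,5)
proof (induction I arbitrary: v rule: finite_induct)
  case empty
  show ?case by (rule bexI[of _ "\<lambda>_. 1"]) (auto intro: polynomial_functions.const)
next
  case (insert n I)
  interpret vector_space sw by (rule sw)
  have "v n p0 \<noteq> 0"
  proof
    assume "v n p0 = 0"
    then have "(\<Sum>i\<in>insert n I. sw (if i = n then 1 else 0) (v i p0)) = 0"
      using insert.hyps by (simp add: sum.neutral)
    then show False using insert.prems(2)[of "\<lambda>i. if i = n then 1 else 0"] by auto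
  qed
  then obtain l where l: "Vector_Spaces.linear sw (*) l" "l (v n p0) \<noteq> 0" by (rule separating_functional)
  interpret l: Vector_Spaces.linear sw "(*)" l by (rule l(1))
  define w where "w = (\<lambda>i p. sw (l (v n p)) (v i p) - sw (l (v i p)) (v n p))"
  obtain Pn where Pn: "Pn \<in> polynomial_functions sp" "\<And>p. p \<in> M \<Longrightarrow> Pn p = l (v n p)"
    using insert.prems(1)[OF _ l(1), of n] by auto
  have elim: "(\<Sum>i\<in>insert n I. sw (if i = n then - (\<Sum>i\<in>I. c i * l (v i p)) else l (v n p) * c i) (v i p))
      = (\<Sum>i\<in>I. sw (c i) (w i p))" for c p
  proof -
    have "(\<Sum>i\<in>insert n I. sw (if i = n then - (\<Sum>i\<in>I. c i * l (v i p)) else l (v n p) * c i) (v i p))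
      = - sw (\<Sum>i\<in>I. c i * l (v i p)) (v n p) + (\<Sum>i\<in>I. sw (l (v n p) * c i) (v i p))"
      using insert.hyps by (auto intro!: sum.cong)
    also have "\<dots> = (\<Sum>i\<in>I. sw (l (v n p) * c i) (v i p)) - (\<Sum>i\<in>I. sw (c i * l (v i p)) (v n p))"
      by (simp add: scale_sum_left)
    also have "\<dots> = (\<Sum>i\<in>I. sw (c i) (w i p))"
      by (simp add: w_def sum_subtractf scale_right_diff_distrib mult.commute)
    finally show ?thesis .
  qed
  have "\<exists>P\<in>polynomial_functions sp. P p0 \<noteq> 0 \<and>
    (\<forall>p\<in>M. P p \<noteq> 0 \<longrightarrow> (\<forall>c. (\<Sum>i\<in>I. sw (c i) (w i p)) = 0 \<longrightarrow> (\<forall>i\<in>I. c i = 0)))"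
  proof (rule insert.IH)
    fix i l' assume i: "i \<in> I" and l': "Vector_Spaces.linear sw (*) l'"
    interpret l': Vector_Spaces.linear sw "(*)" l' by (rule l')
    obtain A where A: "A \<in> polynomial_functions sp" "\<And>p. p \<in> M \<Longrightarrow> A p = l' (v i p)"
      using insert.prems(1)[OF _ l', of i] i by auto
    obtain B where B: "B \<in> polynomial_functions sp" "\<And>p. p \<in> M \<Longrightarrow> B p = l (v i p)"
      using insert.prems(1)[OF _ l(1), of i] i by auto
    obtain C where C: "C \<in> polynomial_functions sp" "\<And>p. p \<in> M \<Longrightarrow> C p = l' (v n p)"
      using insert.prems(1)[OF _ l', of n] by auto
    show "\<exists>P\<in>polynomial_functions sp. \<forall>p\<in>M. P p = l' (w i p)"
    proof (rule bexI, rule ballI)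
      show "(\<lambda>p. Pn p * A p + (- 1) * (B p * C p)) \<in> polynomial_functions sp"
        by (intro polynomial_functions.add polynomial_functions.mult polynomial_functions.const Pn A B C)
      fix p assume "p \<in> M"
      then show "Pn p * A p + (- 1) * (B p * C p) = l' (w i p)"
        by (simp add: w_def l'.diff l'.scale A B C Pn)
    qed
  next
    fix c assume "(\<Sum>i\<in>I. sw (c i) (w i p0)) = 0"
    then have "\<forall>i\<in>insert n I. (if i = n then - (\<Sum>i\<in>I. c i * l (v i p0)) else l (v n p0) * c i) = 0"
      by (intro insert.prems(2)) (simp only: elim)
    then show "\<forall>i\<in>I. c i = 0" using l(2) insert.hyps by (auto split: if_splits)
  qed
  then obtain P where P: "P \<in> polynomial_functions sp" "P p0 \<noteq> 0"
    "\<And>p c. p \<in> M \<Longrightarrow> P p \<noteq> 0 \<Longrightarrow> (\<Sum>i\<in>I. sw (c i) (w i p)) = 0 \<Longrightarrow> \<forall>i\<in>I. c i = 0" by blast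
  show ?case
  proof (intro bexI[of _ "\<lambda>p. Pn p * P p"] conjI ballI impI allI)
    show "(\<lambda>p. Pn p * P p) \<in> polynomial_functions sp" by (intro polynomial_functions.mult Pn P)
    show "Pn p0 * P p0 \<noteq> 0" using Pn P l assms(4) by simp
    fix p c i assume p: "p \<in> M" "Pn p * P p \<noteq> 0"
      and 0: "(\<Sum>i\<in>insert n I. sw (c i) (v i p)) = 0" and i: "i \<in> insert n I"
    let ?a = "l (v n p)"
    have a: "?a \<noteq> 0" "P p \<noteq> 0" using p Pn by auto
    have "l (\<Sum>i\<in>insert n I. sw (c i) (v i p)) = 0" by (simp only: 0 l.zero)
    then have n: "?a * c n = - (\<Sum>i\<in>I. c i * l (v i p))"
      using insert.hyps by (simp add: l.add l.sum l.scale eq_neg_iff_add_eq_0 mult.commute)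
    have "(\<Sum>i\<in>I. sw (c i) (w i p)) =
        (\<Sum>i\<in>insert n I. sw (if i = n then ?a * c n else ?a * c i) (v i p))"
      unfolding n by (simp only: elim)
    also have "\<dots> = sw ?a (\<Sum>i\<in>insert n I. sw (c i) (v i p))"
      unfolding scale_sum_right by (rule sum.cong) auto
    finally have "\<forall>i\<in>I. c i = 0" using P(3)[OF p(1) a(2)] 0 by simp
    moreover from this have "c n = 0" using n a by simp
    ultimately show "c i = 0" using i by auto
  qed
qed

lemma vector_space_pair_scale:
  assumes "vector_space s" "vector_space t"
  shows "vector_space (pair_scale s t)"
  using assms by (auto simp: vector_space_def pair_scale_def)

text \<open>
  On a pair whose first and second components have plus parts \<open>x\<close> and \<open>y\<close>, commuting means that the
  minus parts \<open>\<xi>\<close>, \<open>\<eta>\<close> satisfy \<open>[\<xi>, y] + [x, \<eta>] = 0\<close>. This map of \<open>(\<xi>, \<eta>)\<close> is injective for \<open>(x, y)\<close> in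
  an open set that contains \<open>(a, a')\<close>; so on this open set a commuting pair has no minus parts at all.
  The open set of pairs whose first minus part is not zero is thus disjoint from it, and
  neither is empty.
\<close>

lemma (in lie_algebra) graded_commuting_variety_reducible:
  assumes Vp: "subspace Vp" "Vp \<subseteq> L" and Vm: "subspace Vm" "Vm \<subseteq> L"
    and int0: "Vp \<inter> Vm = {0}"
    and ab_p: "\<And>x y. x \<in> Vp \<Longrightarrow> y \<in> Vp \<Longrightarrow> br x y = 0"
    and ab_m: "\<And>x y. x \<in> Vm \<Longrightarrow> y \<in> Vm \<Longrightarrow> br x y = 0"
    and fin: "finite S" "Vm \<subseteq> span S" and ne: "Vm \<noteq> {0}"
    and a: "a \<in> Vp" "a' \<in> Vp"
    and inj: "\<And>\<xi> \<eta>. \<xi> \<in> Vm \<Longrightarrow> \<eta> \<in> Vm \<Longrightarrow> br \<xi> a' + br a \<eta> = 0 \<Longrightarrow> \<xi> = 0 \<and> \<eta> = 0"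
    and M: "M = {x + y | x y. x \<in> Vp \<and> y \<in> Vm}"
  shows "commuting_variety_reducible smul br M"
proof -
  let ?sp = "pair_scale smul smul"
  let ?C = "commuting_variety br M"
  have vp: "vector_space ?sp" by (intro vector_space_pair_scale vector_space_axioms)
  interpret pp: vector_space ?sp by (rule vp)
  have M_sub: "subspace M" unfolding M by (intro subspace_sums Vp Vm)
  have M_L: "M \<subseteq> L"
    using Vp Vm subspace_add[OF subspace_carrier] unfolding M by blast
  define pr where "pr x = (SOME u. u \<in> Vp \<and> x - u \<in> Vm)" for x
  have pr: "pr x \<in> Vp" "x - pr x \<in> Vm" if "x \<in> M" for x
  proof -
    have "\<exists>u. u \<in> Vp \<and> x - u \<in> Vm" using that unfolding M by force
    then show "pr x \<in> Vp" "x - pr x \<in> Vm" unfolding pr_def by (metis (mono_tags, lifting) someI_ex)+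
  qed
  have pr_eq: "pr x = u" if "u \<in> Vp" "x - u \<in> Vm" for x u
  proof -
    have "x = u + (x - u)" by simp
    then have "x \<in> M" using that unfolding M by blast
    note p = pr[OF this]
    have "pr x - u \<in> Vp" using p that Vp subspace_diff by blast
    moreover have "(x - u) - (x - pr x) \<in> Vm" using p that Vm subspace_diff by blast
    moreover have "(x - u) - (x - pr x) = pr x - u" by simp
    ultimately have "pr x - u \<in> Vp \<inter> Vm" by simp
    then show ?thesis using int0 by simp
  qed
  have pr_add: "pr (x + y) = pr x + pr y" if "x \<in> M" "y \<in> M" for x y
  proof (rule pr_eq)
    show "pr x + pr y \<in> Vp" using pr that Vp subspace_add by blast
    have "(x - pr x) + (y - pr y) \<in> Vm" by (intro subspace_add Vm pr that)
    then show "x + y - (pr x + pr y) \<in> Vm" by (simp add: add_diff_add)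
  qed
  have pr_scale: "pr (smul c x) = smul c (pr x)" if "x \<in> M" for c x
  proof (rule pr_eq)
    show "smul c (pr x) \<in> Vp" using pr that Vp subspace_scale by blast
    have "smul c (x - pr x) \<in> Vm" using pr that Vm subspace_scale by blast
    then show "smul c x - smul c (pr x) \<in> Vm" by (simp add: algebra_simps)
  qed
  have linear_fst: "(\<lambda>p. f (fst p)) \<in> polynomial_functions ?sp"
    and linear_snd: "(\<lambda>p. f (snd p)) \<in> polynomial_functions ?sp"
    if "Vector_Spaces.linear smul (*) f" for f
    using that by (auto intro!: polynomial_functions.linear simp: functional_iff pp.functional_iff pair_scale_def)
  have poly_fst: "\<exists>P\<in>polynomial_functions ?sp. \<forall>p\<in>M \<times> M. P p = f (fst p)"
    and poly_snd: "\<exists>P\<in>polynomial_functions ?sp. \<forall>p\<in>M \<times> M. P p = f (snd p)"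
    if lin: "\<And>x y. x \<in> M \<Longrightarrow> y \<in> M \<Longrightarrow> f (x + y) = f x + f y" "\<And>c x. x \<in> M \<Longrightarrow> f (smul c x) = c * f x" for f
  proof -
    obtain g where g: "Vector_Spaces.linear smul (*) g" "\<And>x. x \<in> M \<Longrightarrow> g x = f x"
      by (rule extend_functional[OF M_sub, of f, OF lin]) auto
    show "\<exists>P\<in>polynomial_functions ?sp. \<forall>p\<in>M \<times> M. P p = f (fst p)"
      by (rule bexI[OF _ linear_fst[OF g(1)]]) (auto simp: g(2))
    show "\<exists>P\<in>polynomial_functions ?sp. \<forall>p\<in>M \<times> M. P p = f (snd p)"
      by (rule bexI[OF _ linear_snd[OF g(1)]]) (auto simp: g(2))
  qed
  obtain B where B: "B \<subseteq> Vm" "independent B" "Vm \<subseteq> span B"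
    using basis_exists[of Vm] by metis
  have finB: "finite B"
    using independent_span_bound[OF fin(1) B(2)] B(1) fin(2) by auto
  define v where "v = (\<lambda>i :: 'v + 'v. \<lambda>p :: 'v \<times> 'v.
    case i of Inl b \<Rightarrow> br b (pr (snd p)) | Inr b \<Rightarrow> br (pr (fst p)) b)"
  have sum_v: "(\<Sum>i\<in>B <+> B. smul (c i) (v i p)) =
      br (\<Sum>b\<in>B. smul (c (Inl b)) b) (pr (snd p)) + br (pr (fst p)) (\<Sum>b\<in>B. smul (c (Inr b)) b)"
    if "p \<in> M \<times> M" for c p
  proof -
    have x: "pr (fst p) \<in> L" "pr (snd p) \<in> L" using that pr Vp by auto
    have BL: "b \<in> B \<Longrightarrow> b \<in> L" for b using B Vm by blast
    have sums: "A \<subseteq> B \<Longrightarrow> (\<Sum>b\<in>A. smul (d b) b) \<in> L" for A d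
      by (rule subspace_sum[OF subspace_carrier], rule subspace_scale[OF subspace_carrier]) (auto intro: BL)
    have "br (\<Sum>b\<in>A. smul (d b) b) (pr (snd p)) = (\<Sum>b\<in>A. smul (d b) (br b (pr (snd p))))
      \<and> br (pr (fst p)) (\<Sum>b\<in>A. smul (d b) b) = (\<Sum>b\<in>A. smul (d b) (br (pr (fst p)) b))"
      if "A \<subseteq> B" for d A
      using finite_subset[OF that finB] that
    proof (induction A rule: finite_induct)
      case empty
      have "br 0 (pr (snd p)) = 0" "br (pr (fst p)) 0 = 0"
        using br_scale_left[of 0 _ 0] br_scale_right[of _ 0 0] x subspace_0[OF subspace_carrier] by auto
      then show ?case by simp
    next
      case (insert b A)
      then have "b \<in> L" "smul (d b) b \<in> L" "(\<Sum>b\<in>A. smul (d b) b) \<in> L"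
        using BL sums[of A d] subspace_scale[OF subspace_carrier] by auto
      with insert show ?case
        by (simp add: br_add_left br_add_right br_scale_left br_scale_right x)
    qed
    from this[of B "\<lambda>b. c (Inl b)"] this[of B "\<lambda>b. c (Inr b)"] show ?thesis
      by (simp add: sum.Plus finB v_def)
  qed
  have rep: "\<exists>c. \<xi> = (\<Sum>b\<in>B. smul (c b) b)" if "\<xi> \<in> Vm" for \<xi>
  proof -
    have "\<xi> \<in> range (\<lambda>u. \<Sum>v\<in>B. smul (u v) v)" using that B(3) span_finite[OF finB] by blast
    then show ?thesis by blast
  qed
  have inVm: "(\<Sum>b\<in>B. smul (c b) b) \<in> Vm" for c
    by (rule subspace_sum[OF Vm(1)], rule subspace_scale[OF Vm(1)]) (use B(1) in auto)
  have VM: "Vp \<subseteq> M" "Vm \<subseteq> M"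
    unfolding M using subspace_0[OF Vp(1)] subspace_0[OF Vm(1)] by force+
  have pr_p: "pr x = x" if "x \<in> Vp" for x
    using that pr_eq[of x x] subspace_0[OF Vm(1)] by simp
  have "\<exists>P\<in>polynomial_functions ?sp. P (a, a') \<noteq> 0 \<and>
    (\<forall>p\<in>M \<times> M. P p \<noteq> 0 \<longrightarrow> (\<forall>c. (\<Sum>i\<in>B <+> B. smul (c i) (v i p)) = 0 \<longrightarrow> (\<forall>i\<in>B <+> B. c i = 0)))"
  proof (rule independence_open[OF vector_space_axioms])
    show "finite (B <+> B)" using finB by simp
    show "(a, a') \<in> M \<times> M" using a VM by auto
    fix i l assume i: "i \<in> B <+> B" and l: "Vector_Spaces.linear smul (*) l"
    interpret l: Vector_Spaces.linear smul "(*)" l by (rule l)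
    have L: "x \<in> M \<Longrightarrow> pr x \<in> L" for x using pr Vp by blast
    from i consider b where "i = Inl b" "b \<in> L" | b where "i = Inr b" "b \<in> L"
      using B Vm by blast
    then show "\<exists>P\<in>polynomial_functions ?sp. \<forall>p\<in>M \<times> M. P p = l (v i p)"
    proof cases
      case 1
      then show ?thesis using poly_snd[of "\<lambda>x. l (br b (pr x))"]
        by (simp add: v_def pr_add pr_scale br_add_right br_scale_right L l.add l.scale)
    next
      case 2
      then show ?thesis using poly_fst[of "\<lambda>x. l (br (pr x) b)"]
        by (simp add: v_def pr_add pr_scale br_add_left br_scale_left L l.add l.scale)
    qed
  next
    fix c assume "(\<Sum>i\<in>B <+> B. smul (c i) (v i (a, a'))) = 0"
    then have "(\<Sum>b\<in>B. smul (c (Inl b)) b) = 0 \<and> (\<Sum>b\<in>B. smul (c (Inr b)) b) = 0"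
      using a subsetD[OF VM(1) a(1)] subsetD[OF VM(1) a(2)]
      by (intro inj inVm) (simp add: sum_v pr_p)
    then have "c (Inl b) = 0" "c (Inr b) = 0" if "b \<in> B" for b
      using independentD[OF B(2) finB subset_refl _ that, of "\<lambda>b. c (Inl b)"]
        independentD[OF B(2) finB subset_refl _ that, of "\<lambda>b. c (Inr b)"] by auto
    then show "\<forall>i\<in>B <+> B. c i = 0" by auto
  qed
  then obtain P where P: "P \<in> polynomial_functions ?sp" "P (a, a') \<noteq> 0"
    "\<And>p c. p \<in> M \<times> M \<Longrightarrow> P p \<noteq> 0 \<Longrightarrow> (\<Sum>i\<in>B <+> B. smul (c i) (v i p)) = 0 \<Longrightarrow> \<forall>i\<in>B <+> B. c i = 0"
    by blast
  have key: "x - pr x = 0" if "P (x, y) \<noteq> 0" "(x, y) \<in> ?C" for x y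
  proof -
    have xy: "x \<in> M" "y \<in> M" "br x y = 0" using that by (auto simp: commuting_variety_def)
    obtain c where c: "x - pr x = (\<Sum>b\<in>B. smul (c b) b)" using rep pr xy by blast
    obtain d where d: "y - pr y = (\<Sum>b\<in>B. smul (d b) b)" using rep pr xy by blast
    have L: "pr x \<in> L" "pr y \<in> L" "x - pr x \<in> L" "y - pr y \<in> L" using pr xy Vp Vm by blast+
    have "br x y = br (pr x + (x - pr x)) (pr y + (y - pr y))" by simp
    also have "\<dots> = br (pr x) (pr y) + br (x - pr x) (pr y) + (br (pr x) (y - pr y) + br (x - pr x) (y - pr y))"
      using L by (simp only: br_add_left br_add_right subspace_add[OF subspace_carrier])
    also have "\<dots> = br (x - pr x) (pr y) + br (pr x) (y - pr y)"
      using ab_p ab_m pr xy by simp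
    finally have "(\<Sum>i\<in>B <+> B. smul (case i of Inl b \<Rightarrow> c b | Inr b \<Rightarrow> d b) (v i (x, y))) = 0"
      using xy by (subst sum_v) (auto simp: c d)
    from P(3)[OF _ that(1) this] xy
    have *: "\<forall>i\<in>B <+> B. (case i of Inl b \<Rightarrow> c b | Inr b \<Rightarrow> d b) = 0" by auto
    have "\<forall>b\<in>B. c b = 0" using bspec[OF *, of "Inl _"] by auto
    then show ?thesis unfolding c by (simp add: sum.neutral)
  qed
  define F where "F = {f. \<exists>g. Vector_Spaces.linear smul (*) g \<and> f = (\<lambda>p :: 'v \<times> 'v. g (fst p)) \<and> (\<forall>x\<in>Vp. g x = 0)}"
  have F: "F \<subseteq> polynomial_functions ?sp" unfolding F_def using linear_fst by blast
  have zF: "(x, y) \<in> zero_locus F \<longleftrightarrow> x \<in> Vp" if "x \<in> M" for x y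
  proof
    assume "x \<in> Vp" then show "(x, y) \<in> zero_locus F" by (auto simp: zero_locus_def F_def)
  next
    assume z: "(x, y) \<in> zero_locus F"
    show "x \<in> Vp"
    proof (rule ccontr)
      assume "x \<notin> Vp"
      then have "x - pr x \<noteq> 0" using pr[OF that] by auto
      then obtain l where l: "Vector_Spaces.linear smul (*) l" "l (x - pr x) \<noteq> 0" by (rule separating_functional)
      interpret l: Vector_Spaces.linear smul "(*)" l by (rule l(1))
      have add: "l (x + y - pr (x + y)) = l (x - pr x) + l (y - pr y)" if "x \<in> M" "y \<in> M" for x y
        using that by (simp add: pr_add l.diff l.add)
      have hom: "l (smul c x - pr (smul c x)) = c * l (x - pr x)" if "x \<in> M" for c x
        using that by (simp add: pr_scale l.diff l.scale algebra_simps)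
      from extend_functional[OF M_sub, of "\<lambda>x. l (x - pr x)", OF add hom]
      obtain g where g: "Vector_Spaces.linear smul (*) g" "\<And>x. x \<in> M \<Longrightarrow> g x = l (x - pr x)" by auto
      then have "\<forall>x\<in>Vp. g x = 0" using VM pr_p by (auto simp: l.zero)
      then have "(\<lambda>p. g (fst p)) \<in> F" using g(1) F_def by blast
      then have "g x = 0" using z by (auto simp: zero_locus_def)
      then show False using g(2)[OF that] l(2) by simp
    qed
  qed
  let ?T = "subtopology (zariski_topology ?sp) ?C"
  have top: "topspace ?T = ?C"
  proof -
    have "closedin (zariski_topology ?sp) UNIV"
      unfolding closedin_zariski by (rule exI[of _ "{}"]) (auto simp: zero_locus_def)
    then have "topspace (zariski_topology ?sp) = UNIV" using closedin_subset by blast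
    then show ?thesis by simp
  qed
  have cl: "closedin ?T (?C \<inter> zero_locus G)" if "G \<subseteq> polynomial_functions ?sp" for G
    unfolding closedin_subtopology using that closedin_zariski by blast
  obtain b where b: "b \<in> Vm" "b \<noteq> 0" using ne subspace_0[OF Vm(1)] by blast
  have 0: "0 \<in> M" "br x 0 = 0" if "x \<in> L" for x
    using that subspace_0[OF M_sub] br_scale_right[of x 0 0] subspace_0[OF subspace_carrier] by auto
  have bC: "(b, 0) \<in> ?C" using b VM 0 Vm by (auto simp: commuting_variety_def)
  have aC: "(a, a') \<in> ?C" using a VM ab_p by (auto simp: commuting_variety_def)
  have nF: "(b, 0) \<notin> zero_locus F"
  proof -
    have "b \<in> M" "b \<notin> Vp" using b int0 VM by auto
    then show ?thesis using zF by blast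
  qed
  have nP: "(a, a') \<notin> zero_locus {P}" using P by (simp add: zero_locus_def)
  have cover: "?C = ?C \<inter> zero_locus {P} \<union> ?C \<inter> zero_locus F"
  proof -
    have "(x, y) \<in> zero_locus F" if "(x, y) \<in> ?C" "(x, y) \<notin> zero_locus {P}" for x y
    proof -
      have "x \<in> M" using that by (simp add: commuting_variety_def)
      moreover have "x - pr x = 0" using key that by (auto simp: zero_locus_def)
      then have "x \<in> Vp" using pr[OF \<open>x \<in> M\<close>] by simp
      ultimately show ?thesis using zF by blast
    qed
    then show ?thesis by auto
  qed
  show ?thesis
    unfolding commuting_variety_reducible_def reducible_space_def top
  proof (intro exI conjI)
    show "closedin ?T (?C \<inter> zero_locus {P})" using P(1) by (intro cl) simp
    show "closedin ?T (?C \<inter> zero_locus F)" by (rule cl[OF F])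
    show "?C \<inter> zero_locus {P} \<noteq> ?C" using nP aC by blast
    show "?C \<inter> zero_locus F \<noteq> ?C" using nF bC by blast
  qed (rule cover)
qed

section \<open>The special linear pairs\<close>

lemma finite_span_matrices:
  "\<exists>S :: ('k::field^'a::finite^'b::finite) set. finite S \<and> module.span mat_scale S = UNIV"
proof -
  interpret M: vector_space "mat_scale :: 'k \<Rightarrow> 'k^'a^'b \<Rightarrow> 'k^'a^'b"
    by (rule vector_space_mat_scale)
  define E :: "'b \<times> 'a \<Rightarrow> 'k^'a^'b" where "E = (\<lambda>(p, q). \<chi> i j. if i = p \<and> j = q then 1 else 0)"
  let ?S = "E ` (UNIV :: ('b \<times> 'a) set)"
  have "X \<in> M.span ?S" for X :: "'k^'a^'b"
  proof -
    have "X = (\<Sum>pq\<in>UNIV. mat_scale (X $ fst pq $ snd pq) (E pq))"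
    proof (simp only: vec_eq_iff, intro allI)
      fix i j
      have "(\<Sum>pq\<in>UNIV. mat_scale (X $ fst pq $ snd pq) (E pq)) $ i $ j =
        (\<Sum>pq\<in>UNIV. if pq = (i, j) then X $ i $ j else 0)"
        unfolding sum_component
        by (rule sum.cong) (auto simp: mat_scale_def E_def split: prod.splits)
      then show "X $ i $ j = (\<Sum>pq\<in>UNIV. mat_scale (X $ fst pq $ snd pq) (E pq)) $ i $ j" by simp
    qed
    also have "\<dots> \<in> M.span ?S" by (intro M.span_sum M.span_scale M.span_base) auto
    finally show ?thesis .
  qed
  then show ?thesis by (intro exI[of _ ?S]) auto
qed

text \<open>
  The two equations say that \<open>b\<close> and its shift \<open>b'\<close> are constant along the diagonals of slope \<open>s\<close> in an
  \<open>n \<times> (n + s)\<close> rectangle. A diagonal on or above \<open>c = j + s\<close> is followed upwards, the other ones downwards,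
  until it leaves the rectangle through a side where the entries vanish.
\<close>

lemma shifted_diagonals_vanish:
  fixes b b' :: "nat \<Rightarrow> nat \<Rightarrow> 'k::zero"
  assumes s: "s > 0"
    and cols: "\<And>j k. j < n \<Longrightarrow> k < n \<Longrightarrow> b j (k + s) = b' j k"
    and rows: "\<And>l c. l < n + s \<Longrightarrow> c < n + s \<Longrightarrow>
      (if l < n then b' l c else 0) = (if s \<le> l then b (l - s) c else 0)"
    and jc: "j < n" "c < n + s"
  shows "b j c = 0" "b' j c = 0"
proof -
  have up: "b j c = 0" if "j + s \<le> c" "j < n" "c < n + s" for j c
    using that
  proof (induction j arbitrary: c rule: less_induct)
    case (less j)
    have "b j c = b' j (c - s)" using cols[of j "c - s"] less.prems by auto
    also have "\<dots> = (if s \<le> j then b (j - s) (c - s) else 0)"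
      using rows[of j "c - s"] less.prems by simp
    also have "\<dots> = 0" using less.IH[of "j - s" "c - s"] less.prems s by auto
    finally show ?case .
  qed
  have down: "b j c = 0" if "c \<le> j + s" "j < n" "c < n + s" for j c
    using that
  proof (induction "n - j" arbitrary: j c rule: less_induct)
    case less
    have 1: "b j c = (if j + s < n then b' (j + s) c else 0)"
      using rows[of "j + s" c] less.prems by simp
    show ?case
    proof (cases "j + s < n")
      case True
      then have "b' (j + s) c = b (j + s) (c + s)" using cols[of "j + s" c] less.prems by simp
      also have "\<dots> = 0" using less.hyps[of "j + s" "c + s"] less.prems True s by simp
      finally show ?thesis using 1 by simp
    qed (use 1 in simp)
  qed
  have b: "b j c = 0" if "j < n" "c < n + s" for j c using up[of j c] down[of c j] that by linarith
  show "b j c = 0" by (rule b[OF jc])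
  show "b' j c = 0" using rows[of j c] b[of "j - s" c] jc by (auto split: if_splits)
qed

lemma block_commuting_variety_reducible:
  fixes I J :: "'a::finite set"
  assumes IJ: "I \<inter> J = {}" "I \<union> J = UNIV" and I: "I \<noteq> {}" and less: "card I < card J"
  shows "commuting_variety_reducible mat_scale commutator
    {X :: 'k::field^'a^'a. \<forall>i j. (i \<in> I \<longleftrightarrow> j \<in> I) \<longrightarrow> X $ i $ j = 0}"
proof -
  interpret lie_algebra "mat_scale :: 'k \<Rightarrow> 'k^'a^'a \<Rightarrow> 'k^'a^'a" sl_algebra commutator
    by (rule lie_algebra_sl)
  define n s where "n = card I" and "s = card J - card I"
  have s: "s > 0" and cardJ: "card J = n + s" using less by (auto simp: n_def s_def)
  obtain u where u: "bij_betw u {..<n} I"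
    unfolding n_def using ex_bij_betw_nat_finite[of I] by (auto simp: atLeast0LessThan)
  obtain w where w: "bij_betw w {..<n + s} J"
    using ex_bij_betw_nat_finite[of J] by (auto simp: atLeast0LessThan cardJ)
  have u_I: "k < n \<Longrightarrow> u k \<in> I" and w_J: "l < n + s \<Longrightarrow> w l \<in> J" for k l
    using u w by (auto dest: bij_betwE)
  have u_eq: "u k = u k' \<longleftrightarrow> k = k'" if "k < n" "k' < n" for k k'
    using u that by (auto simp: bij_betw_def inj_on_def)
  have w_eq: "w k = w k' \<longleftrightarrow> k = k'" if "k < n + s" "k' < n + s" for k k'
    using w that by (auto simp: bij_betw_def inj_on_def)
  have uw: "u k \<noteq> w l" if "k < n" "l < n + s" for k l
    using u_I[OF that(1)] w_J[OF that(2)] IJ by auto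
  define Vp where "Vp = {X :: 'k^'a^'a. \<forall>i j. X $ i $ j \<noteq> 0 \<longrightarrow> i \<in> J \<and> j \<in> I}"
  define Vm where "Vm = {X :: 'k^'a^'a. \<forall>i j. X $ i $ j \<noteq> 0 \<longrightarrow> i \<in> I \<and> j \<in> J}"
  define a where "a = (\<lambda>t. \<chi> i j. if \<exists>k<n. i = w (k + t) \<and> j = u k then 1 else (0 :: 'k))"
  have a_entry: "a t $ x $ u k = (if x = w (k + t) then 1 else 0)" if "k < n" "t \<le> s" for t x k
    using that by (auto simp: a_def u_eq)
  have a_row: "a t $ w l $ x = (if t \<le> l \<and> l < n + t \<and> x = u (l - t) then 1 else 0)"
    if "l < n + s" "t \<le> s" for t l x
  proof -
    have "(\<exists>k<n. w l = w (k + t) \<and> x = u k) \<longleftrightarrow> t \<le> l \<and> l < n + t \<and> x = u (l - t)"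
    proof
      assume "\<exists>k<n. w l = w (k + t) \<and> x = u k"
      then obtain k where k: "k < n" "w l = w (k + t)" "x = u k" by blast
      then have "l = k + t" using that w_eq[of l "k + t"] by simp
      then show "t \<le> l \<and> l < n + t \<and> x = u (l - t)" using k by simp
    next
      assume "t \<le> l \<and> l < n + t \<and> x = u (l - t)"
      then show "\<exists>k<n. w l = w (k + t) \<and> x = u k" by (intro exI[of _ "l - t"]) auto
    qed
    then show ?thesis by (simp add: a_def)
  qed
  have a_Vp: "a t \<in> Vp" if "t \<le> s" for t
    using that u_I w_J by (auto simp: a_def Vp_def split: if_splits)
  have mult_a: "(b ** a t) $ i $ u k = b $ i $ w (k + t)" if "k < n" "t \<le> s" for b :: "'k^'a^'a" and t i k
    using that by (simp add: matrix_matrix_mult_def a_entry if_distrib cong: if_cong)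
  have a_mult: "(a t ** b) $ w l $ j = (if t \<le> l \<and> l < n + t then b $ u (l - t) $ j else 0)"
    if "l < n + s" "t \<le> s" for b :: "'k^'a^'a" and t l j
    using that by (cases "t \<le> l \<and> l < n + t")
      (simp_all add: matrix_matrix_mult_def a_row if_distrib if_distribR sum.neutral cong: if_cong)
  have row_zero: "(X ** Y) $ i $ j = 0" if "\<And>x. X $ i $ x = 0" for X Y :: "'k^'a^'a" and i j
    using that by (simp add: matrix_matrix_mult_def)
  obtain S :: "('k^'a^'a) set" where S: "finite S" "span S = UNIV" using finite_span_matrices by blast
  show ?thesis
  proof (rule graded_commuting_variety_reducible[of Vp Vm S "a 0" "a s"])
    show sub: "subspace Vp" "subspace Vm"
      by (rule subspaceI; auto simp: Vp_def Vm_def mat_scale_def; metis add.right_neutral add.left_neutral)+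
    show "Vp \<subseteq> sl_algebra" "Vm \<subseteq> sl_algebra"
      using IJ by (auto simp: Vp_def Vm_def sl_algebra_def trace_def intro!: sum.neutral; blast)+
    show "Vp \<inter> Vm = {0}"
      using IJ by (auto simp: Vp_def Vm_def vec_eq_iff; blast)
    show "commutator x y = 0" if "x \<in> Vp" "y \<in> Vp" for x y
    proof -
      have "x $ i $ k * y $ k $ j = 0" "y $ i $ k * x $ k $ j = 0" for i j k
        using that IJ by (auto simp: Vp_def) blast+
      then have "x ** y = 0" "y ** x = 0"
        by (simp_all only: matrix_matrix_mult_def vec_eq_iff vec_lambda_beta zero_index sum.neutral_const simp_thms)
      then show ?thesis by (simp add: commutator_def)
    qed
    show "commutator x y = 0" if "x \<in> Vm" "y \<in> Vm" for x y
    proof -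
      have "x $ i $ k * y $ k $ j = 0" "y $ i $ k * x $ k $ j = 0" for i j k
        using that IJ by (auto simp: Vm_def) blast+
      then have "x ** y = 0" "y ** x = 0"
        by (simp_all only: matrix_matrix_mult_def vec_eq_iff vec_lambda_beta zero_index sum.neutral_const simp_thms)
      then show ?thesis by (simp add: commutator_def)
    qed
    show "finite S" "Vm \<subseteq> span S" using S by auto
    show "a 0 \<in> Vp" "a s \<in> Vp" by (simp_all add: a_Vp)
    obtain i j where "i \<in> I" "j \<in> J" using I less by fastforce
    then have "(\<chi> k l. if k = i \<and> l = j then 1 else 0) \<in> Vm - {0}"
      by (auto simp: Vm_def vec_eq_iff)
    then show "Vm \<noteq> {0}" by blast
    show "{X :: 'k^'a^'a. \<forall>i j. (i \<in> I \<longleftrightarrow> j \<in> I) \<longrightarrow> X $ i $ j = 0} = {x + y | x y. x \<in> Vp \<and> y \<in> Vm}"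
      (is "?M = ?N")
    proof
      show "?N \<subseteq> ?M"
      proof
        fix X assume "X \<in> ?N"
        then obtain x y where X: "X = x + y" and xy: "x \<in> Vp" "y \<in> Vm" by blast
        have "x $ i $ j = 0" "y $ i $ j = 0" if "(i \<in> I) = (j \<in> I)" for i j
          using xy that IJ unfolding Vp_def Vm_def by blast+
        then show "X \<in> ?M" unfolding X by simp
      qed
      show "?M \<subseteq> ?N"
      proof
        fix X assume X: "X \<in> ?M"
        let ?x = "\<chi> i j. if i \<in> J then X $ i $ j else 0" and ?y = "\<chi> i j. if i \<in> J then 0 else X $ i $ j"
        have "X = ?x + ?y" by (auto simp: vec_eq_iff)
        moreover have "x \<in> J \<longleftrightarrow> x \<notin> I" for x using IJ by blast
        then have "?x \<in> Vp" "?y \<in> Vm" using X by (auto simp: Vp_def Vm_def split: if_splits)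
        ultimately show "X \<in> ?N" by blast
      qed
    qed
    fix \<xi> \<eta> assume \<xi>: "\<xi> \<in> Vm" and \<eta>: "\<eta> \<in> Vm" and 0: "commutator \<xi> (a s) + commutator (a 0) \<eta> = 0"
    have e: "(\<xi> ** a s) $ i $ j - (a s ** \<xi>) $ i $ j + ((a 0 ** \<eta>) $ i $ j - (\<eta> ** a 0) $ i $ j) = 0" for i j
    proof -
      have "(commutator \<xi> (a s) + commutator (a 0) \<eta>) $ i $ j = 0" using 0 by simp
      then show ?thesis by (simp add: commutator_def)
    qed
    have aI: "a t $ i $ x = 0" if "i \<in> I" "t \<le> s" for t i x
      using a_Vp[OF that(2)] that IJ by (auto simp: Vp_def)
    have bJ: "b $ i $ x = 0" if "i \<in> J" "b \<in> Vm" for b i x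
      using that IJ by (auto simp: Vm_def)
    have "\<xi> $ u j $ w c = 0 \<and> \<eta> $ u j $ w c = 0" if jc: "j < n" "c < n + s" for j c
    proof (rule conjI)
      have cols: "\<xi> $ u j $ w (k + s) = \<eta> $ u j $ w k" if "j < n" "k < n" for j k
        using e[of "u j" "u k"] that
        by (simp add: mult_a row_zero[of "a _"] aI u_I)
      have rows: "(if l < n then \<eta> $ u l $ w c else 0) = (if s \<le> l then \<xi> $ u (l - s) $ w c else 0)"
        if "l < n + s" "c < n + s" for l c
        using e[of "w l" "w c"] that
        by (simp add: a_mult row_zero[of \<xi>] row_zero[of \<eta>] bJ \<xi> \<eta> w_J split: if_splits)
      show "\<xi> $ u j $ w c = 0" "\<eta> $ u j $ w c = 0"
        using shifted_diagonals_vanish[of s n "\<lambda>j c. \<xi> $ u j $ w c" "\<lambda>j c. \<eta> $ u j $ w c" j c, OF s cols rows jc]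
        by auto
    qed
    moreover have "\<exists>k<n. i = u k" if "i \<in> I" for i using u that unfolding bij_betw_def by auto
    moreover have "\<exists>l<n + s. j = w l" if "j \<in> J" for j using w that unfolding bij_betw_def by auto
    ultimately have z: "\<xi> $ i $ j = 0 \<and> \<eta> $ i $ j = 0" if "i \<in> I" "j \<in> J" for i j
      using that by metis
    have "\<xi> $ i $ j = 0 \<and> \<eta> $ i $ j = 0" for i j
      using z[of i j] \<xi> \<eta> by (auto simp: Vm_def)
    then show "\<xi> = 0 \<and> \<eta> = 0" by (simp add: vec_eq_iff)
  qed
qed

lemma minus_part_sl:
  "minus_part sl_algebra (conjugation (block_sign_matrix :: 'k::field_char_0^('p::finite + 'q::finite)^('p + 'q)))
    = {X. \<forall>i j. (i \<in> range Inl \<longleftrightarrow> j \<in> range Inl) \<longrightarrow> X $ i $ j = 0}"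
proof -
  let ?S = "block_sign_matrix :: 'k^('p + 'q)^('p + 'q)"
  define e :: "'p + 'q \<Rightarrow> 'k" where "e i = (case i of Inl _ \<Rightarrow> - 1 | Inr _ \<Rightarrow> 1)" for i
  have S: "?S $ i $ j = (if i = j then e i else 0)" for i j by (simp add: block_sign_matrix_def e_def)
  have left: "(?S ** X) $ i $ j = e i * X $ i $ j" and right: "(X ** ?S) $ i $ j = X $ i $ j * e j" for X i j
    by (simp_all add: matrix_matrix_mult_def S if_distrib if_distribR cong: if_cong)
  have ee: "e i * e i = 1" for i by (simp add: e_def split: sum.splits)
  have SS: "?S ** ?S = mat 1" by (simp add: vec_eq_iff left S mat_def ee)
  have inv: "matrix_inv ?S = ?S"
  proof -
    have "?S ** matrix_inv ?S = mat 1 \<and> matrix_inv ?S ** ?S = mat 1"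
      unfolding matrix_inv_def by (rule someI[of _ ?S]) (simp add: SS)
    then have "?S ** (?S ** matrix_inv ?S) = ?S" by simp
    then show ?thesis by (simp only: matrix_mul_assoc SS matrix_mul_lid)
  qed
  have conj: "conjugation ?S X $ i $ j = e i * e j * X $ i $ j" for X i j
    by (simp add: conjugation_def inv right left mult_ac)
  have sign: "e i * e j * x = - x \<longleftrightarrow> ((i \<in> range Inl \<longleftrightarrow> j \<in> range Inl) \<longrightarrow> x = 0)" for i j and x :: 'k
    by (auto simp: e_def split: sum.splits)
  have "X \<in> sl_algebra" if "\<forall>i j. (i \<in> range Inl \<longleftrightarrow> j \<in> range Inl) \<longrightarrow> X $ i $ j = 0"
    for X :: "'k^('p + 'q)^('p + 'q)"
    using that by (simp add: sl_algebra_def trace_def)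
  then show ?thesis by (auto simp: minus_part_def vec_eq_iff conj sign)
qed

lemma commuting_variety_reducible_sl:
  assumes "CARD('p::finite) \<noteq> CARD('q::finite)"
  shows "commuting_variety_reducible mat_scale commutator
    (minus_part sl_algebra (conjugation (block_sign_matrix :: 'k::field_char_0^('p + 'q)^('p + 'q))))"
proof -
  let ?I = "range Inl :: ('p + 'q) set" and ?J = "range Inr :: ('p + 'q) set"
  have IJ: "?I \<inter> ?J = {}" "?I \<union> ?J = UNIV" by (auto, metis rangeI sum.exhaust)
  have card: "card ?I = CARD('p)" "card ?J = CARD('q)" by (simp_all add: card_image)
  have compl: "(i \<in> ?I \<longleftrightarrow> j \<in> ?I) \<longleftrightarrow> (i \<in> ?J \<longleftrightarrow> j \<in> ?J)" for i j using IJ by blast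
  consider "card ?I < card ?J" | "card ?J < card ?I" using assms card by linarith
  then show ?thesis
  proof cases
    case 1
    then show ?thesis unfolding minus_part_sl using IJ by (intro block_commuting_variety_reducible) auto
  next
    case 2
    then show ?thesis unfolding minus_part_sl compl using IJ
      by (intro block_commuting_variety_reducible[of ?J ?I]) auto
  qed
qed

section \<open>The orthogonal pairs\<close>

text \<open>
  Induction on the number of functionals: with dual vectors for the earlier ones, a new functional that
  vanished on their common kernel would be a combination of them.
\<close>

lemma (in vector_space) independent_functionals_surj:
  assumes "finite I" and H: "subspace H"
    and lin: "\<And>i. i \<in> I \<Longrightarrow> Vector_Spaces.linear scale (*) (f i)"
    and ind: "\<And>c. (\<And>h. h \<in> H \<Longrightarrow> (\<Sum>i\<in>I. c i * f i h) = 0) \<Longrightarrow> \<forall>i\<in>I. c i = 0"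
  shows "\<exists>h\<in>H. \<forall>i\<in>I. f i h = d i"
  using assms(1) lin ind
proof (induction I arbitrary: d rule: finite_induct)
  case empty
  then show ?case using subspace_0[OF H] by auto
next
  case (insert n I)
  have ext: "(\<Sum>i\<in>insert n I. c i * f i h) = c n * f n h + (\<Sum>i\<in>I. c i * f i h)" for c h
    using insert.hyps by simp
  have f: "f i (x + y) = f i x + f i y" "f i (scale c x) = c * f i x" "f i (x - y) = f i x - f i y"
      "f i (\<Sum>j\<in>J. g j) = (\<Sum>j\<in>J. f i (g j))"
    if "i \<in> insert n I" for i x y c and J :: "'c set" and g
  proof -
    interpret l: Vector_Spaces.linear scale "(*)" "f i" by (rule insert.prems(1)[OF that])
    show "f i (x + y) = f i x + f i y" "f i (scale c x) = c * f i x" "f i (x - y) = f i x - f i y"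
      "f i (\<Sum>j\<in>J. g j) = (\<Sum>j\<in>J. f i (g j))"
      by (simp_all add: l.add l.scale l.diff l.sum)
  qed
  have IH: "\<exists>h\<in>H. \<forall>i\<in>I. f i h = d i" for d
  proof (rule insert.IH)
    fix c assume "\<And>h. h \<in> H \<Longrightarrow> (\<Sum>i\<in>I. c i * f i h) = 0"
    then have "(\<Sum>i\<in>insert n I. (c(n := 0)) i * f i h) = 0" if "h \<in> H" for h
    proof -
      have "(\<Sum>i\<in>I. (c(n := 0)) i * f i h) = (\<Sum>i\<in>I. c i * f i h)"
        using insert.hyps by (intro sum.cong) auto
      then show ?thesis using that \<open>\<And>h. h \<in> H \<Longrightarrow> (\<Sum>i\<in>I. c i * f i h) = 0\<close> by (simp add: ext)
    qed
    then have "\<forall>i\<in>insert n I. (c(n := 0)) i = 0" by (rule insert.prems(2))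
    then show "\<forall>i\<in>I. c i = 0" using insert.hyps by (metis fun_upd_apply insertI2)
  qed (use insert.prems in auto)
  have "\<exists>h\<in>H. \<forall>i\<in>I. f i h = (if i = j then 1 else 0)" for j by (rule IH)
  then obtain g where g: "\<And>j. g j \<in> H" "\<And>i j. i \<in> I \<Longrightarrow> f i (g j) = (if i = j then 1 else 0)"
    by metis
  have "\<exists>h'\<in>H. (\<forall>i\<in>I. f i h' = 0) \<and> f n h' \<noteq> 0"
  proof (rule ccontr)
    assume none': "\<not> ?thesis"
    have none: "f n h = 0" if "h \<in> H" "\<And>i. i \<in> I \<Longrightarrow> f i h = 0" for h using that none' by blast
    define c where "c = (\<lambda>i. if i = n then 1 else - f n (g i))"
    have "(\<Sum>i\<in>insert n I. c i * f i h) = 0" if h: "h \<in> H" for h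
    proof -
      let ?h = "h - (\<Sum>j\<in>I. scale (f j h) (g j))"
      have hH: "?h \<in> H"
        by (rule subspace_diff[OF H h], rule subspace_sum[OF H], rule subspace_scale[OF H], rule g(1))
      have "f i ?h = 0" if i: "i \<in> I" for i
      proof -
        have "f i ?h = f i h - (\<Sum>j\<in>I. f j h * (if i = j then 1 else 0))"
          using i g by (simp add: f)
        also have "\<dots> = 0" using i insert.hyps by (simp add: if_distrib cong: if_cong)
        finally show ?thesis .
      qed
      then have "f n ?h = 0" by (rule none[OF hH])
      then have "f n h = (\<Sum>j\<in>I. f j h * f n (g j))" by (simp add: f)
      moreover have "(\<Sum>i\<in>I. c i * f i h) = - (\<Sum>j\<in>I. f j h * f n (g j))"
        unfolding sum_negf[symmetric] using insert.hyps by (intro sum.cong) (auto simp: c_def)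
      ultimately show ?thesis unfolding ext by (simp add: c_def)
    qed
    then have "c n = 0" using insert.prems(2) by blast
    then show False by (simp add: c_def)
  qed
  then obtain h' where h': "h' \<in> H" "\<And>i. i \<in> I \<Longrightarrow> f i h' = 0" "f n h' \<noteq> 0" by blast
  obtain h0 where h0: "h0 \<in> H" "\<And>i. i \<in> I \<Longrightarrow> f i h0 = d i" using IH[of d] by blast
  let ?h = "h0 + scale ((d n - f n h0) / f n h') h'"
  have "?h \<in> H" using h0 h' H by (simp add: subspace_add subspace_scale)
  moreover have "f i ?h = d i" if "i \<in> insert n I" for i
    using that h0 h' by (auto simp: f)
  ultimately show ?case by blast
qed

text \<open>
  The equations arise from the pencil of skew forms pairing \<open>i\<close> with \<open>n - 1 - i\<close> and with \<open>n - i\<close>. They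
  say that \<open>b'\<close> is \<open>b\<close> shifted by one column; by skewness \<open>b\<close> is then constant along antidiagonals, as
  long as these do not cross the middle index \<open>r\<close>. An antidiagonal inside \<open>{0..r}\<^sup>2\<close> is symmetric, hence
  vanishes by skewness; any other one reaches column or row \<open>r + 1\<close> or leaves the square.
\<close>

lemma skew_pencil_vanish:
  fixes b b' :: "nat \<Rightarrow> nat \<Rightarrow> 'k::field_char_0"
  assumes n: "n = 2 * r + 1" "r \<ge> 1"
    and skew: "\<And>j k. j < n \<Longrightarrow> k < n \<Longrightarrow> b j k = - b k j" "\<And>j k. j < n \<Longrightarrow> k < n \<Longrightarrow> b' j k = - b' k j"
    and shift: "\<And>j k. j < n \<Longrightarrow> k < n - 1 \<Longrightarrow> k \<noteq> r \<Longrightarrow> b' j k = b j (k + 1)"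
    and mid: "\<And>j. j < n \<Longrightarrow> b j (r + 1) = 0"
    and last: "\<And>j. j < n \<Longrightarrow> b' j (n - 1) = 0"
    and jk: "j < n" "k < n"
  shows "b j k = 0" "b' j k = 0"
proof -
  \<comment> \<open>extended by zero to row and column \<open>n\<close>, so that \<open>last\<close> becomes a case of \<open>shift\<close>\<close>
  define c where "c j k = (if j = n \<or> k = n then 0 else b j k)" for j k
  have c_skew: "c j k = - c k j" if "j \<le> n" "k \<le> n" for j k
    using that skew(1)[of j k] by (auto simp: c_def)
  have c_shift: "b' j k = c j (k + 1)" if "j < n" "k < n" "k \<noteq> r" for j k
    using that shift[of j k] last[of j] by (cases "k = n - 1") (auto simp: c_def)
  have step: "c j (k + 1) = c (j + 1) k" if "j < n" "k < n" "j \<noteq> r" "k \<noteq> r" for j k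
    using c_shift[of j k] c_shift[of k j] skew(2)[of j k] c_skew[of k "j + 1"] that by simp
  have c_mid: "c j (r + 1) = 0" "c (r + 1) j = 0" if "j \<le> n" for j
    using mid[of j] c_skew[of "r + 1" j] that n by (auto simp: c_def)
  have c_n: "c j n = 0" "c n j = 0" for j by (simp_all add: c_def)
  have sym: "c i j = c j i" if "i \<le> j" "j \<le> r" for i j
    using that
  proof (induction "j - i" arbitrary: i j rule: less_induct)
    case less
    consider "i = j" | "j = i + 1" | "i + 1 \<le> j - 1" using less.prems by linarith
    then show ?case
    proof cases
      case 2
      then show ?thesis using step[of i i] less.prems n by simp
    next
      case 3
      have "c i j = c (i + 1) (j - 1)" using step[of i "j - 1"] 3 less.prems n by simp
      also have "\<dots> = c (j - 1) (i + 1)" using less.hyps[of "j - 1" "i + 1"] 3 less.prems by simp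
      also have "\<dots> = c j i" using step[of "j - 1" i] 3 less.prems n by simp
      finally show ?thesis .
    qed simp
  qed
  have inner: "c i j = 0" if "i \<le> r" "j \<le> r" for i j
  proof -
    have "c i j = c j i" using sym[of i j] sym[of j i] that by (cases "i \<le> j") auto
    then show ?thesis using c_skew[of i j] that n by simp
  qed
  have up: "c k j = 0" if "r < k" "k \<le> n" "j \<le> n" "k + j \<le> 2 * r + 1 \<or> j > r" for k j
    using that
  proof (induction k arbitrary: j)
    case (Suc k)
    show ?case
    proof (cases "k = r \<or> j = n")
      case True
      then show ?thesis using c_mid[of j] c_n Suc.prems by auto
    next
      case False
      have "c (Suc k) j = c k (j + 1)" using step[of k j] False Suc.prems n by auto
      also have "\<dots> = 0" using Suc.IH[of "j + 1"] False Suc.prems n by auto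
      finally show ?thesis .
    qed
  qed simp
  have down: "c k j = 0" if "r < k" "k \<le> n" "j \<le> r" "k + j \<ge> 2 * r + 1" for k j
    using that
  proof (induction j arbitrary: k)
    case 0
    then show ?case using c_n n by simp
  next
    case (Suc j)
    show ?case
    proof (cases "k = n")
      case False
      have "c k (Suc j) = c (k + 1) j" using step[of k j] False Suc.prems n by auto
      also have "\<dots> = 0" using Suc.IH[of "k + 1"] False Suc.prems n by auto
      finally show ?thesis .
    qed (simp add: c_n)
  qed
  have low: "c k j = 0" if "r < k" "k \<le> n" "j \<le> n" for k j
    using up[of k j] down[of k j] that by linarith
  have c: "c j k = 0" if "j \<le> n" "k \<le> n" for j k
    by (cases "r < j"; cases "r < k") (use low[of j k] low[of k j] inner[of j k] c_skew[of j k] that in auto)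
  show "b j k = 0" using c[of j k] jk by (simp add: c_def)
  show "b' j k = 0"
  proof (cases "k = r")
    case False
    then show ?thesis using c_shift[of j k] c jk by simp
  next
    case True
    show ?thesis
    proof (cases "j = r")
      case False
      then show ?thesis using c_shift[of k j] skew(2)[of j k] c jk by simp
    next
      case True
      then show ?thesis using skew(2)[of j k] \<open>k = r\<close> jk by simp
    qed
  qed
qed

locale polarized_form =
  fixes B :: "'k::field_char_0^'v::finite \<Rightarrow> 'k^'v \<Rightarrow> 'k" and Vp Vm :: "('k^'v) set"
  assumes form: "nondegenerate_symmetric_form B"
    and iso: "isotropic_subspace B Vp" "isotropic_subspace B Vm"
    and int0: "Vp \<inter> Vm = {0}"
    and sum_UNIV: "{u + w | u w. u \<in> Vp \<and> w \<in> Vm} = UNIV"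
begin

lemma swap: "polarized_form B Vm Vp"
proof
  have "x \<in> {u + w | u w. u \<in> Vm \<and> w \<in> Vp}" for x
  proof -
    obtain u w where "u \<in> Vp" "w \<in> Vm" "x = u + w" using sum_UNIV by blast
    then have "x = w + u" by (simp add: add.commute)
    with \<open>u \<in> Vp\<close> \<open>w \<in> Vm\<close> show ?thesis by blast
  qed
  then show "{u + w | u w. u \<in> Vm \<and> w \<in> Vp} = UNIV" by blast
qed (use form iso int0 in auto)

lemma linear_B: "Vector_Spaces.linear (*s) (*) (B u)" and sym: "B u v = B v u"
  and nondeg: "(\<And>v. B u v = 0) \<Longrightarrow> u = 0"
  using form by (auto simp: nondegenerate_symmetric_form_def)

lemma B_right: "B u (x + y) = B u x + B u y" "B u (c *s x) = c * B u x" "B u 0 = 0" "B u (x - y) = B u x - B u y"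
  "B u (- x) = - B u x" "B u (\<Sum>i\<in>I. g i) = (\<Sum>i\<in>I. B u (g i))"
proof -
  interpret l: Vector_Spaces.linear "(*s)" "(*)" "B u" by (rule linear_B)
  show "B u (x + y) = B u x + B u y" "B u (c *s x) = c * B u x" "B u 0 = 0" "B u (x - y) = B u x - B u y"
  "B u (- x) = - B u x" "B u (\<Sum>i\<in>I. g i) = (\<Sum>i\<in>I. B u (g i))"
    by (simp_all add: l.add l.scale l.diff l.sum l.zero l.neg)
qed

lemma B_left: "B (x + y) u = B x u + B y u" "B (c *s x) u = c * B x u" "B 0 u = 0" "B (x - y) u = B x u - B y u"
  "B (- x) u = - B x u" "B (\<Sum>i\<in>I. g i) u = (\<Sum>i\<in>I. B (g i) u)"
  using B_right[of u] by (simp_all add: sym[of _ u])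

lemma subspaces: "vec.subspace Vp" "vec.subspace Vm"
  and isotropic: "u \<in> Vp \<Longrightarrow> v \<in> Vp \<Longrightarrow> B u v = 0" "u \<in> Vm \<Longrightarrow> v \<in> Vm \<Longrightarrow> B u v = 0"
  using iso by (auto simp: isotropic_subspace_def)

lemma decompose: obtains u w where "u \<in> Vp" "w \<in> Vm" "x = u + w"
  using sum_UNIV by blast

lemma dual_bases:
  obtains v w where "\<And>i. i < vec.dim Vp \<Longrightarrow> v i \<in> Vp" "\<And>i. i < vec.dim Vp \<Longrightarrow> w i \<in> Vm"
    "\<And>i j. i < vec.dim Vp \<Longrightarrow> j < vec.dim Vp \<Longrightarrow> B (v i) (w j) = (if i = j then 1 else 0)"
    "\<And>x. x \<in> Vm \<Longrightarrow> (\<And>i. i < vec.dim Vp \<Longrightarrow> B (v i) x = 0) \<Longrightarrow> x = 0"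
    "Vm \<subseteq> vec.span (w ` {..<vec.dim Vp})"
proof -
  let ?d = "vec.dim Vp"
  obtain A where A: "A \<subseteq> Vp" "vec.independent A" "Vp \<subseteq> vec.span A" "card A = ?d"
    using vec.basis_exists[of Vp] by metis
  have finA: "finite A" using A(2) by (rule vec.finiteI_independent)
  obtain v where v: "bij_betw v {..<?d} A"
    using ex_bij_betw_nat_finite[OF finA] by (auto simp: atLeast0LessThan A(4))
  have vV: "v i \<in> Vp" if "i < ?d" for i using v A(1) that by (auto dest: bij_betwE)
  have sep: "x = 0" if x: "x \<in> Vm" "\<And>i. i < ?d \<Longrightarrow> B (v i) x = 0" for x
  proof (rule nondeg)
    fix y
    obtain p m where y: "p \<in> Vp" "m \<in> Vm" "y = p + m" by (rule decompose)
    have "p \<in> vec.span A" using A y by blast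
    then have "B x p = 0"
    proof (induction rule: vec.span_induct_alt)
      case (step c a y)
      have "a \<in> v ` {..<?d}" using step v by (auto simp: bij_betw_def)
      then have "B x a = 0" using x(2) sym by auto
      then show ?case using step by (simp add: B_right)
    qed (simp add: B_right)
    then show "B x y = 0" using isotropic x y by (simp add: B_right)
  qed
  have "\<exists>w\<in>Vm. \<forall>i\<in>{..<?d}. B (v i) w = (if i = j then 1 else 0)" for j
  proof (rule vec.independent_functionals_surj)
    fix c assume c: "\<And>h. h \<in> Vm \<Longrightarrow> (\<Sum>i<?d. c i * B (v i) h) = 0"
    let ?u = "\<Sum>i<?d. c i *s v i"
    have "?u = 0"
    proof (rule nondeg)
      fix y
      obtain p m where y: "p \<in> Vp" "m \<in> Vm" "y = p + m" by (rule decompose)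
      have "B (v i) p = 0" if "i < ?d" for i using isotropic vV that y by blast
      then show "B ?u y = 0" using c[OF y(2)] by (simp add: y B_left B_right distrib_left sum.distrib)
    qed
    have "(\<Sum>i<?d. c i *s v i) = (\<Sum>a\<in>A. c (inv_into {..<?d} v a) *s a)"
    proof -
      have "(\<Sum>i<?d. c (inv_into {..<?d} v (v i)) *s v i) = (\<Sum>a\<in>A. c (inv_into {..<?d} v a) *s a)"
        by (rule sum.reindex_bij_betw[OF v])
      moreover have "inv_into {..<?d} v (v i) = i" if "i < ?d" for i
        using v that by (simp add: bij_betw_def)
      ultimately show ?thesis by simp
    qed
    then have *: "(\<Sum>a\<in>A. c (inv_into {..<?d} v a) *s a) = 0" using \<open>?u = 0\<close> by simp
    show "\<forall>i\<in>{..<?d}. c i = 0"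
    proof
      fix i assume i: "i \<in> {..<?d}"
      then have "c (inv_into {..<?d} v (v i)) = 0"
        using vec.independentD[OF A(2) finA subset_refl *, of "v i"] v by (auto dest: bij_betwE)
      then show "c i = 0" using v i by (simp add: bij_betw_def)
    qed
  qed (use subspaces linear_B in auto)
  then obtain w where w: "\<And>j. w j \<in> Vm" "\<And>i j. i < ?d \<Longrightarrow> B (v i) (w j) = (if i = j then 1 else 0)"
    by (metis lessThan_iff)
  have "x \<in> vec.span (w ` {..<?d})" if x: "x \<in> Vm" for x
  proof -
    let ?y = "\<Sum>j<?d. B (v j) x *s w j"
    have yV: "?y \<in> Vm" by (intro vec.subspace_sum vec.subspace_scale subspaces w)
    have "x - ?y = 0"
    proof (rule sep)
      show "x - ?y \<in> Vm" using x yV subspaces vec.subspace_diff by blast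
      show "B (v i) (x - ?y) = 0" if "i < ?d" for i
        using that by (simp add: B_right w if_distrib cong: if_cong)
    qed
    moreover have "?y \<in> vec.span (w ` {..<?d})"
      by (intro vec.span_sum vec.span_scale vec.span_base) auto
    ultimately show ?thesis by simp
  qed
  then show thesis using that[of v w] vV w sep by blast
qed

lemma dim_Vm_le: "vec.dim Vm \<le> vec.dim Vp"
proof -
  obtain v :: "nat \<Rightarrow> 'k^'v" and w :: "nat \<Rightarrow> 'k^'v" where "Vm \<subseteq> vec.span (w ` {..<vec.dim Vp})"
    by (rule dual_bases)
  then have "vec.dim Vm \<le> card (w ` {..<vec.dim Vp})" by (intro vec.dim_le_card) auto
  also have "\<dots> \<le> vec.dim Vp" using card_image_le[of "{..<vec.dim Vp}" w] by simp
  finally show ?thesis .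
qed

lemma dim_Vp: "2 * vec.dim Vp = CARD('v)"
proof -
  have "vec.dim Vp = vec.dim Vm"
    using dim_Vm_le polarized_form.dim_Vm_le[OF swap] by simp
  moreover have "vec.dim {x + y | x y. x \<in> Vp \<and> y \<in> Vm} + vec.dim (Vp \<inter> Vm) = vec.dim Vp + vec.dim Vm"
    by (intro vec.dim_sums_Int subspaces)
  moreover have "vec.dim (UNIV :: ('k^'v) set) = CARD('v)"
    by (simp add: card_cart_basis vec.dimension_def)
  ultimately show ?thesis by (simp add: sum_UNIV int0)
qed


definition raising :: "('k^'v^'v) set" where
  "raising = {X \<in> so_algebra B. (\<forall>u\<in>Vp. X *v u = 0) \<and> (\<forall>w\<in>Vm. X *v w \<in> Vp)}"

lemma so_iff: "X \<in> so_algebra B \<longleftrightarrow> (\<forall>u v. B (X *v u) v = - B u (X *v v))"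
  by (simp add: so_algebra_def eq_neg_iff_add_eq_0)

lemma subspace_raising: "module.subspace mat_scale raising"
proof -
  interpret lie_algebra "mat_scale :: 'k \<Rightarrow> 'k^'v^'v \<Rightarrow> 'k^'v^'v" "so_algebra B" commutator
    by (rule lie_algebra_so[OF form])
  have "X + Y \<in> so_algebra B" "mat_scale c X \<in> so_algebra B" "0 \<in> so_algebra B"
    if "X \<in> so_algebra B" "Y \<in> so_algebra B" for X Y c
    using that subspace_add subspace_scale subspace_0 subspace_carrier by blast+
  then show ?thesis
    using subspaces subspace_0[OF subspace_carrier]
    by (intro subspaceI)
      (auto simp: raising_def matrix_vector_mult_add_rdistrib mat_scale_mult_vec vec.subspace_0 vec.subspace_add vec.subspace_scale)
qed

lemma commutator_raising:
  assumes "X \<in> raising" "Y \<in> raising"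
  shows "commutator X Y = 0"
proof -
  have "commutator X Y *v x = 0" for x
  proof -
    obtain u w where x: "u \<in> Vp" "w \<in> Vm" "x = u + w" by (rule decompose)
    have "X *v x \<in> Vp" "Y *v x \<in> Vp"
      using x assms by (auto simp: raising_def matrix_vector_right_distrib)
    then have "X *v (Y *v x) = 0" "Y *v (X *v x) = 0" using assms by (auto simp: raising_def)
    then show ?thesis
      by (simp add: commutator_def matrix_vector_mult_diff_rdistrib matrix_vector_mul_assoc)
  qed
  then show ?thesis by (simp add: matrix_eq)
qed

lemma raising_Int: "raising \<inter> polarized_form.raising B Vm Vp = {0}"
proof -
  interpret s: polarized_form B Vm Vp by (rule swap)
  interpret lie_algebra "mat_scale :: 'k \<Rightarrow> 'k^'v^'v \<Rightarrow> 'k^'v^'v" "so_algebra B" commutator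
    by (rule lie_algebra_so[OF form])
  have "X = 0" if X: "X \<in> raising" "X \<in> s.raising" for X
  proof -
    have "X *v x = 0" for x
    proof -
      obtain u w where x: "u \<in> Vp" "w \<in> Vm" "x = u + w" by (rule decompose)
      then show ?thesis using X by (simp add: raising_def s.raising_def matrix_vector_right_distrib)
    qed
    then show ?thesis by (simp add: matrix_eq)
  qed
  then show ?thesis using subspace_0[OF subspace_raising] subspace_0[OF s.subspace_raising] by blast
qed

text \<open>
  Coefficients \<open>e\<close> that change sign under the involution \<open>t\<close> describe a skew form on the span of the
  \<open>v i\<close>, in other words a raising element.
\<close>

lemma raising_skew:
  assumes I: "finite I" and t: "\<And>i. i \<in> I \<Longrightarrow> t i \<in> I \<and> t (t i) = i \<and> e (t i) = - e i"
    and v: "\<And>i. i \<in> I \<Longrightarrow> v i \<in> Vp"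
  obtains X where "X \<in> raising" "\<And>x. X *v x = (\<Sum>i\<in>I. (e i * B (v (t i)) x) *s v i)"
proof -
  let ?f = "\<lambda>x. \<Sum>i\<in>I. (e i * B (v (t i)) x) *s v i"
  have "Vector_Spaces.linear (*s) (*s) ?f"
    unfolding Vector_Spaces.linear_iff
    by (simp add: vec.vector_space_axioms B_right distrib_left sum.distrib vec.scale_left_distrib vec.scale_sum_right mult_ac)
  then have X: "matrix ?f *v x = ?f x" for x by (rule matrix_works)
  have "B (?f x) y = - B x (?f y)" for x y
  proof -
    have bij: "bij_betw t I I" by (rule bij_betw_byWitness[of I t t]) (use t in auto)
    have "B (?f x) y = (\<Sum>i\<in>I. e i * B (v (t i)) x * B (v i) y)" by (simp add: B_left)
    also have "\<dots> = (\<Sum>i\<in>I. e (t i) * B (v (t (t i))) x * B (v (t i)) y)"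
      by (rule sum.reindex_bij_betw[OF bij, symmetric])
    also have "\<dots> = (\<Sum>i\<in>I. - (e i * B (v (t i)) y * B (v i) x))"
      by (rule sum.cong) (simp_all add: t)
    also have "\<dots> = - B x (?f y)" by (simp add: B_right sum_negf sym)
    finally show ?thesis .
  qed
  then have "matrix ?f \<in> so_algebra B" by (simp add: so_iff X)
  moreover have "?f x \<in> Vp" for x
    by (intro vec.subspace_sum vec.subspace_scale subspaces v)
  moreover have "?f u = 0" if "u \<in> Vp" for u
    using that t v isotropic by (intro sum.neutral) auto
  ultimately have "matrix ?f \<in> raising" by (auto simp: raising_def X)
  then show thesis using that X by blast
qed

text \<open>\<open>X\<close> anticommutes with \<open>S\<close>, so \<open>(X - X S) / 2\<close> and \<open>(X + X S) / 2\<close> are its two components.\<close>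

lemma minus_part_so:
  assumes S: "\<forall>u\<in>Vp. S *v u = u" "\<forall>w\<in>Vm. S *v w = - w"
  shows "minus_part (so_algebra B) (conjugation S) = {x + y | x y. x \<in> raising \<and> y \<in> polarized_form.raising B Vm Vp}"
    (is "?M = ?N")
proof -
  interpret s: polarized_form B Vm Vp by (rule swap)
  interpret lie_algebra "mat_scale :: 'k \<Rightarrow> 'k^'v^'v \<Rightarrow> 'k^'v^'v" "so_algebra B" commutator
    by (rule lie_algebra_so[OF form])
  have SSx: "S *v (S *v x) = x" and S_so: "B (S *v x) y = - B x (S *v y)" for x y
  proof -
    obtain u w where x: "u \<in> Vp" "w \<in> Vm" "x = u + w" by (rule decompose)
    obtain u' w' where y: "u' \<in> Vp" "w' \<in> Vm" "y = u' + w'" by (rule decompose)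
    show "S *v (S *v x) = x"
      using x S by (simp add: matrix_vector_right_distrib matrix_vector_mult_diff_distrib)
    show "B (S *v x) y = - B x (S *v y)"
      using x y S isotropic by (simp add: matrix_vector_right_distrib B_left B_right)
  qed
  then have SS: "S ** S = mat 1" by (simp add: matrix_eq matrix_vector_mul_assoc[symmetric])
  have inv: "matrix_inv S = S"
  proof -
    have "S ** matrix_inv S = mat 1 \<and> matrix_inv S ** S = mat 1"
      unfolding matrix_inv_def by (rule someI[of _ S]) (simp add: SS)
    then have "S ** (S ** matrix_inv S) = S" by simp
    then show ?thesis by (simp only: matrix_mul_assoc SS matrix_mul_lid)
  qed
  have anti: "conjugation S X = - X \<longleftrightarrow> (\<forall>x. S *v (X *v x) = - (X *v (S *v x)))" for X
  proof
    assume c: "conjugation S X = - X"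
    show "\<forall>x. S *v (X *v x) = - (X *v (S *v x))"
    proof
      fix x
      have "conjugation S X *v (S *v x) = S *v (X *v x)"
        by (simp add: conjugation_def inv matrix_vector_mul_assoc[symmetric] SSx)
      then show "S *v (X *v x) = - (X *v (S *v x))"
        using matrix_vector_mult_diff_rdistrib[of 0 X "S *v x"] by (simp add: c)
    qed
  next
    assume c: "\<forall>x. S *v (X *v x) = - (X *v (S *v x))"
    have "conjugation S X *v x = (- X) *v x" for x
      using matrix_vector_mult_diff_rdistrib[of 0 X x]
      by (simp add: conjugation_def inv matrix_vector_mul_assoc[symmetric] c SSx)
    then show "conjugation S X = - X" by (simp add: matrix_eq)
  qed
  have Vp_iff: "x \<in> Vp \<longleftrightarrow> S *v x = x" and Vm_iff: "x \<in> Vm \<longleftrightarrow> S *v x = - x" for x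
  proof -
    obtain u w where x: "u \<in> Vp" "w \<in> Vm" "x = u + w" by (rule decompose)
    then have Sx: "S *v x = u - w" using S by (simp add: matrix_vector_right_distrib)
    have "w = 0" if "u - w = u + w" using that by (simp add: vec_eq_iff eq_neg_iff_add_eq_0)
    then show "x \<in> Vp \<longleftrightarrow> S *v x = x" using x Sx S by auto
    have "u = 0" if "u - w = - (u + w)" using that by (simp add: vec_eq_iff eq_neg_iff_add_eq_0)
    then show "x \<in> Vm \<longleftrightarrow> S *v x = - x" using x Sx S by auto
  qed
  have M_iff: "X \<in> ?M \<longleftrightarrow> X \<in> so_algebra B \<and> (\<forall>x. S *v (X *v x) = - (X *v (S *v x)))" for X
    by (simp add: minus_part_def anti)
  have p: "X \<in> ?M" if X: "X \<in> raising \<or> X \<in> s.raising" for X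
    unfolding M_iff
  proof (intro conjI allI)
    show "X \<in> so_algebra B" using X by (auto simp: raising_def s.raising_def)
    fix x
    obtain u w where x: "u \<in> Vp" "w \<in> Vm" "x = u + w" by (rule decompose)
    show "S *v (X *v x) = - (X *v (S *v x))"
      using X x S by (auto simp: raising_def s.raising_def matrix_vector_right_distrib matrix_vector_mult_diff_distrib)
  qed
  have "?N \<subseteq> ?M"
  proof
    fix X assume "X \<in> ?N"
    then obtain x y where "X = x + y" "x \<in> ?M" "y \<in> ?M" using p by blast
    then show "X \<in> ?M" unfolding M_iff
      by (auto simp: matrix_vector_mult_add_rdistrib matrix_vector_right_distrib subspace_add[OF subspace_carrier])
  qed
  moreover have "?M \<subseteq> ?N"
  proof
    fix X assume "X \<in> ?M"
    then have X: "X \<in> so_algebra B" "\<And>x. S *v (X *v x) = - (X *v (S *v x))" by (auto simp: M_iff)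
    have XS: "X ** S \<in> so_algebra B"
    proof -
      have "B (X *v (S *v u)) v = - B u (X *v (S *v v))" for u v
      proof -
        have "B (X *v (S *v u)) v = - B (S *v (X *v u)) v" using X(2) by (simp add: B_left)
        also have "\<dots> = B (X *v u) (S *v v)" by (simp add: S_so)
        also have "\<dots> = - B u (X *v (S *v v))" using X(1) by (simp add: so_iff)
        finally show ?thesis .
      qed
      then show ?thesis by (simp add: so_iff matrix_vector_mul_assoc[symmetric])
    qed
    let ?x = "mat_scale (1 / 2) (X - X ** S)" and ?y = "mat_scale (1 / 2) (X + X ** S)"
    have so: "?x \<in> so_algebra B" "?y \<in> so_algebra B"
      using X XS subspace_carrier by (auto intro!: subspace_scale subspace_diff subspace_add)
    have xv: "?x *v v = (1 / 2) *s (X *v v - X *v (S *v v))" "?y *v v = (1 / 2) *s (X *v v + X *v (S *v v))" for v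
      by (simp_all add: mat_scale_mult_vec matrix_vector_mult_diff_rdistrib matrix_vector_mult_add_rdistrib matrix_vector_mul_assoc)
    have half: "(1 / 2) *s (z + z) = z" for z :: "'k^'v" by (simp add: vec_eq_iff)
    have XV: "X *v u \<in> Vm" if "u \<in> Vp" for u using X(2)[of u] that S by (simp add: Vm_iff)
    have XV': "X *v w \<in> Vp" if "w \<in> Vm" for w
      using X(2)[of w] that S matrix_vector_mult_diff_distrib[of X 0 w] by (simp add: Vp_iff)
    have neg: "X *v (- w) = - (X *v w)" for w using matrix_vector_mult_diff_distrib[of X 0 w] by simp
    have "?x *v w = X *v w" "?y *v w = 0" if "w \<in> Vm" for w
      using bspec[OF S(2) that] by (simp_all only: xv neg half diff_minus_eq_add right_minus vec.scale_zero_right)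
    moreover have "?x *v u = 0" "?y *v u = X *v u" if "u \<in> Vp" for u
      using bspec[OF S(1) that] by (simp_all only: xv half diff_self vec.scale_zero_right)
    ultimately have "?x \<in> raising" "?y \<in> s.raising"
      using so XV XV' by (auto simp: raising_def s.raising_def)
    moreover have "X = ?x + ?y" by (simp add: vec_eq_iff mat_scale_def algebra_simps)
    ultimately show "X \<in> ?N" by blast
  qed
  ultimately show ?thesis by blast
qed

lemma commuting_variety_reducible_polarized:
  assumes odd: "odd (vec.dim Vp)" "vec.dim Vp \<ge> 3"
  shows "commuting_variety_reducible mat_scale commutator
    {x + y | x y. x \<in> raising \<and> y \<in> polarized_form.raising B Vm Vp}"
proof -
  interpret s: polarized_form B Vm Vp by (rule swap)
  interpret lie_algebra "mat_scale :: 'k \<Rightarrow> 'k^'v^'v \<Rightarrow> 'k^'v^'v" "so_algebra B" commutator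
    by (rule lie_algebra_so[OF form])
  define n where "n = vec.dim Vp"
  obtain r where r: "n = 2 * r + 1" "r \<ge> 1" using odd unfolding n_def by (auto elim!: oddE)
  obtain v w where v: "\<And>i. i < n \<Longrightarrow> v i \<in> Vp" and w: "\<And>i. i < n \<Longrightarrow> w i \<in> Vm"
    and vw: "\<And>i j. i < n \<Longrightarrow> j < n \<Longrightarrow> B (v i) (w j) = (if i = j then 1 else 0)"
    and sep: "\<And>x. x \<in> Vm \<Longrightarrow> (\<And>i. i < n \<Longrightarrow> B (v i) x = 0) \<Longrightarrow> x = 0"
    and span_w: "Vm \<subseteq> vec.span (w ` {..<n})"
    unfolding n_def by (rule dual_bases) blast
  define e e' :: "nat \<Rightarrow> 'k" where "e i = (if i < r then 1 else if i = r then 0 else - 1)"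
    and "e' i = (if i \<le> r then 1 else - 1)" for i
  have e: "n - 1 - i \<in> {..<n} \<and> n - 1 - (n - 1 - i) = i \<and> e (n - 1 - i) = - e i" if "i \<in> {..<n}" for i
    using that r by (auto simp: e_def)
  have e': "n - i \<in> {1..<n} \<and> n - (n - i) = i \<and> e' (n - i) = - e' i" if "i \<in> {1..<n}" for i
    using that r by (auto simp: e'_def)
  obtain a where a: "a \<in> raising" "\<And>x. a *v x = (\<Sum>i<n. (e i * B (v (n - 1 - i)) x) *s v i)"
    by (rule raising_skew[of "{..<n}" "\<lambda>i. n - 1 - i" e v]) (use e v in auto)
  obtain a' where a': "a' \<in> raising" "\<And>x. a' *v x = (\<Sum>i\<in>{1..<n}. (e' i * B (v (n - i)) x) *s v i)"
    by (rule raising_skew[of "{1..<n}" "\<lambda>i. n - i" e' v]) (use e' v in auto)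
  obtain c where c: "c \<in> s.raising" "\<And>x. c *v x = (\<Sum>i<n. (e i * B (w (n - 1 - i)) x) *s w i)"
    by (rule s.raising_skew[of "{..<n}" "\<lambda>i. n - 1 - i" e w]) (use e w in auto)
  obtain S :: "('k^'v^'v) set" where S: "finite S" "span S = UNIV" using finite_span_matrices by blast
  show ?thesis
  proof (rule graded_commuting_variety_reducible[of raising s.raising S a a'])
    show "subspace raising" "subspace s.raising" by (rule subspace_raising s.subspace_raising)+
    show "raising \<subseteq> so_algebra B" "s.raising \<subseteq> so_algebra B" by (auto simp: raising_def s.raising_def)
    show "raising \<inter> s.raising = {0}" by (rule raising_Int)
    show "a \<in> raising" "a' \<in> raising" by (rule a a')+
    show "finite S" "s.raising \<subseteq> span S" using S by auto
    have "B (v 0) (c *v v (n - 1)) = (\<Sum>i<n. if i = 0 then 1 else 0)"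
      unfolding c(2) B_right using r by (intro sum.cong) (auto simp: vw sym[of "w _"] e_def)
    then have "B (v 0) (c *v v (n - 1)) \<noteq> 0" using r by simp
    then have "c \<noteq> 0" by (auto simp: B_right)
    then show "s.raising \<noteq> {0}" using c by blast
    fix \<xi> \<eta> assume \<xi>: "\<xi> \<in> s.raising" and \<eta>: "\<eta> \<in> s.raising" and 0: "commutator \<xi> a' + commutator a \<eta> = 0"
    define b b' where "b j k = B (v k) (\<xi> *v v j)" and "b' j k = B (v k) (\<eta> *v v j)" for j k
    have eq: "(if 1 \<le> i then e' i * b j (n - i) else 0) = e i * b' j (n - 1 - i)" if "i < n" "j < n" for i j
    proof -
      have "(commutator \<xi> a' + commutator a \<eta>) *v v j = 0" by (simp add: 0)
      moreover have "a *v v j = 0" "a' *v v j = 0" using a(1) a'(1) v that by (auto simp: raising_def)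
      ultimately have "a *v (\<eta> *v v j) = a' *v (\<xi> *v v j)"
        by (simp add: commutator_def matrix_vector_mult_diff_rdistrib matrix_vector_mult_add_rdistrib matrix_vector_mul_assoc[symmetric])
      then have "B (a' *v (\<xi> *v v j)) (w i) = B (a *v (\<eta> *v v j)) (w i)" by simp
      moreover have "B (a' *v x) (w i) = (if 1 \<le> i then e' i * B (v (n - i)) x else 0)" for x
      proof -
        have "B (a' *v x) (w i) = (\<Sum>k\<in>{1..<n}. if k = i then e' i * B (v (n - i)) x else 0)"
          unfolding a'(2) B_left using that by (intro sum.cong) (auto simp: vw)
        then show ?thesis using that by simp
      qed
      moreover have "B (a *v x) (w i) = e i * B (v (n - 1 - i)) x" for x
      proof -
        have "B (a *v x) (w i) = (\<Sum>k<n. if k = i then e i * B (v (n - 1 - i)) x else 0)"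
          unfolding a(2) B_left using that by (intro sum.cong) (auto simp: vw)
        then show ?thesis using that by simp
      qed
      ultimately show ?thesis by (cases "1 \<le> i") (simp_all add: b_def b'_def)
    qed
    have "B (v k) (\<zeta> *v v j) = - B (v j) (\<zeta> *v v k)" if "\<zeta> \<in> s.raising" for \<zeta> j k
    proof -
      have "B (\<zeta> *v v j) (v k) = - B (v j) (\<zeta> *v v k)" using that unfolding s.raising_def so_iff by blast
      then show ?thesis by (simp only: sym[of "v k" "\<zeta> *v v j"])
    qed
    from this[OF \<xi>] this[OF \<eta>] have skew: "b j k = - b k j" "b' j k = - b' k j" for j k
      unfolding b_def b'_def by blast+
    have shift: "b' j k = b j (k + 1)" if "j < n" "k < n - 1" "k \<noteq> r" for j k
    proof -
      define i where "i = n - 1 - k"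
      have i: "n - i = k + 1" "n - 1 - i = k" "1 \<le> i" "i < n" "i < r \<longleftrightarrow> r < k" "i \<le> r \<longleftrightarrow> r \<le> k"
        using that r by (auto simp: i_def)
      then have "e' i * b j (k + 1) = e i * b' j k" using eq[of i j] that by simp
      moreover have "e i = e' i" "e' i \<noteq> 0" using i that(3) by (auto simp: e_def e'_def)
      ultimately show ?thesis by simp
    qed
    have mid: "b j (r + 1) = 0" if "j < n" for j
      using eq[of r j] that r by (simp add: e_def e'_def)
    have last: "b' j (n - 1) = 0" if "j < n" for j
      using eq[of 0 j] that r by (simp add: e_def)
    have z: "b j k = 0" "b' j k = 0" if "j < n" "k < n" for j k
      using skew_pencil_vanish[of n r b b' j k] r skew shift mid last that by blast+
    have zero: "\<zeta> = 0" if \<zeta>: "\<zeta> \<in> s.raising" "\<And>j k. j < n \<Longrightarrow> k < n \<Longrightarrow> B (v k) (\<zeta> *v v j) = 0" for \<zeta>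
    proof -
      have 1: "B (v k) (\<zeta> *v x) = 0" if k: "k < n" for k x
      proof -
        have 2: "\<zeta> *v v k = 0" using \<zeta> v k by (intro sep) (auto simp: s.raising_def)
        have "B (\<zeta> *v v k) x = - B (v k) (\<zeta> *v x)" using \<zeta>(1) unfolding s.raising_def so_iff by blast
        then show ?thesis by (simp add: 2 B_left)
      qed
      have "\<zeta> *v x = 0" for x
      proof (rule sep[OF _ 1])
        obtain u m where x: "u \<in> Vp" "m \<in> Vm" "x = u + m" by (rule decompose)
        then show "\<zeta> *v x \<in> Vm" using \<zeta>(1) by (auto simp: s.raising_def matrix_vector_right_distrib)
      qed
      then show ?thesis by (simp add: matrix_eq)
    qed
    show "\<xi> = 0 \<and> \<eta> = 0" using zero[OF \<xi>] zero[OF \<eta>] z by (auto simp: b_def b'_def)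
  qed (auto intro: commutator_raising s.commutator_raising)
qed

end

lemma commuting_variety_reducible_so:
  fixes B :: "'k::field_char_0^'v::finite \<Rightarrow> 'k^'v \<Rightarrow> 'k"
  assumes "odd n" "n \<ge> 3" "CARD('v) = 2 * n" "nondegenerate_symmetric_form B"
    "isotropic_subspace B Vp" "isotropic_subspace B Vm"
    "Vp \<inter> Vm = {0}" "{u + w | u w. u \<in> Vp \<and> w \<in> Vm} = UNIV"
    "\<forall>u\<in>Vp. S *v u = u" "\<forall>w\<in>Vm. S *v w = - w"
  shows "commuting_variety_reducible mat_scale commutator (minus_part (so_algebra B) (conjugation S))"
proof -
  interpret polarized_form B Vp Vm by unfold_locales (use assms in auto)
  have "vec.dim Vp = n" using dim_Vp assms by simp
  then show ?thesis
    using commuting_variety_reducible_polarized minus_part_so[of S] assms by simp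
qed

section \<open>Eigenvectors and traces\<close>

locale closed_vector_space = vector_space smul
  for smul :: "'k::{alg_closed_field, field_char_0} \<Rightarrow> 'g::ab_group_add \<Rightarrow> 'g"
begin

text \<open>
  For a polynomial \<open>p\<close> of least degree with \<open>p(f) w = 0\<close>, dividing out a root \<open>c\<close> of \<open>p\<close> leaves a polynomial
  whose value at \<open>w\<close> is an eigenvector.
\<close>

lemma eigenvector_exists:
  assumes W: "subspace W" "W \<noteq> {0}" and S: "finite S" "W \<subseteq> span S"
    and f: "\<And>x. x \<in> W \<Longrightarrow> f x \<in> W"
    and add: "\<And>x y. x \<in> W \<Longrightarrow> y \<in> W \<Longrightarrow> f (x + y) = f x + f y"
    and hom: "\<And>c x. x \<in> W \<Longrightarrow> f (smul c x) = smul c (f x)"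
  shows "\<exists>c. \<exists>x\<in>W. x \<noteq> 0 \<and> f x = smul c x"
proof -
  obtain w where w: "w \<in> W" "w \<noteq> 0" using W subspace_0 by blast
  have pow: "(f ^^ i) x \<in> W" if "x \<in> W" for i x using that f by (induction i) auto
  have sums: "(\<Sum>i\<in>I. smul (c i) (v i)) \<in> W \<and> f (\<Sum>i\<in>I. smul (c i) (v i)) = (\<Sum>i\<in>I. smul (c i) (f (v i)))"
    if "\<And>i. v i \<in> W" for c v and I :: "nat set"
  proof (induction I rule: infinite_finite_induct)
    case (insert i I)
    then show ?case using that W by (simp add: add hom subspace_add subspace_scale)
  qed (use hom[OF w(1), of 0] W subspace_0 in auto)
  define n where "n = card S"
  define ev where "ev p = (\<Sum>i\<le>n. smul (coeff p i) ((f ^^ i) w))" for p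
  have ev_W: "ev p \<in> W" for p unfolding ev_def using sums[of "\<lambda>i. (f ^^ i) w"] pow w by blast
  have "\<exists>p. p \<noteq> 0 \<and> degree p \<le> n \<and> ev p = 0"
  proof (cases "inj_on (\<lambda>i. (f ^^ i) w) {..n}")
    case True
    let ?A = "(\<lambda>i. (f ^^ i) w) ` {..n}"
    have "?A \<subseteq> span S" using pow w S by blast
    moreover have "card ?A = n + 1" using True by (simp add: card_image)
    ultimately have "dependent ?A" using independent_span_bound[OF S(1), of ?A] by (auto simp: n_def)
    then obtain u where u: "(\<Sum>v\<in>?A. smul (u v) v) = 0" "\<exists>v\<in>?A. u v \<noteq> 0"
      by (auto simp: dependent_finite)
    define p where "p = (\<Sum>i\<le>n. monom (u ((f ^^ i) w)) i)"
    have cp: "coeff p i = (if i \<le> n then u ((f ^^ i) w) else 0)" for i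
      by (simp add: p_def coeff_sum)
    have "ev p = (\<Sum>v\<in>?A. smul (u v) v)"
      unfolding ev_def by (subst sum.reindex[OF True]) (simp add: cp)
    moreover from u obtain i where "i \<le> n" "u ((f ^^ i) w) \<noteq> 0" by auto
    then have "coeff p i \<noteq> 0" by (simp add: cp)
    then have "p \<noteq> 0" by auto
    moreover have "degree p \<le> n" by (rule degree_le) (simp add: cp)
    ultimately show ?thesis using u by auto
  next
    case False
    then obtain i j where ij: "i \<le> n" "j \<le> n" "i \<noteq> j" "(f ^^ i) w = (f ^^ j) w"
      by (auto simp: inj_on_def)
    let ?p = "monom 1 i - monom 1 j :: 'k poly"
    have "ev ?p = (\<Sum>k\<le>n. (if k = i then (f ^^ i) w else 0) - (if k = j then (f ^^ j) w else 0))"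
      unfolding ev_def by (rule sum.cong) (auto simp: scale_left_diff_distrib)
    then have "ev ?p = 0" using ij by (simp add: sum_subtractf)
    moreover have "coeff ?p i \<noteq> 0" using ij by simp
    then have "?p \<noteq> 0" by (metis coeff_0)
    moreover have "degree ?p \<le> n" by (rule degree_le) (use ij in auto)
    ultimately show ?thesis by blast
  qed
  then obtain p where p: "p \<noteq> 0" "degree p \<le> n" "ev p = 0"
    and min: "\<And>q. q \<noteq> 0 \<and> degree q \<le> n \<and> ev q = 0 \<Longrightarrow> degree p \<le> degree q"
    using ex_has_least_nat[of "\<lambda>p. p \<noteq> 0 \<and> degree p \<le> n \<and> ev p = 0" _ degree] by auto
  have "degree p > 0"
  proof (rule ccontr)
    assume "\<not> degree p > 0"
    then obtain a where a: "p = [:a:]" by (meson degree_eq_zeroE gr0I)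
    have "ev p = (\<Sum>i\<le>n. if i = 0 then smul a w else 0)"
      unfolding ev_def a by (rule sum.cong) (auto simp: coeff_pCons split: nat.splits)
    then show False using p a w by simp
  qed
  then obtain c where "poly p c = 0" using alg_closed_imp_poly_has_root by blast
  then obtain q where q: "p = [:- c, 1:] * q" by (metis dvdE poly_eq_0_iff_dvd)
  have q0: "q \<noteq> 0" using q p by auto
  have deg: "degree p = degree q + 1"
    unfolding q using q0 by (subst degree_mult_eq) auto
  have "f (ev q) = (\<Sum>i\<le>n. smul (coeff q i) ((f ^^ (i + 1)) w))"
    unfolding ev_def using sums[of "\<lambda>i. (f ^^ i) w" "coeff q" "{..n}"] pow w by simp
  also have "\<dots> = (\<Sum>i<n. smul (coeff q i) ((f ^^ (i + 1)) w))"
    using deg p by (intro sum.mono_neutral_right) (auto simp: coeff_eq_0)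
  also have "\<dots> = (\<Sum>i\<in>{1..n}. smul (coeff q (i - 1)) ((f ^^ i) w))"
    by (rule sum.reindex_bij_witness[of _ "\<lambda>i. i - 1" "\<lambda>i. i + 1"]) auto
  also have "\<dots> = (\<Sum>i\<le>n. smul (coeff (pCons 0 q) i) ((f ^^ i) w))"
    by (intro sum.mono_neutral_cong_left) (auto simp: coeff_pCons split: nat.splits)
  finally have f_ev: "f (ev q) = ev (pCons 0 q)" by (simp add: ev_def)
  have "ev p = (\<Sum>i\<le>n. smul (coeff (pCons 0 q) i) ((f ^^ i) w) - smul c (smul (coeff q i) ((f ^^ i) w)))"
    unfolding ev_def q by (rule sum.cong) (auto simp: scale_left_diff_distrib)
  then have "ev p = f (ev q) - smul c (ev q)"
    by (simp add: sum_subtractf f_ev) (simp add: ev_def scale_sum_right)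
  then have "f (ev q) = smul c (ev q)" using p by simp
  moreover have "ev q \<noteq> 0" using min[of q] q0 deg p by auto
  ultimately show ?thesis using ev_W by blast
qed

text \<open>Unless all members of \<open>F\<close> are scalar on \<open>W\<close>, an eigenspace of one of them is a smaller stable subspace.\<close>

lemma common_eigenvector_exists:
  assumes W: "subspace W" "W \<noteq> {0}" and S: "finite S" "W \<subseteq> span S"
    and F: "\<And>f x. f \<in> F \<Longrightarrow> x \<in> W \<Longrightarrow> f x \<in> W"
    and lin: "\<And>f x y. f \<in> F \<Longrightarrow> x \<in> W \<Longrightarrow> y \<in> W \<Longrightarrow> f (x + y) = f x + f y"
      "\<And>f x c. f \<in> F \<Longrightarrow> x \<in> W \<Longrightarrow> f (smul c x) = smul c (f x)"
    and comm: "\<And>f g x. f \<in> F \<Longrightarrow> g \<in> F \<Longrightarrow> x \<in> W \<Longrightarrow> f (g x) = g (f x)"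
  shows "\<exists>x\<in>W. x \<noteq> 0 \<and> (\<forall>f\<in>F. \<exists>c. f x = smul c x)"
  using assms
proof (induction "card S" arbitrary: W S rule: less_induct)
  case less
  show ?case
  proof (cases "\<forall>f\<in>F. \<exists>c. \<forall>x\<in>W. f x = smul c x")
    case True
    obtain x where "x \<in> W" "x \<noteq> 0" using less.prems(1,2) subspace_0 by blast
    with True show ?thesis by (intro bexI[of _ x]) auto
  next
    case False
    then obtain f where f: "f \<in> F" "\<And>c. \<exists>x\<in>W. f x \<noteq> smul c x" by blast
    obtain c x where c: "x \<in> W" "x \<noteq> 0" "f x = smul c x"
      using eigenvector_exists[OF less.prems(1-4), of f] less.prems(5-7)[OF f(1)] by blast
    let ?E = "{x \<in> W. f x = smul c x}"
    have E: "subspace ?E"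
      using less.prems(1) subspace_0[OF less.prems(1)] less.prems(7)[OF f(1), of 0 0]
      by (intro subspaceI)
        (auto simp: less.prems(6)[OF f(1)] less.prems(7)[OF f(1)] subspace_add subspace_scale scale_right_distrib mult.commute)
    obtain w where w: "w \<in> W" "f w \<noteq> smul c w" using f by blast
    obtain A where A: "A \<subseteq> ?E" "independent A" "?E \<subseteq> span A" "card A = dim ?E"
      by (rule basis_exists)
    have "w \<notin> span A" using span_minimal[OF A(1) E] w by blast
    then have ind: "independent (insert w A)" using A by (simp add: independent_insert)
    have "insert w A \<subseteq> span S" using A w less.prems(4) by blast
    from independent_span_bound[OF less.prems(3) ind this]
    have fin: "finite A" "card (insert w A) \<le> card S" by auto
    moreover have "w \<notin> A" using \<open>w \<notin> span A\<close> span_base by blast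
    ultimately have "card A < card S" by simp
    moreover have "?E \<noteq> {0}" using c by auto
    moreover have "g x \<in> ?E" if "g \<in> F" "x \<in> ?E" for g x
      using that less.prems(5)[of g x] less.prems(8)[of f g x] less.prems(7)[of g x c] f by auto
    ultimately have "\<exists>x\<in>?E. x \<noteq> 0 \<and> (\<forall>f\<in>F. \<exists>c. f x = smul c x)"
      using E fin(1) A(3) by (intro less.hyps) (auto simp: less.prems(6,7,8))
    then show ?thesis by blast
  qed
qed

end

text \<open>A bracket that is bilinear on the whole ambient space spares the side conditions \<open>x \<in> L\<close>.\<close>

locale total_lie_algebra = closed_vector_space smul
  for smul :: "'k::{alg_closed_field, field_char_0} \<Rightarrow> 'g::ab_group_add \<Rightarrow> 'g" +
  fixes L :: "'g set" and br :: "'g \<Rightarrow> 'g \<Rightarrow> 'g"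
  assumes subspace_L: "subspace L"
    and br_in: "br x y \<in> L"
    and br_add_left: "br (x + y) z = br x z + br y z"
    and br_add_right: "br x (y + z) = br x y + br x z"
    and br_scale_left: "br (smul c x) y = smul c (br x y)"
    and br_scale_right: "br x (smul c y) = smul c (br x y)"
    and br_self: "br x x = 0"
    and jacobi: "br x (br y z) + br y (br z x) + br z (br x y) = 0"
begin

lemma br_zero [simp]: "br 0 x = 0" "br x 0 = 0"
  using br_scale_left[of 0 0 x] br_scale_right[of x 0 0] by simp_all

lemma br_neg [simp]: "br (- x) y = - br x y" "br x (- y) = - br x y"
  using br_scale_left[of "- 1" x y] br_scale_right[of x "- 1" y] by simp_all

lemma br_diff: "br (x - y) z = br x z - br y z" "br x (y - z) = br x y - br x z"
  using br_add_left[of x "- y" z] br_add_right[of x y "- z"] by simp_all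

lemma br_anti: "br y x = - br x y"
proof -
  have "br x y + br y x = br (x + y) (x + y) - br x x - br y y"
    by (simp add: br_add_left br_add_right)
  then have "br x y + br y x = 0" by (simp add: br_self)
  then show ?thesis by (simp only: add_eq_0_iff)
qed

lemma br_br: "br (br x y) z = br x (br y z) - br y (br x z)"
proof -
  have "br x (br y z) - br y (br x z) - br (br x y) z = 0"
    using jacobi[of x y z] br_anti[of x z] br_anti[of z "br x y"] by simp
  then show ?thesis by simp
qed

lemma br_sum: "br (\<Sum>i\<in>I. f i) y = (\<Sum>i\<in>I. br (f i) y)" "br x (\<Sum>i\<in>I. f i) = (\<Sum>i\<in>I. br x (f i))"
  by (induction I rule: infinite_finite_induct) (auto simp: br_add_left br_add_right)

lemmas br_linear = br_add_left br_add_right br_scale_left br_scale_right br_diff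

lemma linear_br: "Vector_Spaces.linear smul smul (br x)"
  by (simp add: Vector_Spaces.linear_iff vector_space_axioms br_linear)

end

text \<open>
  The Killing form, with traces taken in a basis of eigenvectors of \<open>ad h\<close> with integral eigenvalues:
  then \<open>\<kappa>(h, h)\<close> is a sum of squares of integers, which is not zero. As the radical is an
  ideal, \<open>\<kappa>\<close> is nondegenerate.
\<close>

locale integral_simple_lie_algebra = total_lie_algebra smul L br
  for smul :: "'k::{alg_closed_field, field_char_0} \<Rightarrow> 'g::ab_group_add \<Rightarrow> 'g" and L br +
  fixes Bs :: "'g set" and h :: 'g and ev :: "'g \<Rightarrow> int"
  assumes simple: "subspace I \<Longrightarrow> I \<subseteq> L \<Longrightarrow> (\<And>x y. x \<in> L \<Longrightarrow> y \<in> I \<Longrightarrow> br x y \<in> I) \<Longrightarrow> I = {0} \<or> I = L"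
    and basis: "finite Bs" "independent Bs" "span Bs = L"
    and h: "h \<in> L" "\<And>b. b \<in> Bs \<Longrightarrow> br h b = smul (of_int (ev b)) b"
    and ev_nonzero: "\<exists>b\<in>Bs. ev b \<noteq> 0"
begin

definition tr :: "('g \<Rightarrow> 'g) \<Rightarrow> 'k" where
  "tr f = (\<Sum>b\<in>Bs. representation Bs (f b) b)"

definition kf :: "'g \<Rightarrow> 'g \<Rightarrow> 'k" where
  "kf x y = tr (\<lambda>v. br x (br y v))"

lemma tr_commute:
  assumes f: "Vector_Spaces.linear smul smul f" "\<And>x. f x \<in> L"
    and g: "Vector_Spaces.linear smul smul g" "\<And>x. g x \<in> L"
  shows "tr (\<lambda>v. f (g v)) = tr (\<lambda>v. g (f v))"
proof -
  have expand: "representation Bs (f v) b = (\<Sum>c\<in>Bs. representation Bs v c * representation Bs (f c) b)"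
    if v: "v \<in> L" and f: "Vector_Spaces.linear smul smul f" "\<And>x. f x \<in> L" for f v b
  proof -
    interpret f: Vector_Spaces.linear smul smul f by (rule f(1))
    have "f v = f (\<Sum>c\<in>Bs. smul (representation Bs v c) c)"
      using v basis by (subst sum_representation_eq) auto
    also have "\<dots> = (\<Sum>c\<in>Bs. smul (representation Bs v c) (f c))" by (simp add: f.sum f.scale)
    finally show ?thesis
      using basis f(2) by (simp add: representation_sum representation_scale subspace_scale[OF subspace_L])
  qed
  have "tr (\<lambda>v. f (g v)) = (\<Sum>b\<in>Bs. \<Sum>c\<in>Bs. representation Bs (g b) c * representation Bs (f c) b)"
    unfolding tr_def by (simp add: expand[OF g(2) f])
  also have "\<dots> = (\<Sum>c\<in>Bs. \<Sum>b\<in>Bs. representation Bs (f c) b * representation Bs (g b) c)"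
    by (subst sum.swap) (simp add: mult.commute)
  also have "\<dots> = tr (\<lambda>v. g (f v))"
    unfolding tr_def by (simp add: expand[OF f(2) g])
  finally show ?thesis .
qed

lemma tr_add: "(\<And>x. f x \<in> L) \<Longrightarrow> (\<And>x. g x \<in> L) \<Longrightarrow> tr (\<lambda>v. f v + g v) = tr f + tr g"
  and tr_diff: "(\<And>x. f x \<in> L) \<Longrightarrow> (\<And>x. g x \<in> L) \<Longrightarrow> tr (\<lambda>v. f v - g v) = tr f - tr g"
  and tr_scale: "(\<And>x. f x \<in> L) \<Longrightarrow> tr (\<lambda>v. smul c (f v)) = c * tr f"
  using basis
  by (simp_all add: tr_def representation_add representation_diff representation_scale sum.distrib sum_subtractf sum_distrib_left)

lemma kf_add: "kf (x + y) z = kf x z + kf y z" "kf x (y + z) = kf x y + kf x z"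
  by (simp_all add: kf_def br_linear tr_add br_in)

lemma kf_scale: "kf (smul c x) y = c * kf x y" "kf x (smul c y) = c * kf x y"
  by (simp_all add: kf_def br_linear tr_scale br_in)

lemma kf_diff: "kf (x - y) z = kf x z - kf y z" "kf x (y - z) = kf x y - kf x z"
  by (simp_all add: kf_def br_linear tr_diff br_in)

lemma kf_zero [simp]: "kf 0 x = 0" "kf x 0 = 0"
  using kf_scale(1)[of 0 0 x] kf_scale(2)[of x 0 0] by simp_all

lemma kf_neg [simp]: "kf (- x) y = - kf x y" "kf x (- y) = - kf x y"
  using kf_scale(1)[of "- 1" x y] kf_scale(2)[of x "- 1" y] by simp_all

lemma kf_sum: "kf (\<Sum>i\<in>I. f i) y = (\<Sum>i\<in>I. kf (f i) y)" "kf y (\<Sum>i\<in>I. f i) = (\<Sum>i\<in>I. kf y (f i))"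
  by (induction I rule: infinite_finite_induct) (auto simp: kf_add)

lemma kf_sym: "kf x y = kf y x"
  unfolding kf_def by (rule tr_commute) (simp_all add: linear_br br_in)

lemma kf_invariant: "kf (br x y) z = kf x (br y z)"
proof -
  have lin: "Vector_Spaces.linear smul smul (\<lambda>v. br x (br z v))"
    by (simp add: Vector_Spaces.linear_iff vector_space_axioms br_linear)
  have "kf (br x y) z = tr (\<lambda>v. br x (br y (br z v))) - tr (\<lambda>v. br y (br x (br z v)))"
    unfolding kf_def by (simp add: br_br tr_diff br_in)
  also have "tr (\<lambda>v. br y (br x (br z v))) = tr (\<lambda>v. br x (br z (br y v)))"
    by (rule tr_commute[OF linear_br br_in lin br_in])
  also have "tr (\<lambda>v. br x (br y (br z v))) - tr (\<lambda>v. br x (br z (br y v))) = kf x (br y z)"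
    unfolding kf_def by (simp add: br_br br_diff tr_diff br_in)
  finally show ?thesis .
qed

lemma kf_nondegenerate:
  assumes "x \<in> L" "\<And>y. y \<in> L \<Longrightarrow> kf x y = 0"
  shows "x = 0"
proof -
  let ?R = "{x \<in> L. \<forall>y\<in>L. kf x y = 0}"
  have "?R = {0} \<or> ?R = L"
  proof (rule simple)
    show "subspace ?R"
      using subspace_L by (intro subspaceI) (auto simp: kf_add kf_scale subspace_0 subspace_add subspace_scale)
    fix x y assume y: "y \<in> ?R"
    have "kf (br x y) z = 0" if "z \<in> L" for z
      using y br_in[of x z] kf_invariant[of y x z] br_anti[of x y] by auto
    then show "br x y \<in> ?R" by (simp add: br_in)
  qed auto
  moreover have "kf h h \<noteq> 0"
  proof -
    have "kf h h = (\<Sum>b\<in>Bs. of_int ((ev b)\<^sup>2))"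
      unfolding kf_def tr_def
    proof (rule sum.cong)
      fix b assume b: "b \<in> Bs"
      then have "br h (br h b) = smul (of_int ((ev b)\<^sup>2)) b"
        by (simp add: h br_scale_right power2_eq_square)
      then show "representation Bs (br h (br h b)) b = of_int ((ev b)\<^sup>2)"
        using b basis representation_scale[of Bs b] span_base[OF b] by (simp add: representation_basis)
    qed simp
    also have "\<dots> = of_int (\<Sum>b\<in>Bs. (ev b)\<^sup>2)" by simp
    also have "\<dots> \<noteq> 0"
      using ev_nonzero basis(1) by (subst of_int_eq_0_iff) (auto simp: sum_nonneg_eq_0_iff)
    finally show ?thesis .
  qed
  then have "h \<notin> ?R" using h(1) by auto
  ultimately show ?thesis using h(1) assms by auto
qed

end

section \<open>Symmetric pairs with a central element\<close>

locale centered_pair = integral_simple_lie_algebra smul L br Bs h ev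
  for smul :: "'k::{alg_closed_field, field_char_0} \<Rightarrow> 'g::ab_group_add \<Rightarrow> 'g" and L br Bs h ev +
  fixes \<sigma> :: "'g \<Rightarrow> 'g" and z :: 'g and g0 g1 :: "'g set"
  assumes sigma: "Vector_Spaces.linear smul smul \<sigma>" "\<And>x. \<sigma> x \<in> L" "\<And>x. x \<in> L \<Longrightarrow> \<sigma> (\<sigma> x) = x"
      "\<And>x y. \<sigma> (br x y) = br (\<sigma> x) (\<sigma> y)"
    and g0_def: "g0 = {x \<in> L. \<sigma> x = x}" and g1_def: "g1 = {x \<in> L. \<sigma> x = - x}"
    and z: "z \<in> g0" "z \<noteq> 0" "\<And>x. x \<in> g0 \<Longrightarrow> br z x = 0"
    and perfect: "g0 \<subseteq> span (insert z {br x y | x y. x \<in> g0 \<and> y \<in> g0})"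
begin

lemma sigma_linear: "\<sigma> (x + y) = \<sigma> x + \<sigma> y" "\<sigma> (smul c x) = smul c (\<sigma> x)" "\<sigma> 0 = 0" "\<sigma> (- x) = - \<sigma> x"
  "\<sigma> (x - y) = \<sigma> x - \<sigma> y"
proof -
  interpret s: Vector_Spaces.linear smul smul \<sigma> by (rule sigma(1))
  show "\<sigma> (x + y) = \<sigma> x + \<sigma> y" "\<sigma> (smul c x) = smul c (\<sigma> x)" "\<sigma> 0 = 0" "\<sigma> (- x) = - \<sigma> x"
    "\<sigma> (x - y) = \<sigma> x - \<sigma> y"
    by (rule s.add s.scale s.zero s.neg s.diff)+
qed

lemma subspace_g0: "subspace g0" and subspace_g1: "subspace g1"
  using subspace_L unfolding g0_def g1_def
  by (auto intro!: subspaceI simp: sigma_linear subspace_0 subspace_add subspace_scale)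

lemma g0_L: "x \<in> g0 \<Longrightarrow> x \<in> L" and g1_L: "x \<in> g1 \<Longrightarrow> x \<in> L"
  by (auto simp: g0_def g1_def)

lemma br_g: "x \<in> g0 \<Longrightarrow> y \<in> g0 \<Longrightarrow> br x y \<in> g0" "x \<in> g0 \<Longrightarrow> y \<in> g1 \<Longrightarrow> br x y \<in> g1"
  "x \<in> g1 \<Longrightarrow> y \<in> g0 \<Longrightarrow> br x y \<in> g1" "x \<in> g1 \<Longrightarrow> y \<in> g1 \<Longrightarrow> br x y \<in> g0"
  by (auto simp: g0_def g1_def sigma br_in)

lemma double_zero: "x = 0" if "x = - x" for x :: 'g
proof -
  have "smul 2 x = x + x" using scale_left_distrib[of 1 1 x] by simp
  also have "\<dots> = 0" using that by (simp add: eq_neg_iff_add_eq_0)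
  finally show ?thesis by simp
qed

lemma decompose:
  assumes "x \<in> L"
  obtains u v where "u \<in> g0" "v \<in> g1" "x = u + v"
proof
  let ?u = "smul (1 / 2) (x + \<sigma> x)" and ?v = "smul (1 / 2) (x - \<sigma> x)"
  show "?u \<in> g0" "?v \<in> g1"
    using assms sigma subspace_L
    by (auto simp: g0_def g1_def sigma_linear subspace_add subspace_diff subspace_scale add.commute
        scale_minus_right[symmetric] simp del: scale_minus_right)
  have "?u + ?v = smul (1 / 2) (x + x)" by (simp add: scale_right_distrib[symmetric])
  also have "\<dots> = x" using scale_left_distrib[of "1 / 2" "1 / 2" x] by (simp add: scale_right_distrib)
  finally show "x = ?u + ?v" ..
qed

lemma subspace_br_preimage:
  assumes "subspace A" "subspace B"
  shows "subspace {y \<in> A. \<forall>v\<in>C. br y v \<in> B}" "subspace {y \<in> A. \<forall>v\<in>C. br v y \<in> B}"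
  using subspace_0[OF assms(1)] subspace_0[OF assms(2)] subspace_add[OF assms(1)] subspace_add[OF assms(2)]
    subspace_scale[OF assms(1)] subspace_scale[OF assms(2)]
  by (auto intro!: subspaceI simp: br_linear)

lemma g0_Int_g1: "x \<in> g0 \<Longrightarrow> x \<in> g1 \<Longrightarrow> x = 0"
  using double_zero by (auto simp: g0_def g1_def)

lemma graded_ideal:
  assumes I0: "subspace I0" "I0 \<subseteq> g0" and I1: "subspace I1" "I1 \<subseteq> g1"
    and 00: "\<And>x y. x \<in> g0 \<Longrightarrow> y \<in> I0 \<Longrightarrow> br x y \<in> I0"
    and 01: "\<And>x y. x \<in> g0 \<Longrightarrow> y \<in> I1 \<Longrightarrow> br x y \<in> I1"
    and 10: "\<And>x y. x \<in> g1 \<Longrightarrow> y \<in> I0 \<Longrightarrow> br x y \<in> I1"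
    and 11: "\<And>x y. x \<in> g1 \<Longrightarrow> y \<in> I1 \<Longrightarrow> br x y \<in> I0"
    and ne: "I1 \<noteq> {0}"
  shows "I1 = g1"
proof -
  let ?I = "{x + y | x y. x \<in> I0 \<and> y \<in> I1}"
  have "?I = {0} \<or> ?I = L"
  proof (rule simple)
    show "subspace ?I" by (rule subspace_sums[OF I0(1) I1(1)])
    show "?I \<subseteq> L" using I0 I1 g0_L g1_L subspace_L by (auto intro!: subspace_add)
    fix x y assume x: "x \<in> L" and y: "y \<in> ?I"
    obtain u v where uv: "u \<in> g0" "v \<in> g1" "x = u + v" using decompose[OF x] .
    obtain a b where ab: "a \<in> I0" "b \<in> I1" "y = a + b" using y by blast
    have "br x y = (br u a + br v b) + (br u b + br v a)"
      by (simp add: uv ab br_linear algebra_simps)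
    moreover have "br u a + br v b \<in> I0" "br u b + br v a \<in> I1"
      using subspace_add[OF I0(1) 00[OF uv(1) ab(1)] 11[OF uv(2) ab(2)]]
        subspace_add[OF I1(1) 01[OF uv(1) ab(2)] 10[OF uv(2) ab(1)]] by auto
    ultimately show "br x y \<in> ?I" by blast
  qed
  moreover have "I1 \<subseteq> ?I" using subspace_0[OF I0(1)] by force
  then have "?I \<noteq> {0}" using ne subspace_0[OF I1(1)] by blast
  ultimately have IL: "?I = L" by blast
  have "x \<in> I1" if x: "x \<in> g1" for x
  proof -
    obtain a b where ab: "a \<in> I0" "b \<in> I1" "x = a + b" using IL g1_L[OF x] by blast
    have "x - b \<in> g1" using x ab I1 subspace_g1 subspace_diff by blast
    then have "a = 0" using ab I0 g0_Int_g1[of a] by auto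
    then show ?thesis using ab by simp
  qed
  then show ?thesis using I1 by blast
qed

text \<open>
  \<open>Q = (ad z)\<^sup>2 - c\<close> is symmetric in the sense that \<open>[Qx, y] = [x, Qy]\<close> on \<open>g1\<close> and commutes with \<open>g0\<close>.
  The trilinear map \<open>[[Qx, y], w] - Q[[x, y], w]\<close> is alternating in \<open>x, y\<close> and, by the Jacobi identity,
  symmetric in \<open>y, w\<close>; hence it vanishes, and the kernel of \<open>Q\<close> on \<open>g1\<close> generates an ideal without
  growing inside \<open>g1\<close>. So an eigenspace of \<open>(ad z)\<^sup>2\<close> is all of \<open>g1\<close>.
\<close>

lemma ad_z_square: "\<exists>c. \<forall>x\<in>g1. br z (br z x) = smul c x"
proof (cases "g1 = {0}")
  case True
  then show ?thesis by auto
next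
  case ne: False
  have z1: "br z x \<in> g1" if "x \<in> g1" for x using that z br_g by blast
  have z_g0: "br z (br u x) = br u (br z x)" if "u \<in> g0" for u x
    using br_br[of z u x] z(3)[OF that] by simp
  have Dsym: "br (br z x) y = - br x (br z y)" if "x \<in> g1" "y \<in> g1" for x y
    using br_br[of z x y] z(3)[OF br_g(4)[OF that]] by simp
  have "\<exists>c. \<exists>x\<in>g1. x \<noteq> 0 \<and> br z (br z x) = smul c x"
    by (rule eigenvector_exists[of g1 Bs])
      (use subspace_g1 ne basis g1_L z1 in \<open>auto simp: br_linear\<close>)
  then obtain c x0 where c: "x0 \<in> g1" "x0 \<noteq> 0" "br z (br z x0) = smul c x0" by blast
  define Q where "Q x = br z (br z x) - smul c x" for x
  have Q_diff: "Q (x - y) = Q x - Q y" and Q_neg: "Q (- x) = - Q x" for x y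
    by (simp_all add: Q_def br_linear scale_right_diff_distrib)
  have Q1: "Q x \<in> g1" if "x \<in> g1" for x
    unfolding Q_def using that z1 subspace_g1 by (intro subspace_diff subspace_scale) auto
  have Q_g0: "Q (br u x) = br u (Q x)" if "u \<in> g0" for u x
    using that by (simp add: Q_def br_linear z_g0)
  have Q_sym: "br (Q x) y = br x (Q y)" if "x \<in> g1" "y \<in> g1" for x y
    using that z1 by (simp add: Q_def br_linear Dsym)
  define G where "G x y w = br (br (Q x) y) w - Q (br (br x y) w)" for x y w
  have anti: "G y x w = - G x y w" if "x \<in> g1" "y \<in> g1" "w \<in> g1" for x y w
    using that br_anti[of "Q x" y] br_anti[of x y] Q_sym[of y x]
    by (simp add: G_def Q_neg br_anti[of "Q x" y])
  have jac: "br (br a b) d - br (br a d) b = - br (br b d) a" for a b d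
    using br_br[of a b d] br_anti[of b "br a d"] br_anti[of a "br b d"] by simp
  have symm: "G x y w = G x w y" if "x \<in> g1" "y \<in> g1" "w \<in> g1" for x y w
  proof -
    have "G x y w - G x w y = (br (br (Q x) y) w - br (br (Q x) w) y) - Q (br (br x y) w - br (br x w) y)"
      by (simp add: G_def Q_diff)
    also have "\<dots> = - br (br y w) (Q x) + Q (br (br y w) x)" by (simp only: jac Q_neg) simp
    also have "\<dots> = 0" using that br_g by (simp add: Q_g0)
    finally show ?thesis by simp
  qed
  have G0: "G x y w = 0" if "x \<in> g1" "y \<in> g1" "w \<in> g1" for x y w
  proof (rule double_zero)
    have "G x y w = - G y x w" using anti[of y x w] that by simp
    also have "\<dots> = - G y w x" using symm[of y x w] that by simp
    also have "\<dots> = G w y x" using anti[of y w x] that by simp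
    also have "\<dots> = G w x y" using symm[of w y x] that by simp
    also have "\<dots> = - G x w y" using anti[of x w y] that by simp
    also have "\<dots> = - G x y w" using symm[of x y w] that by simp
    finally show "G x y w = - G x y w" .
  qed
  let ?I1 = "{x \<in> g1. Q x = 0}"
  let ?I0 = "{u \<in> g0. \<forall>w\<in>g1. br u w \<in> ?I1}"
  have sub1: "subspace ?I1"
    using subspace_g1
    by (intro subspaceI) (auto simp: Q_def br_linear subspace_0 subspace_add subspace_scale scale_right_distrib mult.commute)
  have "?I1 = g1"
  proof (rule graded_ideal[of ?I0])
    show "subspace ?I0" by (rule subspace_br_preimage(1)[OF subspace_g0 sub1])
    show "br u y \<in> ?I1" if "u \<in> g0" "y \<in> ?I1" for u y
      using that br_g by (simp add: Q_g0)
    show "br u y \<in> ?I0" if u: "u \<in> g0" and y: "y \<in> ?I0" for u y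
    proof -
      have "br (br u y) w \<in> ?I1" if w: "w \<in> g1" for w
      proof -
        have "br y w \<in> ?I1" "br y (br u w) \<in> ?I1" using y w br_g(2)[OF u w] by blast+
        moreover from this(1) have "br u (br y w) \<in> ?I1" using u br_g by (simp add: Q_g0)
        ultimately have "br u (br y w) \<in> ?I1" "br y (br u w) \<in> ?I1" by blast+
        then show ?thesis unfolding br_br using sub1 subspace_diff by blast
      qed
      then show ?thesis using that br_g by blast
    qed
    show "br w y \<in> ?I1" if "w \<in> g1" "y \<in> ?I0" for w y
    proof -
      have "- br y w \<in> ?I1" using that by (intro subspace_neg[OF sub1]) blast
      then show ?thesis by (simp only: br_anti[of w y])
    qed
    show "br w y \<in> ?I0" if w: "w \<in> g1" and y: "y \<in> ?I1" for w y
    proof -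
      have "br (br w y) v \<in> ?I1" if v: "v \<in> g1" for v
      proof -
        have "br (br y w) v \<in> ?I1" using G0[of y w v] v w y br_g by (simp add: G_def)
        then have "- br (br y w) v \<in> ?I1" by (rule subspace_neg[OF sub1])
        then show ?thesis by (simp only: br_anti[of w y] br_neg)
      qed
      moreover have "br w y \<in> g0" using br_g(4)[OF w] y by simp
      ultimately show ?thesis by simp
    qed
    have "x0 \<in> ?I1" using c by (simp add: Q_def)
    then show "?I1 \<noteq> {0}" using c by blast
  qed (use sub1 in auto)
  then have "br z (br z x) = smul c x" if "x \<in> g1" for x using that by (auto simp: Q_def)
  then show ?thesis by blast
qed

lemma kf_sigma:
  assumes "x \<in> L" "y \<in> L"
  shows "kf (\<sigma> x) (\<sigma> y) = kf x y"
proof -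
  have lin: "Vector_Spaces.linear smul smul (\<lambda>v. br x (br y (\<sigma> v)))"
    by (simp add: Vector_Spaces.linear_iff vector_space_axioms br_linear sigma_linear)
  have BL: "b \<in> Bs \<Longrightarrow> b \<in> L" for b using basis span_base by blast
  have "kf (\<sigma> x) (\<sigma> y) = tr (\<lambda>v. \<sigma> (br x (br y (\<sigma> v))))"
    unfolding kf_def tr_def by (rule sum.cong) (simp_all add: sigma BL)
  also have "\<dots> = tr (\<lambda>v. br x (br y (\<sigma> (\<sigma> v))))"
    using tr_commute[OF sigma(1,2) lin br_in] by simp
  also have "\<dots> = kf x y"
    unfolding kf_def tr_def by (rule sum.cong) (simp_all add: sigma BL)
  finally show ?thesis .
qed

lemma kf_g0_g1: "x \<in> g0 \<Longrightarrow> y \<in> g1 \<Longrightarrow> kf x y = 0"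
  using kf_sigma[of x y] by (simp add: g0_def g1_def)

lemma kf_nondegenerate_g0: "x \<in> g0 \<Longrightarrow> (\<And>y. y \<in> g0 \<Longrightarrow> kf x y = 0) \<Longrightarrow> x = 0"
  by (rule kf_nondegenerate) (auto simp: g0_L kf_add kf_g0_g1 elim!: decompose)

lemma kf_nondegenerate_g1: "x \<in> g1 \<Longrightarrow> (\<And>y. y \<in> g1 \<Longrightarrow> kf x y = 0) \<Longrightarrow> x = 0"
  by (rule kf_nondegenerate) (auto simp: g1_L kf_add kf_g0_g1 kf_sym[of x] elim!: decompose)

lemma kf_z: "kf z z \<noteq> 0"
proof
  assume 0: "kf z z = 0"
  have "kf z y = 0" if "y \<in> span (insert z {br x y | x y. x \<in> g0 \<and> y \<in> g0})" for y
    using that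
  proof (induction rule: span_induct_alt)
    case (step c x y)
    then have "kf z x = 0" using 0 by (auto simp: kf_invariant[symmetric] z)
    then show ?case using step by (simp add: kf_add kf_scale)
  qed simp
  then have "z = 0" using perfect z by (intro kf_nondegenerate_g0) auto
  then show False using z by simp
qed

definition V :: "'k \<Rightarrow> 'g set" where
  "V s = {x \<in> g1. br z x = smul s x}"

text \<open>The scalar by which \<open>(ad z)\<^sup>2\<close> acts on \<open>g1\<close> is not zero, since otherwise \<open>\<kappa>(z, z) = 0\<close>.\<close>

lemma weight_of_z:
  obtains s where "s \<noteq> 0" "g1 = {x + y | x y. x \<in> V s \<and> y \<in> V (- s)}"
proof -
  obtain c where c: "\<And>x. x \<in> g1 \<Longrightarrow> br z (br z x) = smul c x" using ad_z_square by blast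
  have "c \<noteq> 0"
  proof
    assume "c = 0"
    have "br z (br z b) = 0" if "b \<in> L" for b
    proof -
      obtain u v where uv: "u \<in> g0" "v \<in> g1" "b = u + v" using decompose[OF \<open>b \<in> L\<close>] .
      then show ?thesis using c[of v] \<open>c = 0\<close> z by (simp add: br_linear)
    qed
    moreover have "b \<in> L" if "b \<in> Bs" for b using that basis span_base by blast
    ultimately have "kf z z = 0" by (simp add: kf_def tr_def representation_zero)
    then show False using kf_z by simp
  qed
  obtain s where s: "s ^ 2 = c" using nth_root_exists[of 2 c] by auto
  then have s0: "s \<noteq> 0" using \<open>c \<noteq> 0\<close> by auto
  have ss: "smul (s * s) x = smul c x" for x using s by (simp add: power2_eq_square)
  have half: "smul (1 / (2 * s)) (smul s x + smul s x) = x" for x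
    using s0 scale_left_distrib[of "1 / 2" "1 / 2" x] by (simp add: scale_right_distrib)
  have "x \<in> {x + y | x y. x \<in> V s \<and> y \<in> V (- s)}" if x: "x \<in> g1" for x
  proof -
    let ?x = "smul (1 / (2 * s)) (smul s x + br z x)" and ?y = "smul (1 / (2 * s)) (smul s x - br z x)"
    have g: "?x \<in> g1" "?y \<in> g1" using x z br_g subspace_g1
      by (auto intro!: subspace_scale subspace_add subspace_diff)
    have "br z ?x = smul s ?x" "br z ?y = smul (- s) ?y"
      using c[OF x] s0 by (simp_all add: br_linear scale_right_distrib scale_right_diff_distrib ss[symmetric] mult.commute)
    then have "?x \<in> V s" "?y \<in> V (- s)" using g by (auto simp: V_def)
    moreover have "?x + ?y = smul (1 / (2 * s)) (smul s x + smul s x)"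
      by (simp add: scale_right_distrib[symmetric])
    then have "x = ?x + ?y" using half by simp
    ultimately show ?thesis by blast
  qed
  moreover have "x + y \<in> g1" if "x \<in> V s" "y \<in> V (- s)" for x y
    using that subspace_g1 by (auto simp: V_def intro: subspace_add)
  ultimately show thesis using that[OF s0] by blast
qed

lemma subspace_V: "subspace (V s)"
  using subspace_g1
  by (intro subspaceI) (auto simp: V_def br_linear subspace_0 subspace_add subspace_scale scale_right_distrib mult.commute)

lemma V_g1: "x \<in> V s \<Longrightarrow> x \<in> g1"
  by (simp add: V_def)

lemma br_g0_V: "u \<in> g0 \<Longrightarrow> x \<in> V s \<Longrightarrow> br u x \<in> V s"
  using br_br[of z u x] z(3)[of u] br_g by (auto simp: V_def br_linear)

lemma br_V_V: "s \<noteq> 0 \<Longrightarrow> x \<in> V s \<Longrightarrow> y \<in> V s \<Longrightarrow> br x y = 0"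
proof -
  assume "s \<noteq> 0" "x \<in> V s" "y \<in> V s"
  then have "smul s (br x y) = - smul s (br x y)"
    using br_br[of z x y] z(3)[of "br x y"] br_g(4) by (auto simp: V_def br_linear)
  from double_zero[OF this] show ?thesis using \<open>s \<noteq> 0\<close> by simp
qed

lemma V_Int_V: "s \<noteq> 0 \<Longrightarrow> x \<in> V s \<Longrightarrow> x \<in> V (- s) \<Longrightarrow> x = 0"
  using double_zero[of "smul s x"] by (simp add: V_def)

lemma kf_V_V:
  assumes "s \<noteq> 0" "x \<in> V s" "y \<in> V s"
  shows "kf x y = 0"
proof -
  have "s * kf x y = kf (br z x) y" using assms by (simp add: V_def kf_scale)
  also have "\<dots> = - kf x (br z y)" using kf_invariant[of x z y] br_anti[of x z]
    by (simp add: neg_eq_iff_add_eq_0 eq_neg_iff_add_eq_0)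
  also have "\<dots> = - (s * kf x y)" using assms by (simp add: V_def kf_scale)
  finally show ?thesis using assms(1) by (simp add: eq_neg_iff_add_eq_0)
qed

end

text \<open>Now \<open>g1 = V s \<oplus> V (-s)\<close>, and the grading by \<open>ad z\<close> makes both summands abelian.\<close>

locale graded_pair = centered_pair smul L br Bs h ev \<sigma> z g0 g1
  for smul :: "'k::{alg_closed_field, field_char_0} \<Rightarrow> 'g::ab_group_add \<Rightarrow> 'g"
    and L br Bs h ev \<sigma> z g0 g1 +
  fixes s :: 'k
  assumes s: "s \<noteq> 0" "g1 = {x + y | x y. x \<in> V s \<and> y \<in> V (- s)}"
begin

lemma g1_split:
  assumes "x \<in> g1"
  obtains a b where "a \<in> V s" "b \<in> V (- s)" "x = a + b"
  using subsetD[OF equalityD1[OF s(2)] assms] by blast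

lemma opposite: "graded_pair smul L br Bs h ev \<sigma> z g0 g1 (- s)"
proof
  have "x \<in> {x + y | x y. x \<in> V (- s) \<and> y \<in> V (- (- s))}" if x: "x \<in> g1" for x
  proof -
    obtain a b where "a \<in> V s" "b \<in> V (- s)" "x = a + b" using g1_split[OF x] .
    then have "b \<in> V (- s) \<and> a \<in> V (- (- s)) \<and> x = b + a" by (simp add: add.commute)
    then show ?thesis by blast
  qed
  moreover have "x + y \<in> g1" if "x \<in> V (- s)" "y \<in> V (- (- s))" for x y
    using that subspace_g1 by (auto simp: V_def intro: subspace_add)
  ultimately show "g1 = {x + y | x y. x \<in> V (- s) \<and> y \<in> V (- (- s))}" by blast
qed (use s in auto)

text \<open>
  A submodule \<open>W\<close> of \<open>V s\<close> is the degree-one part of the largest graded subspace whose other parts are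
  carried into \<open>W\<close> by \<open>V s\<close>; that subspace is an ideal.
\<close>

lemma irreducible:
  assumes W: "subspace W" "W \<subseteq> V s" "W \<noteq> {0}" and stable: "\<And>u w. u \<in> g0 \<Longrightarrow> w \<in> W \<Longrightarrow> br u w \<in> W"
  shows "W = V s"
proof -
  let ?I0 = "{u \<in> g0. \<forall>v\<in>V s. br u v \<in> W}"
  let ?Y = "{y \<in> V (- s). \<forall>v\<in>V s. br v y \<in> ?I0}"
  let ?I1 = "{w + y | w y. w \<in> W \<and> y \<in> ?Y}"
  have sI0: "subspace ?I0"
    by (rule subspace_br_preimage(1)[OF subspace_g0 W(1)])
  have sY: "subspace ?Y"
    by (rule subspace_br_preimage(2)[OF subspace_V sI0])
  have Y_I1: "y \<in> ?I1" if "y \<in> ?Y" for y using that subspace_0[OF W(1)] by force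
  have W_I1: "w \<in> ?I1" if "w \<in> W" for w using that subspace_0[OF sY] by force
  have sI1: "subspace ?I1" by (rule subspace_sums[OF W(1) sY])
  have pm: "br v u \<in> g0" if "v \<in> V a" "u \<in> V b" for v u a b by (intro br_g(4) V_g1[OF that(1)] V_g1[OF that(2)])
  have I00: "br u y \<in> ?I0" if "u \<in> g0" "y \<in> ?I0" for u y
  proof -
    have "br (br u y) v \<in> W" if v: "v \<in> V s" for v
      unfolding br_br using that \<open>u \<in> g0\<close> \<open>y \<in> ?I0\<close> stable br_g0_V W(1) by (intro subspace_diff) auto
    then show ?thesis using that br_g by blast
  qed
  have WI0: "br w u \<in> ?I0" if w: "w \<in> W" and u: "u \<in> V (- s)" for w u
  proof -
    have "br (br w u) v \<in> W" if v: "v \<in> V s" for v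
    proof -
      have "br w v = 0" using br_V_V[of s w v] s W w v by blast
      then have "br (br w u) v = br w (br u v)" by (simp add: br_br)
      also have "\<dots> = - br (br u v) w" by (rule br_anti)
      also have "\<dots> \<in> W" using stable[OF pm[OF u v] w] W(1) subspace_neg by blast
      finally show ?thesis .
    qed
    then show ?thesis using pm[of w s u "- s"] w u W by blast
  qed
  have I0Y: "br y u \<in> ?Y" if y: "y \<in> ?I0" and u: "u \<in> V (- s)" for y u
  proof -
    have "br v (br y u) \<in> ?I0" if v: "v \<in> V s" for v
    proof -
      have "br v (br y u) = br (br v y) u + br y (br v u)" by (simp add: br_br)
      also have "\<dots> = - br (br y v) u - br (br v u) y" using br_anti[of v y] br_anti[of y "br v u"] by simp
      also have "\<dots> \<in> ?I0"
        using WI0[of "br y v" u] I00[of "br v u" y] y u v pm sI0 by (intro subspace_diff subspace_neg) auto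
      finally show ?thesis .
    qed
    then show ?thesis using y u br_g0_V by blast
  qed
  have g0Y: "br u y \<in> ?Y" if u: "u \<in> g0" and y: "y \<in> ?Y" for u y
  proof -
    have "br v (br u y) \<in> ?I0" if v: "v \<in> V s" for v
    proof -
      have "br v (br u y) = br u (br v y) - br (br u v) y" by (simp add: br_br)
      also have "\<dots> \<in> ?I0" using I00[OF u, of "br v y"] y v br_g0_V[OF u v] sI0 by (intro subspace_diff) auto
      finally show ?thesis .
    qed
    then show ?thesis using u y br_g0_V by blast
  qed
  have "?I1 = g1"
  proof (rule graded_ideal[of ?I0])
    show "subspace ?I0" "subspace ?I1" by (rule sI0 sI1)+
    show "?I0 \<subseteq> g0" by auto
    show "?I1 \<subseteq> g1" using W V_g1 subspace_g1 by (auto intro!: subspace_add)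
    show "br x y \<in> ?I0" if "x \<in> g0" "y \<in> ?I0" for x y by (rule I00[OF that])
    show "br x y \<in> ?I1" if x: "x \<in> g0" and y: "y \<in> ?I1" for x y
    proof -
      obtain w y' where "w \<in> W" "y' \<in> ?Y" "y = w + y'" using y by blast
      then have "br x y = br x w + br x y'" "br x w \<in> W" "br x y' \<in> ?Y"
        using stable[OF x] g0Y[OF x] by (simp_all only: br_add_right)
      then show ?thesis by blast
    qed
    show "br x y \<in> ?I1" if x: "x \<in> g1" and y: "y \<in> ?I0" for x y
    proof -
      obtain v u where vu: "v \<in> V s" "u \<in> V (- s)" "x = v + u" using g1_split[OF x] .
      have "br y v \<in> ?I1" "br y u \<in> ?I1" using y vu W_I1 Y_I1[OF I0Y[OF y vu(2)]] by blast+
      moreover have "br x y = - br y x" by (rule br_anti)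
      then have "br x y = - br y v - br y u" by (simp add: vu(3) br_add_right)
      ultimately show ?thesis by (simp only: subspace_diff[OF sI1 subspace_neg[OF sI1]])
    qed
    show "br x y \<in> ?I0" if x: "x \<in> g1" and y: "y \<in> ?I1" for x y
    proof -
      obtain w y' where wy: "w \<in> W" "y' \<in> ?Y" "y = w + y'" using y by blast
      obtain v u where vu: "v \<in> V s" "u \<in> V (- s)" "x = v + u" using g1_split[OF x] .
      have "br v w = 0" using br_V_V[of s v w] s vu W wy by blast
      moreover have "br u y' = 0" using br_V_V[of "- s" u y'] s vu wy by simp
      moreover have "br u w = - br w u" by (rule br_anti)
      ultimately have "br x y = br v y' - br w u" by (simp add: vu wy br_linear)
      also have "\<dots> \<in> ?I0" using WI0[OF wy(1) vu(2)] wy vu sI0 by (intro subspace_diff) auto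
      finally show ?thesis .
    qed
    show "?I1 \<noteq> {0}" using W W_I1 subspace_0[OF W(1)] by blast
  qed
  have "v \<in> W" if v: "v \<in> V s" for v
  proof -
    have "v \<in> ?I1" using \<open>?I1 = g1\<close> v V_g1 by blast
    then obtain w y where wy: "w \<in> W" "y \<in> V (- s)" "v = w + y" by blast
    have "v - w \<in> V s" using v wy W subspace_V[of s] subspace_diff by blast
    then have "y = 0" using wy V_Int_V[OF s(1), of y] by simp
    then show ?thesis using wy by simp
  qed
  then show ?thesis using W by blast
qed

lemma kf_nondegenerate_V:
  assumes "x \<in> V s" "\<And>y. y \<in> V (- s) \<Longrightarrow> kf x y = 0"
  shows "x = 0"
proof (rule kf_nondegenerate_g1)
  show "x \<in> g1" using assms V_g1 by blast
  fix y assume "y \<in> g1"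
  then obtain a b where "a \<in> V s" "b \<in> V (- s)" "y = a + b" by (rule g1_split)
  then show "kf x y = 0" using kf_V_V[OF s(1) assms(1)] assms(2) by (simp add: kf_add)
qed

end

section \<open>Weights with respect to a frame of \<open>so\<^sub>1\<^sub>0\<close>\<close>

definition idx :: "int set" where
  "idx = {-5..5} - {0}"

text \<open>The value of the weight \<open>e\<^sub>p\<close> (with \<open>e\<^sub>-\<^sub>p = - e\<^sub>p\<close>) on the \<open>i\<close>-th diagonal element.\<close>

definition sg :: "int \<Rightarrow> int \<Rightarrow> 'k::field_char_0" where
  "sg i p = (if p = i then 1 else if p = - i then - 1 else 0)"

lemma idx_simps [simp]: "- p \<in> idx \<longleftrightarrow> p \<in> idx" "p \<in> idx \<Longrightarrow> p \<noteq> 0" "finite idx"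
  "p \<in> idx \<Longrightarrow> p = - p \<longleftrightarrow> False" "p \<in> idx \<Longrightarrow> - p = p \<longleftrightarrow> False"
  by (auto simp: idx_def)

lemma idx_pos: "i \<in> {1..5} \<Longrightarrow> i \<in> idx"
  by (auto simp: idx_def)

lemma sg_neg: "i \<in> idx \<Longrightarrow> sg (- i) p = - sg i p" "i \<in> idx \<Longrightarrow> sg i (- p) = - sg i p"
  by (auto simp: sg_def)

lemma sum_sg: "(\<Sum>i = 1..5. m i * sg i p) = m p"
  if "p \<in> idx" "\<And>i. i \<in> idx \<Longrightarrow> m (- i) = - m i" for m :: "int \<Rightarrow> 'k::field_char_0"
proof (cases "p > 0")
  case True
  then have "(\<Sum>i = 1..5. m i * sg i p) = (\<Sum>i = 1..5. if i = p then m p else 0)"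
    by (intro sum.cong) (auto simp: sg_def)
  then show ?thesis using True that by (simp add: idx_def)
next
  case False
  then have "(\<Sum>i = 1..5. m i * sg i p) = (\<Sum>i = 1..5. if i = - p then m p else 0)"
    using that(2)[of "- p"] that(1) by (intro sum.cong) (auto simp: sg_def)
  then show ?thesis using False that by (simp add: idx_def)
qed

lemma opposite_root:
  assumes "p \<in> idx" "q \<in> idx" "r \<in> idx" "t \<in> idx" "p \<noteq> q" "p \<noteq> - q" "r \<noteq> t"
    and "\<And>i. i \<in> idx \<Longrightarrow> sg i p + sg i q + (sg i r + sg i t) = (0 :: 'k::field_char_0)"
  shows "r = - p \<and> t = - q \<or> r = - q \<and> t = - p"
proof -
  have pq: "- p \<noteq> q" "- q \<noteq> p" "q \<noteq> p" "q \<noteq> - p" using assms by auto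
  have "1 + (sg p r + sg p t) = (0 :: 'k)" using assms(8)[of p] assms(1) pq by (simp add: sg_def)
  then have 1: "r = - p \<or> t = - p" using assms(1-7) by (auto simp: sg_def split: if_splits)
  have "1 + (sg q r + sg q t) = (0 :: 'k)" using assms(8)[of q] assms(2,5,6) by (simp add: sg_def)
  then have 2: "r = - q \<or> t = - q" using assms(1-7) by (auto simp: sg_def split: if_splits)
  show ?thesis using 1 2 pq by auto
qed

text \<open>
  \<open>X p q\<close> plays the role of \<open>u \<wedge> v\<close> for members \<open>u\<close>, \<open>v\<close> of a basis of the ten-dimensional space that
  consists of isotropic vectors \<open>w\<^sub>p\<close>, where \<open>w\<^sub>p\<close> is paired with \<open>w\<^sub>-\<^sub>p\<close>. The \<open>X i (-i)\<close> span a Cartan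
  subalgebra, and \<open>X p q\<close> is a root vector for \<open>e\<^sub>p + e\<^sub>q\<close>.
\<close>

locale framed_pair = graded_pair smul L br Bs h ev \<sigma> z g0 g1 s
  for smul :: "'k::{alg_closed_field, field_char_0} \<Rightarrow> 'g::ab_group_add \<Rightarrow> 'g"
    and L br Bs h ev \<sigma> z g0 g1 s +
  fixes X :: "int \<Rightarrow> int \<Rightarrow> 'g"
  assumes X_g0: "p \<in> idx \<Longrightarrow> q \<in> idx \<Longrightarrow> X p q \<in> g0"
    and X_anti: "p \<in> idx \<Longrightarrow> q \<in> idx \<Longrightarrow> X q p = - X p q"
    and X_br: "p \<in> idx \<Longrightarrow> q \<in> idx \<Longrightarrow> r \<in> idx \<Longrightarrow> t \<in> idx \<Longrightarrow>
      br (X p q) (X r t) = (if q = - r then X p t else 0) - (if p = - r then X q t else 0)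
        + (if q = - t then X r p else 0) - (if p = - t then X r q else 0)"
    and X_span: "g0 = span (insert z {X p q | p q. p \<in> idx \<and> q \<in> idx})"
    and X_ne: "p \<in> idx \<Longrightarrow> q \<in> idx \<Longrightarrow> p \<noteq> q \<Longrightarrow> X p q \<noteq> 0"
begin

lemma opposite_framed: "framed_pair smul L br Bs h ev \<sigma> z g0 g1 (- s) X"
  by (intro framed_pair.intro opposite framed_pair_axioms.intro)
    (rule X_g0 X_anti X_br X_span X_ne; assumption)+

lemma X_self: "p \<in> idx \<Longrightarrow> X p p = 0"
  using X_anti[of p p] by (intro double_zero) simp

lemma br_h_X:
  assumes "i \<in> idx" "p \<in> idx" "q \<in> idx"
  shows "br (X i (- i)) (X p q) = smul (sg i p + sg i q) (X p q)"
proof -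
  have "br (X i (- i)) (X p q) = smul (sg i p) (X p q) + smul (sg i q) (X p q)"
    using assms X_anti[of "- i" q] X_anti[of p i] X_anti[of p "- i"]
    by (auto simp: X_br sg_def X_anti[of _ "- i"] X_self)
  then show ?thesis by (simp add: scale_left_distrib)
qed

definition wt :: "(int \<Rightarrow> 'k) \<Rightarrow> 'g \<Rightarrow> bool" where
  "wt m x \<longleftrightarrow> (\<forall>i\<in>idx. br (X i (- i)) x = smul (m i) x)"

lemma wt_odd: "wt m x \<Longrightarrow> x \<noteq> 0 \<Longrightarrow> i \<in> idx \<Longrightarrow> m (- i) = - m i"
  using X_anti[of i "- i"] by (simp add: wt_def) (metis br_neg(1) scale_minus_left scale_right_imp_eq idx_simps(1) minus_minus)

lemma wt_X: "p \<in> idx \<Longrightarrow> q \<in> idx \<Longrightarrow> wt (\<lambda>i. sg i p + sg i q) (X p q)"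
  by (simp add: wt_def br_h_X)

lemma wt_z: "wt (\<lambda>i. 0) z"
  using br_anti[of _ z] z(3) X_g0 by (simp add: wt_def)

lemma wt_br: "wt m x \<Longrightarrow> wt m' y \<Longrightarrow> wt (\<lambda>i. m i + m' i) (br x y)"
proof (unfold wt_def, rule ballI)
  fix i assume wx: "\<forall>i\<in>idx. br (X i (- i)) x = smul (m i) x" and wy: "\<forall>i\<in>idx. br (X i (- i)) y = smul (m' i) y"
    and i: "i \<in> idx"
  have "br (br (X i (- i)) x) y = br (X i (- i)) (br x y) - br x (br (X i (- i)) y)" by (rule br_br)
  then show "br (X i (- i)) (br x y) = smul (m i + m' i) (br x y)"
    using wx wy i by (simp add: br_linear scale_left_distrib algebra_simps)
qed

lemma wt_shift: "wt m x \<Longrightarrow> p \<in> idx \<Longrightarrow> q \<in> idx \<Longrightarrow> wt (\<lambda>i. m i + sg i p + sg i q) (br (X p q) x)"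
  using wt_br[OF wt_X, of p q m x] by (simp add: add_ac)

lemma wt_scale: "wt m x \<Longrightarrow> wt m (smul c x)"
  by (simp add: wt_def br_linear mult.commute)

lemma kf_wt: "wt m x \<Longrightarrow> wt m' y \<Longrightarrow> i \<in> idx \<Longrightarrow> m i + m' i \<noteq> 0 \<Longrightarrow> kf x y = 0"
proof -
  assume w: "wt m x" "wt m' y" "i \<in> idx" and ne: "m i + m' i \<noteq> 0"
  have "m i * kf x y = kf (br (X i (- i)) x) y" using w by (simp add: wt_def kf_scale)
  also have "\<dots> = - kf (br x (X i (- i))) y" by (simp add: br_anti[of x])
  also have "\<dots> = - kf x (br (X i (- i)) y)" by (simp add: kf_invariant)
  also have "\<dots> = - (m' i * kf x y)" using w by (simp add: wt_def kf_scale)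
  finally have "(m i + m' i) * kf x y = 0" by (simp add: distrib_right)
  then show ?thesis using ne by simp
qed

lemma kf_frame_zero:
  assumes "u \<in> g0" "\<And>p q. p \<in> idx \<Longrightarrow> q \<in> idx \<Longrightarrow> kf u (X p q) = 0" "kf u z = 0"
  shows "u = 0"
proof (rule kf_nondegenerate_g0[OF assms(1)])
  fix y assume "y \<in> g0"
  then have "y \<in> span (insert z {X p q | p q. p \<in> idx \<and> q \<in> idx})" using X_span by simp
  then show "kf u y = 0"
  proof (induction rule: span_induct_alt)
    case (step c x y)
    then have "kf u x = 0" using assms by auto
    then show ?case using step by (simp add: kf_add kf_scale)
  qed simp
qed

lemma kf_root_zero:
  assumes u: "wt (\<lambda>i. sg i p + sg i q) u" and pq: "p \<in> idx" "q \<in> idx" "p \<noteq> q" "p \<noteq> - q"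
    and rt: "r \<in> idx" "t \<in> idx" "\<not> (r = - p \<and> t = - q \<or> r = - q \<and> t = - p)"
  shows "kf u (X r t) = 0"
proof (cases "r = t")
  case True
  then show ?thesis using X_self rt by simp
next
  case False
  obtain i where "i \<in> idx" "sg i p + sg i q + (sg i r + sg i t) \<noteq> (0 :: 'k)"
    using opposite_root[OF pq(1,2) rt(1,2) pq(3,4) False] rt(3) by blast
  then show ?thesis using kf_wt[OF u wt_X[OF rt(1,2)]] by blast
qed

lemma kf_root_z: "wt (\<lambda>i. sg i p + sg i q) u \<Longrightarrow> p \<in> idx \<Longrightarrow> q \<in> idx \<Longrightarrow> p \<noteq> q \<Longrightarrow> p \<noteq> - q \<Longrightarrow> kf u z = 0"
  by (rule kf_wt[of _ _ "\<lambda>_. 0" _ p]) (auto simp: wt_z sg_def)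

lemma br_opposite:
  assumes "p \<in> idx" "q \<in> idx" "p \<noteq> q" "p \<noteq> - q"
  shows "br (X p q) (X (- q) (- p)) = X p (- p) + X q (- q)"
  using assms X_anti[of q "- q"] by (auto simp: X_br)

lemma kf_pair_h:
  assumes "p \<in> idx" "q \<in> idx" "p \<noteq> q" "p \<noteq> - q" "i \<in> idx"
  shows "kf (X p (- p) + X q (- q)) (X i (- i)) = (sg i p + sg i q) * kf (X p q) (X (- q) (- p))"
proof -
  have "kf (X p (- p) + X q (- q)) (X i (- i)) = kf (X p q) (br (X (- q) (- p)) (X i (- i)))"
    using assms by (simp add: br_opposite[symmetric] kf_invariant)
  also have "br (X (- q) (- p)) (X i (- i)) = - br (X i (- i)) (X (- q) (- p))" by (rule br_anti)
  also have "\<dots> = smul (sg i p + sg i q) (X (- q) (- p))"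
    using assms by (simp add: br_h_X sg_neg scale_minus_left[symmetric] del: scale_minus_left)
  finally show ?thesis by (simp add: kf_scale)
qed

lemma kf_h_h:
  assumes "i \<in> idx" "j \<in> idx" "i \<noteq> j" "i \<noteq> - j"
  shows "kf (X i (- i)) (X j (- j)) = 0"
proof -
  obtain k where k: "k \<in> idx" "k \<noteq> i" "k \<noteq> - i" "k \<noteq> j" "k \<noteq> - j"
  proof -
    have "\<exists>k\<in>{1,2,3}. k \<noteq> \<bar>i\<bar> \<and> k \<noteq> \<bar>j\<bar>" by auto
    then obtain k where "k \<in> {1,2,3}" "k \<noteq> \<bar>i\<bar>" "k \<noteq> \<bar>j\<bar>" by blast
    then show thesis by (intro that[of k]) (auto simp: idx_def)
  qed
  have "kf (X i (- i) + X k (- k)) (X j (- j)) = 0"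
    using k assms by (subst kf_pair_h) (auto simp: sg_def)
  moreover have "kf (X i (- i) + X (- k) (- (- k))) (X j (- j)) = 0"
    using k assms by (subst kf_pair_h) (auto simp: sg_def)
  moreover have "X (- k) (- (- k)) = - X k (- k)" using X_anti[of k "- k"] k by simp
  ultimately have "kf (X i (- i)) (X j (- j)) + kf (X i (- i)) (X j (- j)) = 0"
    by (simp add: kf_add)
  then show ?thesis by (simp flip: mult_2)
qed

definition C :: 'k where
  "C = kf (X 1 (- 1)) (X 1 (- 1))"

lemma kf_root:
  assumes "p \<in> idx" "q \<in> idx" "p \<noteq> q" "p \<noteq> - q"
  shows "kf (X p q) (X (- q) (- p)) = kf (X p (- p)) (X p (- p))"
proof -
  have "kf (X q (- q)) (X p (- p)) = 0" using assms by (intro kf_h_h) auto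
  then show ?thesis using kf_pair_h[OF assms assms(1)] assms by (simp add: kf_add sg_def)
qed

lemma kf_h: "i \<in> idx \<Longrightarrow> kf (X i (- i)) (X i (- i)) = C"
proof -
  have swap: "kf (X p (- p)) (X p (- p)) = kf (X q (- q)) (X q (- q))"
    if pq: "p \<in> idx" "q \<in> idx" "p \<noteq> q" "p \<noteq> - q" for p q
  proof -
    have qp: "q \<noteq> p" "q \<noteq> - p" using pq by auto
    have "kf (X p q) (X (- q) (- p)) = kf (X q p) (X (- p) (- q))"
      using X_anti[of p q] X_anti[of "- p" "- q"] pq by simp
    then show ?thesis using kf_root[OF pq] kf_root[OF pq(2,1) qp] by simp
  qed
  assume i: "i \<in> idx"
  have 12: "1 \<in> idx" "2 \<in> idx" by (auto simp: idx_def)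
  show ?thesis
  proof (cases "i = 1 \<or> i = - 1")
    case True
    then have "i \<noteq> 2" "i \<noteq> - 2" by auto
    then show ?thesis using swap[OF i 12(2)] swap[OF 12(1,2)] by (simp add: C_def)
  next
    case False
    then show ?thesis using swap[OF i 12(1)] by (simp add: C_def)
  qed
qed

lemma kf_h_z: "i \<in> idx \<Longrightarrow> kf (X i (- i)) z = 0"
proof -
  assume i: "i \<in> idx"
  define k :: int where "k = (if i = 1 \<or> i = - 1 then 2 else 1)"
  have k: "k \<in> idx" "i \<noteq> k" "i \<noteq> - k" by (auto simp: k_def idx_def)
  have 0: "kf (X i (- i) + X q (- q)) z = 0" if "q \<in> idx" "i \<noteq> q" "i \<noteq> - q" for q
  proof -
    have "kf (X i (- i) + X q (- q)) z = kf (X i q) (br (X (- q) (- i)) z)"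
      using that i by (simp add: br_opposite[symmetric] kf_invariant)
    also have "br (X (- q) (- i)) z = - br z (X (- q) (- i))" by (rule br_anti)
    finally show ?thesis using z(3) X_g0 i that by simp
  qed
  have "X (- k) (- (- k)) = - X k (- k)" using X_anti[of k "- k"] k by simp
  then have "kf (X i (- i)) z + kf (X i (- i)) z = 0"
    using 0[of k] 0[of "- k"] k by (simp add: kf_add kf_diff)
  then show ?thesis by (simp flip: mult_2)
qed

lemma kf_X_z: "kf (X p q) z = 0" if pq: "p \<in> idx" "q \<in> idx"
proof -
  consider "p = q" | "q = - p" | "p \<noteq> q" "p \<noteq> - q" by fastforce
  then show ?thesis
  proof cases
    case 1
    then show ?thesis using X_self pq by simp
  next
    case 2
    then show ?thesis using kf_h_z pq by simp
  next
    case 3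
    then show ?thesis using kf_root_z[OF wt_X[OF pq] pq] by simp
  qed
qed

lemma kf_h_X: "i \<in> idx \<Longrightarrow> p \<in> idx \<Longrightarrow> q \<in> idx \<Longrightarrow> p \<noteq> - q \<Longrightarrow> kf (X i (- i)) (X p q) = 0"
proof (cases "p = q")
  case False
  assume "i \<in> idx" "p \<in> idx" "q \<in> idx" "p \<noteq> - q"
  with False show ?thesis
    using kf_root_zero[OF wt_X, of p q i "- i"] kf_sym[of "X p q"] by auto
qed (simp add: X_self)

lemma C_ne: "C \<noteq> 0"
proof
  assume C0: "C = 0"
  have 1: "1 \<in> idx" by (simp add: idx_def)
  have "X 1 (- 1) = 0"
  proof (rule kf_frame_zero)
    fix p q assume pq: "p \<in> idx" "q \<in> idx"
    consider "p \<noteq> - q" | "q = - p" "p = 1 \<or> p = - 1" | "q = - p" "p \<noteq> 1" "p \<noteq> - 1" by fastforce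
    then show "kf (X 1 (- 1)) (X p q) = 0"
    proof cases
      case 1
      then show ?thesis using kf_h_X[OF \<open>1 \<in> idx\<close> pq] by simp
    next
      case 2
      have "X (- 1) 1 = - X 1 (- 1)" using X_anti[of 1 "- 1"] 1 by simp
      then show ?thesis using 2 C0 C_def by auto
    next
      case 3
      then show ?thesis using kf_h_h[of 1 p] 1 pq by auto
    qed
  qed (use X_g0[of 1 "- 1"] kf_h_z 1 in auto)
  then show False using X_ne[of 1 "- 1"] 1 by simp
qed

lemma root_space:
  assumes u: "u \<in> g0" "wt (\<lambda>i. sg i p + sg i q) u" and pq: "p \<in> idx" "q \<in> idx" "p \<noteq> q" "p \<noteq> - q"
  shows "\<exists>c. u = smul c (X p q)"
proof -
  define c where "c = kf u (X (- q) (- p)) / C"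
  have c: "kf (X p q) (X (- q) (- p)) = C" using kf_root[OF pq] kf_h pq by simp
  have "u - smul c (X p q) = 0"
  proof (rule kf_frame_zero)
    show "u - smul c (X p q) \<in> g0" using u X_g0 pq subspace_g0 by (auto intro: subspace_diff subspace_scale)
    show "kf (u - smul c (X p q)) z = 0"
      using kf_root_z[OF u(2) pq] kf_X_z pq by (simp add: kf_diff kf_scale)
    fix r t assume rt: "r \<in> idx" "t \<in> idx"
    consider "r = - q" "t = - p" | "r = - p" "t = - q" | "\<not> (r = - p \<and> t = - q \<or> r = - q \<and> t = - p)" by blast
    then show "kf (u - smul c (X p q)) (X r t) = 0"
    proof cases
      case 1
      then show ?thesis using c C_ne by (simp add: kf_diff kf_scale c_def)
    next
      case 2
      have "X (- p) (- q) = - X (- q) (- p)" using X_anti[of "- q" "- p"] pq by simp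
      then show ?thesis using 2 c C_ne by (simp add: kf_diff kf_scale c_def)
    next
      case 3
      then show ?thesis
        using kf_root_zero[OF u(2) pq rt] kf_root_zero[OF wt_X pq rt] pq by (simp add: kf_diff kf_scale)
    qed
  qed
  then show ?thesis by auto
qed

end

context framed_pair
begin

text \<open>The element of the Cartan subalgebra that represents, under \<open>\<kappa>\<close>, the weight \<open>m\<close> on \<open>V s\<close>.\<close>

definition tt :: "(int \<Rightarrow> 'k) \<Rightarrow> 'g" where
  "tt m = (\<Sum>i = 1..5. smul (m i / C) (X i (- i))) + smul (s / kf z z) z"

definition qn :: "(int \<Rightarrow> 'k) \<Rightarrow> 'k" where
  "qn m = (\<Sum>i = 1..5. m i * m i)"

definition gam :: 'k where
  "gam = C * (s * s / kf z z)"

definition dd :: "(int \<Rightarrow> 'k) \<Rightarrow> 'k" where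
  "dd m = (qn m + gam) / 2"

lemma tt_g0: "tt m \<in> g0"
  unfolding tt_def using X_g0 idx_pos z subspace_g0
  by (auto intro!: subspace_add subspace_sum subspace_scale)

lemma kf_tt_h:
  assumes "i \<in> idx" "\<And>i. i \<in> idx \<Longrightarrow> m (- i) = - m i"
  shows "kf (tt m) (X i (- i)) = m i"
proof -
  have "kf (X j (- j)) (X i (- i)) = sg j i * C" if j: "j \<in> {1..5}" for j
  proof -
    have "X (- j) j = - X j (- j)" using X_anti[of j "- j"] idx_pos[OF j] by simp
    then show ?thesis
      using kf_h_h[of j i] kf_h[of j] idx_pos[OF j] assms(1) by (auto simp: sg_def)
  qed
  then have "kf (tt m) (X i (- i)) = (\<Sum>j = 1..5. m j * sg j i)"
    using C_ne assms kf_h_z[of i] kf_sym[of z "X i (- i)"] by (simp add: tt_def kf_add kf_sum kf_scale)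
  also have "\<dots> = m i" by (rule sum_sg[of _ m, OF assms])
  finally show ?thesis .
qed

lemma kf_tt_z: "kf (tt m) z = s"
  using kf_z kf_h_z[OF idx_pos] by (simp add: tt_def kf_add kf_sum kf_scale)

lemma kf_tt_X: "p \<in> idx \<Longrightarrow> q \<in> idx \<Longrightarrow> p \<noteq> - q \<Longrightarrow> kf (tt m) (X p q) = 0"
  using kf_h_X[OF idx_pos] kf_X_z[of p q] kf_sym[of z "X p q"] by (simp add: tt_def kf_add kf_sum kf_scale)

lemma br_tt:
  assumes "wt m' x" "br z x = smul c x"
  shows "br (tt m) x = smul ((\<Sum>i = 1..5. m i * m' i) / C + s * c / kf z z) x"
proof -
  have "br (tt m) x = (\<Sum>i = 1..5. smul (m i * m' i / C) x) + smul (s * c / kf z z) x"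
    using assms idx_pos by (simp add: tt_def br_linear br_sum wt_def)
  also have "\<dots> = smul ((\<Sum>i = 1..5. m i * m' i / C) + s * c / kf z z) x"
    by (simp add: scale_left_distrib scale_sum_left)
  finally show ?thesis by (simp add: sum_divide_distrib)
qed

lemma br_tt_X:
  assumes "p \<in> idx" "q \<in> idx" "\<And>i. i \<in> idx \<Longrightarrow> m (- i) = - m i"
  shows "br (tt m) (X p q) = smul ((m p + m q) / C) (X p q)"
proof -
  have "(\<Sum>i = 1..5. m i * (sg i p + sg i q)) = m p + m q"
    by (simp only: distrib_left sum.distrib sum_sg[of _ m, OF assms(1,3)] sum_sg[of _ m, OF assms(2,3)])
  then show ?thesis using br_tt[OF wt_X[OF assms(1,2)], of 0 m] z(3)[OF X_g0[OF assms(1,2)]] by simp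
qed

lemma br_tt_V: "x \<in> V s \<Longrightarrow> wt m x \<Longrightarrow> br (tt m) x = smul (2 * dd m / C) x"
  using br_tt[of m x s m] C_ne by (simp add: V_def dd_def qn_def gam_def add_divide_distrib)

text \<open>A set of weights that is closed under the action of the root vectors is the set of all weights.\<close>

lemma weights_closed:
  assumes x: "x \<in> V s" "x \<noteq> 0" "wt m x" "\<Phi> m"
    and closed: "\<And>m x p q. x \<in> V s \<Longrightarrow> wt m x \<Longrightarrow> \<Phi> m \<Longrightarrow> p \<in> idx \<Longrightarrow> q \<in> idx \<Longrightarrow> p \<noteq> q \<Longrightarrow> p \<noteq> - q \<Longrightarrow>
      br (X p q) x \<noteq> 0 \<Longrightarrow> \<Phi> (\<lambda>i. m i + sg i p + sg i q)"
  shows "span {x \<in> V s. \<exists>m. \<Phi> m \<and> wt m x} = V s"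
proof (rule irreducible)
  let ?A = "{x \<in> V s. \<exists>m. \<Phi> m \<and> wt m x}"
  show "subspace (span ?A)" by simp
  show "span ?A \<subseteq> V s" by (rule span_minimal[OF _ subspace_V]) blast
  have "x \<in> span ?A" using x by (intro span_base) blast
  then show "span ?A \<noteq> {0}" using x by blast
  have X: "br (X p q) v \<in> span ?A" if pq: "p \<in> idx" "q \<in> idx" and v: "v \<in> ?A" for p q v
  proof -
    obtain m where m: "v \<in> V s" "\<Phi> m" "wt m v" using v by blast
    consider "p = q" | "q = - p" | "p \<noteq> q" "p \<noteq> - q" by fastforce
    then show ?thesis
    proof cases
      case 1
      then show ?thesis using X_self pq span_zero by simp
    next
      case 2
      then show ?thesis using m(3) pq v by (simp add: wt_def span_scale span_base)
    next
      case 3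
      show ?thesis
      proof (cases "br (X p q) v = 0")
        case False
        have "br (X p q) v \<in> V s" using m X_g0 pq br_g0_V by blast
        then have "br (X p q) v \<in> ?A" using closed[OF m(1,3,2) pq 3 False] wt_shift[OF m(3) pq] by blast
        then show ?thesis by (rule span_base)
      qed (simp add: span_zero)
    qed
  qed
  fix u w assume u: "u \<in> g0" and w: "w \<in> span ?A"
  from w show "br u w \<in> span ?A"
  proof (induction rule: span_induct_alt)
    case (step c x y)
    have "u \<in> span (insert z {X p q | p q. p \<in> idx \<and> q \<in> idx})" using u X_span by simp
    then have "br u x \<in> span ?A"
    proof (induction rule: span_induct_alt)
      case (step d g y)
      have "br g x \<in> span ?A"
        using step(1) X \<open>x \<in> ?A\<close> span_scale[OF span_base[of x ?A]] by (auto simp: V_def)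
      then show ?case using step by (simp add: br_linear span_add span_scale)
    qed (simp add: span_zero)
    then show ?case using step by (simp add: br_linear span_add span_scale)
  qed (simp add: span_zero)
qed

lemma weight_vector_exists:
  assumes "V s \<noteq> {0}"
  obtains x m where "x \<in> V s" "x \<noteq> 0" "wt m x"
proof -
  have "\<exists>x\<in>V s. x \<noteq> 0 \<and> (\<forall>f\<in>(\<lambda>i. br (X i (- i))) ` idx. \<exists>c. f x = smul c x)"
  proof (rule common_eigenvector_exists[OF subspace_V assms basis(1)])
    show "V s \<subseteq> span Bs" using V_g1 g1_L basis by auto
    fix f g x assume f: "f \<in> (\<lambda>i. br (X i (- i))) ` idx" and g: "g \<in> (\<lambda>i. br (X i (- i))) ` idx"
    then obtain i j where i: "i \<in> idx" "f = br (X i (- i))" and j: "j \<in> idx" "g = br (X j (- j))" by blast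
    have "br (br (X i (- i)) (X j (- j))) x = 0"
      using i j by (simp add: br_h_X sg_neg)
    then show "f (g x) = g (f x)" using br_br[of "X i (- i)" "X j (- j)" x] i j by simp
  next
    fix f x assume "f \<in> (\<lambda>i. br (X i (- i))) ` idx" "x \<in> V s"
    then show "f x \<in> V s" using X_g0 by (auto intro!: br_g0_V)
  qed (auto simp: br_linear)
  then obtain x where x: "x \<in> V s" "x \<noteq> 0" "\<And>i. i \<in> idx \<Longrightarrow> \<exists>c. br (X i (- i)) x = smul c x" by auto
  then obtain m where "\<And>i. i \<in> idx \<Longrightarrow> br (X i (- i)) x = smul (m i) x" by metis
  then show thesis using that[of x m] x by (simp add: wt_def)
qed

lemma span_weights: "span {x \<in> V s. \<exists>m. wt m x} = V s"
proof (cases "V s = {0}")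
  case True
  then have "{x \<in> V s. \<exists>m. wt m x} \<subseteq> {0}" by blast
  then have "span {x \<in> V s. \<exists>m. wt m x} \<subseteq> {0}" by (rule span_minimal) simp
  moreover have "0 \<in> span {x \<in> V s. \<exists>m. wt m x}" by (rule span_zero)
  ultimately show ?thesis unfolding True by auto
next
  case False
  then obtain x m where "x \<in> V s" "x \<noteq> 0" "wt m x" by (rule weight_vector_exists)
  then show ?thesis using weights_closed[of x m "\<lambda>_. True"] by simp
qed

end

context framed_pair
begin

text \<open>
  Weight vectors pair nontrivially only if their weights are opposite. The bracket \<open>[x, y]\<close> is identified
  with \<open>tt m\<close> by comparing their products, under \<open>\<kappa>\<close>, with the members of the frame.
\<close>

lemma dual_weight_vector:
  assumes x: "x \<in> V s" "x \<noteq> 0" "wt m x"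
  obtains y where "y \<in> V (- s)" "wt (\<lambda>i. - m i) y" "kf x y = 1" "br x y = tt m"
proof -
  interpret o: framed_pair smul L br Bs h ev \<sigma> z g0 g1 "- s" X by (rule opposite_framed)
  have "\<exists>y\<in>V (- s). (\<exists>m. wt m y) \<and> kf x y \<noteq> 0"
  proof (rule ccontr)
    assume no: "\<not> ?thesis"
    have "kf x y = 0" if "y \<in> V (- s)" for y
    proof -
      have "y \<in> span {x \<in> V (- s). \<exists>m. wt m x}" using that o.span_weights by simp
      then show ?thesis
      proof (induction rule: span_induct_alt)
        case (step c a b)
        then have "kf x a = 0" using no by blast
        then show ?case using step by (simp add: kf_add kf_scale)
      qed simp
    qed
    then show False using kf_nondegenerate_V x by blast
  qed
  then obtain y' m' where y': "y' \<in> V (- s)" "wt m' y'" "kf x y' \<noteq> 0" by blast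
  define y where "y = smul (1 / kf x y') y'"
  have yV: "y \<in> V (- s)" using y' subspace_V by (simp add: y_def subspace_scale)
  have xy: "kf x y = 1" using y' by (simp add: y_def kf_scale)
  have m': "m' i = - m i" if "i \<in> idx" for i
    using kf_wt[OF x(3) y'(2) that] y'(3) by (auto simp: eq_neg_iff_add_eq_0 add.commute)
  have wy: "wt (\<lambda>i. - m i) y" using wt_scale[OF y'(2)] m' by (simp add: y_def wt_def)
  have g: "br x y \<in> g0" by (rule br_g(4)[OF V_g1[OF x(1)] V_g1[OF yV]])
  have "br x y - tt m = 0"
  proof (rule kf_frame_zero)
    show "br x y - tt m \<in> g0" using g tt_g0 subspace_g0 subspace_diff by blast
    have "kf (br x y) z = - kf x (br z y)" by (simp add: kf_invariant br_anti[of y z])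
    also have "\<dots> = s" using yV xy by (simp add: V_def kf_scale)
    finally show "kf (br x y - tt m) z = 0" by (simp add: kf_diff kf_tt_z)
    fix p q assume pq: "p \<in> idx" "q \<in> idx"
    consider "p = q" | "q = - p" | "p \<noteq> q" "p \<noteq> - q" by fastforce
    then show "kf (br x y - tt m) (X p q) = 0"
    proof cases
      case 1
      then show ?thesis using X_self pq by simp
    next
      case 2
      have "kf (br x y) (X p (- p)) = - kf x (br (X p (- p)) y)" by (simp add: kf_invariant br_anti[of y "X p (- p)"])
      also have "\<dots> = m p" using wy xy pq by (simp add: wt_def kf_scale)
      finally show ?thesis using 2 pq kf_tt_h[of p m] wt_odd[OF x(3,2)] by (simp add: kf_diff)
    next
      case 3
      have "kf (X p q) (br x y) = 0"
        by (rule kf_wt[OF wt_X[OF pq] wt_br[OF x(3) wy] pq(1)]) (use 3 pq in \<open>auto simp: sg_def\<close>)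
      then show ?thesis using kf_tt_X pq 3 kf_sym[of "X p q" "br x y"] by (simp add: kf_diff)
    qed
  qed
  then show thesis using that[OF yV wy xy] by simp
qed

text \<open>
  With \<open>y\<close> dual to the weight vector \<open>x\<close> and a root vector \<open>g\<close>, both \<open>[y, [x, g]] = a g\<close> and
  \<open>[x, [y, g]] = b g\<close> are determined by the action of \<open>[x, y] = tt m\<close>, because \<open>[x, [x, g]]\<close> and
  \<open>[y, [y, g]]\<close> vanish for reasons of degree. Comparing coefficients leaves three possible values for
  the root on \<open>tt m\<close>.
\<close>

lemma weight_trichotomy:
  assumes x: "x \<in> V s" "x \<noteq> 0" "wt m x" and pq: "p \<in> idx" "q \<in> idx" "p \<noteq> q" "p \<noteq> - q"
  shows "m p + m q = 0 \<or> m p + m q = dd m \<or> m p + m q = - dd m"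
    and "m p + m q = - dd m \<Longrightarrow> dd m \<noteq> 0 \<Longrightarrow> br (X p q) x \<noteq> 0"
proof -
  obtain y where y: "y \<in> V (- s)" "wt (\<lambda>i. - m i) y" "kf x y = 1" "br x y = tt m"
    using dual_weight_vector[OF x] .
  let ?g = "X p q"
  define \<tau> S where "\<tau> = (m p + m q) / C" and "S = 2 * dd m / C"
  define P Q where "P = br x ?g" and "Q = br y ?g"
  have odd: "m (- i) = - m i" if "i \<in> idx" for i using wt_odd[OF x(3,2) that] .
  have g0: "?g \<in> g0" using X_g0 pq by blast
  have gne: "?g \<noteq> 0" using X_ne pq by blast
  have tg: "br (tt m) ?g = smul \<tau> ?g" unfolding \<tau>_def using br_tt_X[of p q m] pq odd by simp
  have tx: "br (tt m) x = smul S x" unfolding S_def using br_tt_V x by blast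
  have ty: "br (tt m) y = smul (- S) y"
  proof -
    have "(\<Sum>i = 1..5. m i * - m i) = - qn m" by (simp add: qn_def sum_negf)
    then have "(\<Sum>i = 1..5. m i * - m i) / C + s * - s / kf z z = - S"
      using C_ne by (simp add: S_def dd_def gam_def add_divide_distrib)
    then show ?thesis using br_tt[OF y(2), of "- s" m] y(1) by (simp add: V_def)
  qed
  have PV: "P \<in> V s" and QV: "Q \<in> V (- s)"
    unfolding P_def Q_def using br_g0_V[OF g0 x(1)] br_g0_V[OF g0 y(1)] br_anti[of x ?g] br_anti[of y ?g] subspace_V
    by (auto intro: subspace_neg)
  have xP: "br x P = 0" using br_V_V[OF s(1) x(1) PV] .
  have yQ: "br y Q = 0" using br_V_V[of "- s" y Q] s y QV by simp
  have wP: "wt (\<lambda>i. m i + (sg i p + sg i q)) P" and wQ: "wt (\<lambda>i. - m i + (sg i p + sg i q)) Q"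
    unfolding P_def Q_def using wt_br x y wt_X pq by blast+
  have "wt (\<lambda>i. - m i + (m i + (sg i p + sg i q))) (br y P)" "wt (\<lambda>i. m i + (- m i + (sg i p + sg i q))) (br x Q)"
    using wt_br x y wP wQ by blast+
  then have w: "wt (\<lambda>i. sg i p + sg i q) (br y P)" "wt (\<lambda>i. sg i p + sg i q) (br x Q)" by simp_all
  have "br y P \<in> g0" "br x Q \<in> g0"
    by (rule br_g(4)[OF V_g1[OF y(1)] V_g1[OF PV]] br_g(4)[OF V_g1[OF x(1)] V_g1[OF QV]])+
  then obtain a b where a: "br y P = smul a ?g" and b: "br x Q = smul b ?g"
    using root_space[OF _ w(1) pq] root_space[OF _ w(2) pq] by blast
  have "smul \<tau> ?g = br x Q - br y P" unfolding tg[symmetric] y(4)[symmetric] by (simp add: br_br P_def Q_def)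
  also have "\<dots> = smul (b - a) ?g" by (simp add: a b scale_left_diff_distrib)
  finally have ab: "\<tau> = b - a" using gne by simp
  have "br (tt m) P = br (br (tt m) x) ?g + br x (br (tt m) ?g)"
    unfolding P_def by (simp add: br_br)
  then have tP: "br (tt m) P = smul (S + \<tau>) P" unfolding tx tg by (simp add: br_linear P_def scale_left_distrib)
  have "br (tt m) Q = br (br (tt m) y) ?g + br y (br (tt m) ?g)"
    unfolding Q_def by (simp add: br_br)
  then have tQ: "br (tt m) Q = smul (\<tau> - S) Q" unfolding ty tg
    by (simp add: br_linear Q_def scale_left_diff_distrib)
  have "br (br x y) P = br x (br y P) - br y (br x P)" by (rule br_br)
  then have "smul (S + \<tau>) P = smul a P" unfolding y(4) tP a xP by (simp add: br_linear P_def)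
  then have Pa: "P = 0 \<or> a = S + \<tau>" by auto
  have "br (br x y) Q = br x (br y Q) - br y (br x Q)" by (rule br_br)
  then have "smul (\<tau> - S) Q = smul (- b) Q" unfolding y(4) tQ b yQ by (simp add: br_linear Q_def)
  then have Qb: "Q = 0 \<or> - b = \<tau> - S" by (metis scale_cancel_right)
  have P0: "P = 0 \<Longrightarrow> a = 0" using a gne by simp
  have Q0: "Q = 0 \<Longrightarrow> b = 0" using b gne by simp
  have d: "S / 2 * C = dd m" "\<tau> * C = m p + m q" using C_ne by (simp_all add: S_def \<tau>_def)
  have cases: "\<tau> = 0 \<or> \<tau> = - (S / 2) \<and> P \<noteq> 0 \<or> \<tau> = S / 2"
  proof (cases "P = 0"; cases "Q = 0")
    assume "P = 0" "Q = 0" then show ?thesis using ab P0 Q0 by simp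
  next
    assume "P = 0" "Q \<noteq> 0"
    then have "\<tau> + \<tau> = S" using ab P0 Qb by (metis add_diff_cancel_left' diff_add_cancel diff_zero minus_diff_eq)
    then show ?thesis by (metis mult_2 nonzero_mult_div_cancel_left zero_neq_numeral)
  next
    assume "P \<noteq> 0" "Q = 0"
    then have "\<tau> = - (S + \<tau>)" using ab Q0 Pa by simp
    then have "\<tau> + \<tau> = - S" by (simp add: algebra_simps eq_neg_iff_add_eq_0)
    then have "\<tau> = - (S / 2)" by (metis minus_divide_left mult_2 nonzero_mult_div_cancel_left zero_neq_numeral)
    then show ?thesis using \<open>P \<noteq> 0\<close> by simp
  next
    assume "P \<noteq> 0" "Q \<noteq> 0"
    then have 1: "a = S + \<tau>" "- b = \<tau> - S" using Pa Qb by auto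
    have "3 * \<tau> = (\<tau> - (b - a)) - (- b - (\<tau> - S)) - (a - (S + \<tau>))" by (simp add: algebra_simps)
    also have "\<tau> - (b - a) = 0" using ab by (rule right_minus_eq[THEN iffD2])
    also have "- b - (\<tau> - S) = 0" using 1(2) by (rule right_minus_eq[THEN iffD2])
    also have "a - (S + \<tau>) = 0" using 1(1) by (rule right_minus_eq[THEN iffD2])
    finally show ?thesis by simp
  qed
  show "m p + m q = 0 \<or> m p + m q = dd m \<or> m p + m q = - dd m"
    unfolding d[symmetric] using cases by auto
  assume neg: "m p + m q = - dd m" and ne: "dd m \<noteq> 0"
  have "S \<noteq> 0" using d ne by auto
  have "\<tau> = - (S / 2)"
  proof -
    have "\<tau> * C = - (S / 2) * C" using neg d by simp
    then show ?thesis using C_ne by (simp only: mult_cancel_right) simp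
  qed
  then have "P \<noteq> 0" using cases \<open>S \<noteq> 0\<close> by auto
  then show "br (X p q) x \<noteq> 0" unfolding P_def br_anti[of x "X p q"] by simp
qed

text \<open>
  A vector of weight \<open>m\<close> that is orthogonal to the dual \<open>y\<close> of \<open>x\<close> commutes with \<open>y\<close> and with \<open>x\<close>, hence with
  \<open>[x, y] = tt m\<close>, which however acts on it by a nonzero scalar.
\<close>

lemma weight_space_one_dim:
  assumes x: "x \<in> V s" "x \<noteq> 0" "wt m x" and x': "x' \<in> V s" "wt m x'" and dd: "dd m \<noteq> 0"
  shows "\<exists>c. x' = smul c x"
proof -
  obtain y where y: "y \<in> V (- s)" "wt (\<lambda>i. - m i) y" "kf x y = 1" "br x y = tt m"
    using dual_weight_vector[OF x] .
  let ?u = "x' - smul (kf x' y) x"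
  have u: "?u \<in> V s" using x x' subspace_V by (auto intro: subspace_diff subspace_scale)
  have wu: "wt m ?u" using x x' by (simp add: wt_def br_linear scale_right_diff_distrib mult.commute)
  have "?u = 0"
  proof (rule ccontr)
    assume ne: "?u \<noteq> 0"
    have "br y ?u = 0"
    proof (rule kf_frame_zero)
      show "br y ?u \<in> g0" by (rule br_g(4)[OF V_g1[OF y(1)] V_g1[OF u]])
      have kyu: "kf y ?u = 0" using y by (simp add: kf_diff kf_scale kf_sym[of y])
      show "kf (br y ?u) z = 0"
      proof -
        have "kf (br y ?u) z = - kf y (br z ?u)" by (simp add: kf_invariant br_anti[of ?u z])
        then show ?thesis using u kyu by (simp add: V_def kf_scale)
      qed
      fix p q assume pq: "p \<in> idx" "q \<in> idx"
      consider "p = q" | "q = - p" | "p \<noteq> q" "p \<noteq> - q" by fastforce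
      then show "kf (br y ?u) (X p q) = 0"
      proof cases
        case 1
        then show ?thesis using X_self pq by simp
      next
        case 2
        have "kf (br y ?u) (X p (- p)) = - kf y (br (X p (- p)) ?u)" by (simp add: kf_invariant br_anti[of ?u "X p (- p)"])
        then show ?thesis using wu kyu pq 2 by (simp add: wt_def kf_scale)
      next
        case 3
        have "kf (X p q) (br y ?u) = 0"
          by (rule kf_wt[OF wt_X[OF pq] wt_br[OF y(2) wu] pq(1)]) (use 3 pq in \<open>auto simp: sg_def\<close>)
        then show ?thesis using kf_sym[of "X p q"] by simp
      qed
    qed
    then have "br (br x y) ?u = 0" using br_V_V[OF s(1) x(1) u] by (simp only: br_br) simp
    then have "smul (2 * dd m / C) ?u = 0" unfolding y(4) using br_tt_V[OF u wu] by simp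
    then show False using ne dd C_ne by simp
  qed
  then show ?thesis by auto
qed

end

section \<open>The half-spin weights\<close>

lemma pair_trichotomy:
  fixes a b d :: "'k::field_char_0"
  assumes "a + b = 0 \<or> a + b = d \<or> a + b = - d" "a - b = 0 \<or> a - b = d \<or> a - b = - d"
  shows "a = 0 \<and> (b = 0 \<or> b = d \<or> b = - d) \<or> b = 0 \<and> (a = d \<or> a = - d) \<or>
    (a = d / 2 \<or> a = - (d / 2)) \<and> (b = d / 2 \<or> b = - (d / 2))"
proof -
  have "a = ((a + b) + (a - b)) / 2" "b = ((a + b) - (a - b)) / 2" by (simp_all add: field_simps)
  then show ?thesis using assms by (elim disjE) simp_all
qed

lemma trichotomy_square:
  fixes u d :: "'k::field"
  shows "u = 0 \<or> u = d \<or> u = - d \<Longrightarrow> u \<noteq> 0 \<Longrightarrow> u * u = d * d"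
  by auto

lemma idx_avoid:
  obtains r where "r \<in> idx" "r \<noteq> p" "r \<noteq> - p" "r \<noteq> q" "r \<noteq> - q" "r \<noteq> t" "r \<noteq> - t"
proof -
  have "\<exists>r\<in>{1,2,3,4}. r \<noteq> \<bar>p\<bar> \<and> r \<noteq> \<bar>q\<bar> \<and> r \<noteq> \<bar>t\<bar>" by auto
  then obtain r where "r \<in> {1,2,3,4}" "r \<noteq> \<bar>p\<bar>" "r \<noteq> \<bar>q\<bar>" "r \<noteq> \<bar>t\<bar>" by blast
  then show thesis by (intro that[of r]) (auto simp: idx_def)
qed

text \<open>Up to scaling: the zero weight, the weights of the vector representation, and those of the spin representation.\<close>

lemma weight_shapes:
  fixes m :: "int \<Rightarrow> 'k::field_char_0"
  assumes odd: "\<And>p. p \<in> idx \<Longrightarrow> m (- p) = - m p"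
    and tri: "\<And>p q. p \<in> idx \<Longrightarrow> q \<in> idx \<Longrightarrow> p \<noteq> q \<Longrightarrow> p \<noteq> - q \<Longrightarrow>
      m p + m q = 0 \<or> m p + m q = d \<or> m p + m q = - d"
  obtains (zero) "\<forall>p\<in>idx. m p = 0"
  | (vector) p where "d \<noteq> 0" "p \<in> idx" "m p = d" "\<forall>q\<in>idx. q \<noteq> p \<longrightarrow> q \<noteq> - p \<longrightarrow> m q = 0"
  | (spin) "d \<noteq> 0" "\<forall>p\<in>idx. m p = d / 2 \<or> m p = - (d / 2)"
proof (cases "\<forall>p\<in>idx. m p = 0")
  case True
  then show thesis using zero by blast
next
  case False
  then obtain p where p: "p \<in> idx" "m p \<noteq> 0" by blast
  have pair: "m p = 0 \<and> (m q = 0 \<or> m q = d \<or> m q = - d) \<or> m q = 0 \<and> (m p = d \<or> m p = - d) \<or>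
    (m p = d / 2 \<or> m p = - (d / 2)) \<and> (m q = d / 2 \<or> m q = - (d / 2))"
    if q: "q \<in> idx" "q \<noteq> p" "q \<noteq> - p" for q
  proof (rule pair_trichotomy)
    show "m p + m q = 0 \<or> m p + m q = d \<or> m p + m q = - d" using tri[of p q] p q by fastforce
    have "p \<noteq> - q" "p \<noteq> - (- q)" using q by auto
    then show "m p - m q = 0 \<or> m p - m q = d \<or> m p - m q = - d" using tri[of p "- q"] p q odd[of q] by simp
  qed
  show thesis
  proof (cases "\<exists>q\<in>idx. q \<noteq> p \<and> q \<noteq> - p \<and> m q = 0")
    case True
    then obtain q where q: "q \<in> idx" "q \<noteq> p" "q \<noteq> - p" "m q = 0" by blast
    have pd: "m p = d \<or> m p = - d" using pair[OF q(1-3)] q(4) p(2) by auto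
    then have d: "d \<noteq> 0" using p by auto
    have z: "m r = 0" if r: "r \<in> idx" "r \<noteq> p" "r \<noteq> - p" for r
      using pair[OF r] pd p(2) d by (auto simp: field_simps)
    show thesis
    proof (cases "m p = d")
      case True
      then show thesis using vector[OF d p(1)] z by blast
    next
      case False
      then have "m (- p) = d" using pd odd p by simp
      moreover have "m r = 0" if "r \<in> idx" "r \<noteq> - p" "r \<noteq> - (- p)" for r using z that by simp
      ultimately show thesis using vector[OF d, of "- p"] p by simp
    qed
  next
    case False
    obtain q0 where q0: "q0 \<in> idx" "q0 \<noteq> p" "q0 \<noteq> - p" by (rule idx_avoid[of p p p])
    have half: "(m p = d / 2 \<or> m p = - (d / 2)) \<and> (m q = d / 2 \<or> m q = - (d / 2))"
      if q: "q \<in> idx" "q \<noteq> p" "q \<noteq> - p" for q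
      using pair[OF q] p(2) False q by blast
    have mp: "m p = d / 2 \<or> m p = - (d / 2)" using half[OF q0] by blast
    then have "d \<noteq> 0" using p by auto
    moreover have "m q = d / 2 \<or> m q = - (d / 2)" if "q \<in> idx" for q
      using half[OF that] mp odd[OF p(1)] by (cases "q = p"; cases "q = - p") auto
    ultimately show thesis using spin by blast
  qed
qed

context framed_pair
begin

lemma V_br_X: "x \<in> V s \<Longrightarrow> p \<in> idx \<Longrightarrow> q \<in> idx \<Longrightarrow> br (X p q) x \<in> V s"
  using br_g0_V X_g0 by blast

text \<open>
  The trichotomy, applied also to the weights reached from a given one, fixes the scale: \<open>d = 1\<close> for the
  vector and the spin shape. In the zero and vector cases no root leads out of the shape,
  so the module has at most ten weights, each with multiplicity one.
\<close>

lemma zero_or_vector_or_spin: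
  assumes "V s \<noteq> {0}"
  shows "(\<exists>A. finite A \<and> card A \<le> 10 \<and> V s \<subseteq> span A) \<or>
    (\<exists>x m. x \<in> V s \<and> x \<noteq> 0 \<and> wt m x \<and> (\<forall>p\<in>idx. m p = 1 / 2 \<or> m p = - (1 / 2)))"
proof -
  note [[linarith_neq_limit = 0]]
  obtain x m where x: "x \<in> V s" "x \<noteq> 0" "wt m x" using weight_vector_exists[OF assms] .
  define d where "d = dd m"
  have tri: "m p + m q = 0 \<or> m p + m q = d \<or> m p + m q = - d"
    if "p \<in> idx" "q \<in> idx" "p \<noteq> q" "p \<noteq> - q" for p q
    unfolding d_def by (rule weight_trichotomy(1)[OF x that])
  have odd: "m (- p) = - m p" if "p \<in> idx" for p using wt_odd[OF x(3,2) that] .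
  consider (zero) "\<forall>p\<in>idx. m p = 0"
    | (vector) p where "d \<noteq> 0" "p \<in> idx" "m p = d" "\<forall>q\<in>idx. q \<noteq> p \<longrightarrow> q \<noteq> - p \<longrightarrow> m q = 0"
    | (spin) "d \<noteq> 0" "\<forall>p\<in>idx. m p = d / 2 \<or> m p = - (d / 2)"
    using weight_shapes[of m d] odd tri by blast
  then show ?thesis
  proof cases
    case zero
    have "span {x \<in> V s. \<exists>m. (\<forall>p\<in>idx. m p = 0) \<and> wt m x} = V s"
    proof (rule weights_closed[OF x])
      show "\<forall>p\<in>idx. m p = 0" using zero by blast
      fix m x p q assume x: "x \<in> V s" "wt m x" and 0: "\<forall>p\<in>idx. m p = 0"
        and pq: "p \<in> idx" "q \<in> idx" "p \<noteq> q" "p \<noteq> - q" and ne: "br (X p q) x \<noteq> 0"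
      obtain r where r: "r \<in> idx" "r \<noteq> p" "r \<noteq> - p" "r \<noteq> q" "r \<noteq> - q" by (rule idx_avoid[of p q q])
      let ?m = "\<lambda>i. m i + sg i p + sg i q"
      have pr: "p \<noteq> r" "p \<noteq> - r" "q \<noteq> p" "q \<noteq> - p" "q \<noteq> r" "q \<noteq> - r" using r pq by auto
      note T = weight_trichotomy(1)[OF V_br_X[OF x(1) pq(1,2)] ne wt_shift[OF x(2) pq(1,2)]]
      have v: "?m p = 1" "?m q = 1" "?m r = 0" using 0 pq r pr by (simp_all add: sg_def)
      have "?m p + ?m q = 2" "?m p + ?m r = 1" unfolding v by simp_all
      then have "2 * 2 = dd ?m * dd ?m" "1 * 1 = dd ?m * dd ?m"
        using trichotomy_square[OF T[OF pq]] trichotomy_square[OF T[OF pq(1) r(1) pr(1,2)]] by simp_all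
      then have "2 * 2 = (1 * 1 :: 'k)" by (simp only:)
      then have False by simp
      then show "\<forall>i\<in>idx. ?m i = 0" ..
    qed
    moreover have "{x \<in> V s. \<exists>m. (\<forall>p\<in>idx. m p = 0) \<and> wt m x} \<subseteq> span {x}"
    proof safe
      fix x' m' assume x': "x' \<in> V s" "\<forall>p\<in>idx. m' p = 0" "wt m' x'"
      then have "wt m x'" using zero by (simp add: wt_def)
      have "qn m = 0" unfolding qn_def using zero idx_pos by (intro sum.neutral) auto
      then have "dd m \<noteq> 0" using C_ne s kf_z by (simp add: dd_def gam_def)
      then obtain c where "x' = smul c x" using weight_space_one_dim[OF x x'(1) \<open>wt m x'\<close>] by blast
      then show "x' \<in> span {x}" by (simp add: span_scale span_base)
    qed
    then have "span {x \<in> V s. \<exists>m. (\<forall>p\<in>idx. m p = 0) \<and> wt m x} \<subseteq> span {x}"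
      by (rule span_minimal) simp
    ultimately show ?thesis by (intro disjI1 exI[of _ "{x}"]) simp
  next
    case (vector p)
    obtain q where q: "q \<in> idx" "q \<noteq> p" "q \<noteq> - p" by (rule idx_avoid[of p p p])
    obtain r where r: "r \<in> idx" "r \<noteq> p" "r \<noteq> - p" "r \<noteq> q" "r \<noteq> - q" by (rule idx_avoid[of p q q])
    have pr: "p \<noteq> r" "p \<noteq> - r" "q \<noteq> r" "q \<noteq> - r" "p \<noteq> q" "p \<noteq> - q" "- p \<in> idx" "- p \<noteq> q" "- p \<noteq> - q" "- q \<in> idx"
      using r vector(2) q by auto
    have "m (- p) + m q = - d" using odd vector q by simp
    then have ne: "br (X (- p) q) x \<noteq> 0"
      using weight_trichotomy(2)[OF x pr(7) q(1) pr(8,9)] vector(1) by (simp add: d_def)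
    let ?m = "\<lambda>i. m i + sg i (- p) + sg i q"
    note T = weight_trichotomy(1)[OF V_br_X[OF x(1) pr(7) q(1)] ne wt_shift[OF x(3) pr(7) q(1)]]
    have mz: "m q = 0" "m r = 0" using vector q r by auto
    have v: "?m p = d - 1" "?m q = 1" "?m r = 0" "?m (- q) = - 1"
      using vector(2,3) q r pr mz odd[of q] by (simp_all add: sg_def)
    define d' where "d' = dd ?m"
    have t1: "1 = d' \<or> 1 = - d'" using T[OF q(1) r(1) pr(3,4)] unfolding v d'_def by simp
    have t2: "d = 0 \<or> d = d' \<or> d = - d'" using T[OF vector(2) q(1) pr(5,6)] unfolding v d'_def by simp
    have "p \<noteq> - (- q)" using pr by simp
    then have t3: "d - 2 = 0 \<or> d - 2 = d' \<or> d - 2 = - d'"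
      using T[OF vector(2) pr(10) pr(6)] unfolding v d'_def by simp
    have t4: "d - 1 = 0 \<or> d - 1 = d' \<or> d - 1 = - d'" using T[OF vector(2) r(1) pr(1,2)] unfolding v d'_def by simp
    have dd': "d' = 1 \<or> d' = - 1" using t1 by (auto simp: minus_equation_iff)
    then have "d = 1 \<or> d = - 1" using t2 vector(1) by auto
    moreover have "d \<noteq> - 1"
    proof
      assume "d = - 1"
      then have "d - 2 = - 3" by simp
      then have "(3 :: 'k) = 0 \<or> (3 :: 'k) = 1 \<or> (3 :: 'k) = - 1" using t3 dd' by (auto simp: minus_equation_iff)
      then show False by (auto simp: eq_neg_iff_add_eq_0)
    qed
    ultimately have d1: "d = 1" by simp
    define \<Phi> where "\<Phi> m \<longleftrightarrow> (\<exists>p\<in>idx. \<forall>i\<in>idx. m i = (sg i p :: 'k))" for m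
    have "span {x \<in> V s. \<exists>m. \<Phi> m \<and> wt m x} = V s"
    proof (rule weights_closed[OF x])
      have "m i = sg i p" if "i \<in> idx" for i
        using vector(3,4) odd[OF vector(2)] d1 that by (auto simp: sg_def)
      then show "\<Phi> m" unfolding \<Phi>_def using vector(2) by blast
      fix m x a b assume x: "x \<in> V s" "wt m x" and "\<Phi> m"
        and ab: "a \<in> idx" "b \<in> idx" "a \<noteq> b" "a \<noteq> - b" and ne: "br (X a b) x \<noteq> 0"
      then obtain p where p: "p \<in> idx" "\<And>i. i \<in> idx \<Longrightarrow> m i = sg i p" unfolding \<Phi>_def by blast
      let ?m = "\<lambda>i. m i + sg i a + sg i b"
      note T = weight_trichotomy(1)[OF V_br_X[OF x(1) ab(1,2)] ne wt_shift[OF x(2) ab(1,2)]]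
      define d' where "d' = dd ?m"
      have ba: "b \<noteq> a" "b \<noteq> - a" using ab by auto
      consider "a = - p" | "b = - p" | "a = p" | "b = p" | "a \<noteq> p" "a \<noteq> - p" "b \<noteq> p" "b \<noteq> - p" by blast
      then show "\<Phi> ?m"
      proof cases
        case 1
        then have "?m i = sg i b" if "i \<in> idx" for i using p that by (simp add: sg_neg)
        then show ?thesis unfolding \<Phi>_def using ab by blast
      next
        case 2
        then have "?m i = sg i a" if "i \<in> idx" for i using p that by (simp add: sg_neg)
        then show ?thesis unfolding \<Phi>_def using ab by blast
      next
        case 3
        then have v: "?m a = 2" "?m b = 1" "?m (- b) = - 1" using p ab ba by (simp_all add: sg_def)
        have nb: "- b \<in> idx" "a \<noteq> - (- b)" using ab by auto
        have "(3::'k) = d' \<or> (3::'k) = - d'" using T[OF ab] unfolding v d'_def by simp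
        moreover have "(1::'k) = d' \<or> (1::'k) = - d'" using T[OF ab(1) nb(1) ab(4) nb(2)] unfolding v d'_def by simp
        ultimately have "3 * 3 = d' * d'" "1 * 1 = d' * d'" by (metis square_eq_iff)+
        then have "3 * 3 = (1 * 1 :: 'k)" by (simp only:)
        then show ?thesis by simp
      next
        case 4
        then have v: "?m b = 2" "?m a = 1" "?m (- a) = - 1" using p ab ba by (simp_all add: sg_def)
        have na: "- a \<in> idx" "b \<noteq> - (- a)" using ba ab by auto
        have "(3::'k) = d' \<or> (3::'k) = - d'" using T[OF ab(2,1) ba] unfolding v d'_def by simp
        moreover have "(1::'k) = d' \<or> (1::'k) = - d'" using T[OF ab(2) na(1) ba(2) na(2)] unfolding v d'_def by simp
        ultimately have "3 * 3 = d' * d'" "1 * 1 = d' * d'" by (metis square_eq_iff)+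
        then have "3 * 3 = (1 * 1 :: 'k)" by (simp only:)
        then show ?thesis by simp
      next
        case 5
        obtain r where r: "r \<in> idx" "r \<noteq> p" "r \<noteq> - p" "r \<noteq> a" "r \<noteq> - a" "r \<noteq> b" "r \<noteq> - b" by (rule idx_avoid)
        have n: "p \<noteq> a" "p \<noteq> - a" "p \<noteq> r" "p \<noteq> - r" and n': "p \<noteq> b" "p \<noteq> - b" "a \<noteq> r" "a \<noteq> - r" "b \<noteq> r" "b \<noteq> - r"
          using 5 r by (metis minus_minus)+
        then have v: "?m p = 1" "?m a = 1" "?m r = 0" using p(2)[OF p(1)] p(2)[OF ab(1)] p(2)[OF r(1)] 5 ab ba r
          by (simp_all add: sg_def)
        have "(2::'k) = d' \<or> (2::'k) = - d'" using T[OF p(1) ab(1) n(1,2)] unfolding v d'_def by simp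
        moreover have "(1::'k) = d' \<or> (1::'k) = - d'" using T[OF p(1) r(1) n(3,4)] unfolding v d'_def by simp
        ultimately have "2 * 2 = d' * d'" "1 * 1 = d' * d'" by (metis square_eq_iff)+
        then have "2 * 2 = (1 * 1 :: 'k)" by (simp only:)
        then show ?thesis by simp
      qed
    qed
    moreover define xv where "xv p = (SOME x. x \<in> V s \<and> wt (\<lambda>i. sg i p) x \<and> (x \<noteq> 0 \<or> (\<forall>y\<in>V s. wt (\<lambda>i. sg i p) y \<longrightarrow> y = 0)))" for p
    have xv: "xv p \<in> V s \<and> wt (\<lambda>i. sg i p) (xv p) \<and> (xv p \<noteq> 0 \<or> (\<forall>y\<in>V s. wt (\<lambda>i. sg i p) y \<longrightarrow> y = 0))" for p
    proof -
      have "0 \<in> V s \<and> wt (\<lambda>i. sg i p) 0" using subspace_0[OF subspace_V] by (simp add: wt_def)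
      then have "\<exists>x. x \<in> V s \<and> wt (\<lambda>i. sg i p) x \<and> (x \<noteq> 0 \<or> (\<forall>y\<in>V s. wt (\<lambda>i. sg i p) y \<longrightarrow> y = 0))" by blast
      then show ?thesis unfolding xv_def by (rule someI_ex)
    qed
    have "{x \<in> V s. \<exists>m. \<Phi> m \<and> wt m x} \<subseteq> span (xv ` idx)"
    proof safe
      fix x' m' assume x': "x' \<in> V s" "wt m' x'" and "\<Phi> m'"
      then obtain p where p: "p \<in> idx" "\<And>i. i \<in> idx \<Longrightarrow> m' i = sg i p" unfolding \<Phi>_def by blast
      then have w: "wt (\<lambda>i. sg i p) x'" using x' by (simp add: wt_def)
      show "x' \<in> span (xv ` idx)"
      proof (cases "x' = 0")
        case True
        then show ?thesis by (simp add: span_zero)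
      next
        case False
        then have ne: "xv p \<noteq> 0" using xv[of p] x' w by blast
        obtain q where q: "q \<in> idx" "q \<noteq> p" "q \<noteq> - p" by (rule idx_avoid[of p p p])
        then have pq: "p \<noteq> q" "p \<noteq> - q" by auto
        have "sg p p + sg q p = (0 :: 'k) \<or> sg p p + sg q p = dd (\<lambda>i. sg i p) \<or> sg p p + sg q p = - dd (\<lambda>i. sg i p)"
          using weight_trichotomy(1)[OF _ ne _ p(1) q(1) pq, of "\<lambda>i. sg i p"] xv[of p] by blast
        then have "dd (\<lambda>i. sg i p) \<noteq> 0" using pq by (auto simp: sg_def)
        then obtain c where "x' = smul c (xv p)" using weight_space_one_dim[OF _ ne _ x'(1) w] xv[of p] by blast
        then show ?thesis using p by (simp add: span_scale span_base)
      qed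
    qed
    then have "span {x \<in> V s. \<exists>m. \<Phi> m \<and> wt m x} \<subseteq> span (xv ` idx)" by (rule span_minimal) simp
    moreover have "card (xv ` idx) \<le> 10"
    proof -
      have "card idx = 10" by (simp add: idx_def)
      then show ?thesis using card_image_le[of idx xv] by simp
    qed
    ultimately show ?thesis by (intro disjI1 exI[of _ "xv ` idx"]) simp
  next
    case spin
    have half: "\<exists>p. p \<in> idx \<and> \<bar>p\<bar> = i \<and> m p = d / 2" if "i \<in> idx" "i > 0" for i
      using bspec[OF spin(2) that(1)] odd[OF that(1)] that
      by (elim disjE) (rule exI[of _ i], simp, rule exI[of _ "- i"], simp)
    have "1 \<in> idx" "2 \<in> idx" "3 \<in> idx" "4 \<in> idx" by (auto simp: idx_def)
    then obtain p q r t where p: "p \<in> idx" "\<bar>p\<bar> = 1" "m p = d / 2" and q: "q \<in> idx" "\<bar>q\<bar> = 2" "m q = d / 2"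
      and r: "r \<in> idx" "\<bar>r\<bar> = 3" "m r = d / 2" and t: "t \<in> idx" "\<bar>t\<bar> = 4" "m t = d / 2"
      using half[of 1] half[of 2] half[of 3] half[of 4] by auto
    have ne: "p \<noteq> q" "p \<noteq> - q" "p \<noteq> r" "p \<noteq> - r" "r \<noteq> t" "r \<noteq> - t" "q \<noteq> r" "q \<noteq> - r" "t \<noteq> p" "t \<noteq> - p" "t \<noteq> q" "t \<noteq> - q"
      and neg: "- p \<in> idx" "- q \<in> idx" "- p \<noteq> - q" "- p \<noteq> - (- q)" "- r \<in> idx" "p \<noteq> - (- r)"
      using p q r t by auto
    have "m (- p) + m (- q) = - (d / 2) + - (d / 2)" by (simp only: odd[OF p(1)] odd[OF q(1)] p(3) q(3))
    also have "\<dots> = - d" by (simp add: field_simps)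
    finally have "m (- p) + m (- q) = - d" .
    then have nz: "br (X (- p) (- q)) x \<noteq> 0"
      using weight_trichotomy(2)[OF x neg(1-4)] spin(1) by (simp add: d_def)
    let ?m = "\<lambda>i. m i + sg i (- p) + sg i (- q)"
    note T = weight_trichotomy(1)[OF V_br_X[OF x(1) neg(1,2)] nz wt_shift[OF x(3) neg(1,2)]]
    define d' where "d' = dd ?m"
    have v: "?m p = d / 2 - 1" "?m q = d / 2 - 1" "?m r = d / 2" "?m (- r) = - (d / 2)" "?m t = d / 2"
      using p(1,3) q(1,3) r(1,3) t(1,3) ne odd[of r] by (auto simp: sg_def)
    have t1: "(1 :: 'k) = d' \<or> (1 :: 'k) = - d'"
      using T[OF p(1) neg(5) ne(4) neg(6)] unfolding v d'_def by (auto simp: minus_equation_iff)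
    have t2: "d = 0 \<or> d = d' \<or> d = - d'" using T[OF r(1) t(1) ne(5,6)] unfolding v d'_def by (simp add: field_simps)
    have t3: "d - 2 = 0 \<or> d - 2 = d' \<or> d - 2 = - d'" 
    proof -
      have "d / 2 - 1 + (d / 2 - 1) = d - 2" by (simp add: field_simps)
      then show ?thesis using T[OF p(1) q(1) ne(1,2)] unfolding v d'_def by simp
    qed
    have dd': "d' = 1 \<or> d' = - 1" using t1 by (auto simp: minus_equation_iff)
    then have "d = 1 \<or> d = - 1" using t2 spin(1) by auto
    moreover have "d \<noteq> - 1"
    proof
      assume "d = - 1"
      then have "d - 2 = - 3" by simp
      then have "(3 :: 'k) = 0 \<or> (3 :: 'k) = 1 \<or> (3 :: 'k) = - 1" using t3 dd' by (auto simp: minus_equation_iff)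
      then show False by (auto simp: eq_neg_iff_add_eq_0)
    qed
    ultimately have "d = 1" by simp
    then show ?thesis using x spin(2) by blast
  qed
qed

end

text \<open>Sign vectors of length five encode the weights of the spin representation, up to the factor \<open>1 / 2\<close>.\<close>

definition sv :: "int list \<Rightarrow> int \<Rightarrow> int" where
  "sv l p = (if p > 0 then l ! nat (p - 1) else - (l ! nat (- p - 1)))"

definition isg :: "int \<Rightarrow> int \<Rightarrow> int" where
  "isg i p = (if p = i then 1 else if p = - i then - 1 else 0)"

definition even_signs :: "int list list" where
  "even_signs = [[a, b, c, d, a * b * c * d]. a \<leftarrow> [1, - 1], b \<leftarrow> [1, - 1], c \<leftarrow> [1, - 1], d \<leftarrow> [1, - 1]]"

definition pat :: "int \<Rightarrow> int list list" where
  "pat e = [[1, 1, 1, e, e], [- 1, - 1, - 1, - e, e]]"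

definition idxs :: "int list" where
  "idxs = [1, - 1, 2, - 2, 3, - 3, 4, - 4, 5, - 5]"

definition raises :: "int list \<Rightarrow> int \<Rightarrow> int \<Rightarrow> bool" where
  "raises u p q \<longleftrightarrow> sv u p = - 1 \<and> sv u q = - 1"

text \<open>
  A root \<open>e\<^sub>p + e\<^sub>q\<close> acts nontrivially on a half-spin weight vector iff both coordinates have the value \<open>-1/2\<close>.
  The lists in \<open>pat (-1)\<close> and \<open>pat 1\<close> are the weights that occur in \<open>a'\<close> and \<open>a\<close>.
\<close>

lemma reach_table:
  "list_all (\<lambda>e. list_all (\<lambda>l. l \<in> set (pat e) \<or>
     list_ex (\<lambda>u. list_ex (\<lambda>p. list_ex (\<lambda>q. \<bar>p\<bar> \<noteq> \<bar>q\<bar> \<and> raises u p q \<and>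
        list_all (\<lambda>v. v = u \<or> \<not> raises v p q) (pat e @ pat (- e)) \<and>
        list_all (\<lambda>i. sv l i = sv u i + 2 * (isg i p + isg i q)) [1, 2, 3, 4, 5]) idxs) idxs) (pat e)) even_signs) [1, - 1]"
  by code_simp


lemma even_signs_values:
  "list_all (\<lambda>l. list_all (\<lambda>p. sv l p = 1 \<or> sv l p = - 1) idxs) even_signs"
  by code_simp

lemma raise_table:
  "list_all (\<lambda>l. list_all (\<lambda>p. list_all (\<lambda>q. \<bar>p\<bar> \<noteq> \<bar>q\<bar> \<and> raises l p q \<longrightarrow>
     list_ex (\<lambda>l'. list_all (\<lambda>i. sv l' i = sv l i + 2 * (isg i p + isg i q)) [1, 2, 3, 4, 5]) even_signs) idxs) idxs) even_signs"
  by code_simp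

lemma set_idxs: "set idxs = idx"
  by (simp add: idxs_def idx_def set_eq_iff) presburger

lemma sv_neg: "p \<in> idx \<Longrightarrow> sv l (- p) = - sv l p"
  by (auto simp: sv_def idx_def)

lemma isg_neg: "i \<in> idx \<Longrightarrow> isg (- i) p = - isg i p"
  by (auto simp: isg_def)

lemma sg_isg: "sg i p = of_int (isg i p)"
  by (simp add: sg_def isg_def)

lemma pat_even_table: "list_all (\<lambda>e. list_all (\<lambda>u. u \<in> set even_signs) (pat e)) [1, - 1]"
  by code_simp

lemma pat_even: "e = 1 \<or> e = - 1 \<Longrightarrow> u \<in> set (pat e) \<Longrightarrow> u \<in> set even_signs"
  using pat_even_table by (auto simp: list_all_iff)

lemma shift_idx:
  assumes "list_all (\<lambda>i. sv l' i = sv l i + 2 * (isg i p + isg i q)) [1, 2, 3, 4, 5]" and i: "i \<in> idx"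
  shows "sv l' i = sv l i + 2 * (isg i p + isg i q)"
proof -
  have *: "sv l' j = sv l j + 2 * (isg j p + isg j q)" if "j \<in> {1..5}" for j
  proof -
    have "j = 1 \<or> j = 2 \<or> j = 3 \<or> j = 4 \<or> j = 5" using that by auto
    then show ?thesis using assms(1) by auto
  qed
  show ?thesis
  proof (cases "i > 0")
    case True
    then show ?thesis using *[of i] i by (simp add: idx_def)
  next
    case False
    then have j: "- i \<in> {1..5}" using i by (auto simp: idx_def)
    then have "- i \<in> idx" by (rule idx_pos)
    then show ?thesis using *[OF j] i by (simp add: sv_neg isg_neg)
  qed
qed

lemma reach:
  assumes "e = 1 \<or> e = - 1" "l \<in> set even_signs" "l \<notin> set (pat e)"
  obtains u p q where "u \<in> set (pat e)" "p \<in> idx" "q \<in> idx" "\<bar>p\<bar> \<noteq> \<bar>q\<bar>" "raises u p q"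
    "\<forall>v\<in>set (pat e) \<union> set (pat (- e)). v \<noteq> u \<longrightarrow> \<not> raises v p q"
    "\<forall>i\<in>idx. sv l i = sv u i + 2 * (isg i p + isg i q)"
proof -
  have "e \<in> set [1, - 1]" using assms by auto
  then have "list_ex (\<lambda>u. list_ex (\<lambda>p. list_ex (\<lambda>q. \<bar>p\<bar> \<noteq> \<bar>q\<bar> \<and> raises u p q \<and>
        list_all (\<lambda>v. v = u \<or> \<not> raises v p q) (pat e @ pat (- e)) \<and>
        list_all (\<lambda>i. sv l i = sv u i + 2 * (isg i p + isg i q)) [1, 2, 3, 4, 5]) idxs) idxs) (pat e)"
    using reach_table assms unfolding list_all_iff by blast
  then obtain u p q where "u \<in> set (pat e)" "p \<in> idx" "q \<in> idx" "\<bar>p\<bar> \<noteq> \<bar>q\<bar>" "raises u p q"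
    "list_all (\<lambda>v. v = u \<or> \<not> raises v p q) (pat e @ pat (- e))"
    "list_all (\<lambda>i. sv l i = sv u i + 2 * (isg i p + isg i q)) [1, 2, 3, 4, 5]"
    unfolding list_ex_iff set_idxs by blast
  moreover from this(7) have "\<forall>i\<in>idx. sv l i = sv u i + 2 * (isg i p + isg i q)" using shift_idx by blast
  moreover from calculation(6) have "\<forall>v\<in>set (pat e) \<union> set (pat (- e)). v \<noteq> u \<longrightarrow> \<not> raises v p q"
    unfolding list_all_iff set_append by blast
  ultimately show thesis using that by blast
qed

definition wl :: "int list \<Rightarrow> int \<Rightarrow> 'k::field_char_0" where
  "wl l i = of_int (sv l i) / 2"

lemma wl_values: "l \<in> set even_signs \<Longrightarrow> p \<in> idx \<Longrightarrow> wl l p = 1 / 2 \<or> wl l p = - (1 / 2)"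
  and wl_eq_minus_half: "l \<in> set even_signs \<Longrightarrow> p \<in> idx \<Longrightarrow> wl l p = - (1 / 2) \<longleftrightarrow> sv l p = - 1"
proof -
  assume "l \<in> set even_signs" "p \<in> idx"
  then have "sv l p = 1 \<or> sv l p = - 1" using even_signs_values unfolding list_all_iff set_idxs by blast
  then show "wl l p = 1 / 2 \<or> wl l p = - (1 / 2)" "wl l p = - (1 / 2) \<longleftrightarrow> sv l p = - 1"
    by (elim disjE; simp add: wl_def)+
qed

lemma wl_shift: "sv l' i = sv l i + 2 * (isg i p + isg i q) \<Longrightarrow> wl l' i = wl l i + sg i p + sg i q"
  by (simp add: wl_def sg_isg add_divide_distrib)

lemma eq_neg_zero: "x = y \<Longrightarrow> x = - y \<Longrightarrow> x = 0" for x y :: "'k::field_char_0"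
  by simp

context framed_pair
begin

text \<open>Raising a coordinate \<open>1/2\<close> would produce a coordinate \<open>3/2\<close>, against the trichotomy.\<close>

lemma spin_raise:
  assumes x: "x \<in> V s" "wt m x" and m: "\<forall>p\<in>idx. m p = 1 / 2 \<or> m p = - (1 / 2)"
    and pq: "p \<in> idx" "q \<in> idx" "\<bar>p\<bar> \<noteq> \<bar>q\<bar>" and ne: "br (X p q) x \<noteq> 0"
  shows "m p = - (1 / 2)" "m q = - (1 / 2)"
proof -
  note [[linarith_neq_limit = 0]]
  have odd: "m (- i) = - m i" if "i \<in> idx" for i
    using wt_odd[OF x(2) _ that] ne by fastforce
  let ?m = "\<lambda>i. m i + sg i p + sg i q"
  note T = weight_trichotomy(1)[OF V_br_X[OF x(1) pq(1,2)] ne wt_shift[OF x(2) pq(1,2)]]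
  have key: "m a = - (1 / 2)" if a: "a \<in> idx" "?m a = m a + 1" for a
  proof (rule ccontr)
    assume "m a \<noteq> - (1 / 2)"
    then have "m a = 1 / 2" using m a by blast
    then have ma: "?m a = 3 / 2" unfolding a(2) by simp
    obtain r where r: "r \<in> idx" "r \<noteq> p" "r \<noteq> - p" "r \<noteq> q" "r \<noteq> - q" "r \<noteq> a" "r \<noteq> - a" by (rule idx_avoid)
    have ar: "a \<noteq> r" "a \<noteq> - r" "a \<noteq> - r" "a \<noteq> - (- r)" "- r \<in> idx" "p \<noteq> r" "p \<noteq> - r" "q \<noteq> r" "q \<noteq> - r"
      using r by (metis minus_minus idx_simps(1))+
    have mr: "?m r = m r" using ar by (simp add: sg_def)
    have mr': "?m (- r) = - m r" using ar r odd[OF r(1)] by (simp add: sg_def)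
    have t1: "3 / 2 + m r = 0 \<or> 3 / 2 + m r = dd ?m \<or> 3 / 2 + m r = - dd ?m"
      using T[OF a(1) r(1) ar(1,2)] unfolding ma mr .
    have t2: "3 / 2 + - m r = 0 \<or> 3 / 2 + - m r = dd ?m \<or> 3 / 2 + - m r = - dd ?m"
      using T[OF a(1) ar(5) ar(2,4)] unfolding ma mr' .
    have mrc: "m r = 1 / 2 \<or> m r = - (1 / 2)" using bspec[OF m r(1)] .
    have arith: "3 / 2 + u \<noteq> 0 \<and> 3 / 2 + - u \<noteq> 0 \<and> (3 / 2 + u) * (3 / 2 + u) \<noteq> (3 / 2 + - u) * (3 / 2 + - u)"
      if "u = 1 / 2 \<or> u = - (1 / 2)" for u :: 'k
      using that by (elim disjE; hypsubst; simp)
    have n: "3 / 2 + m r \<noteq> 0" and n': "3 / 2 + - m r \<noteq> 0"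
      and "(3 / 2 + m r) * (3 / 2 + m r) \<noteq> (3 / 2 + - m r) * (3 / 2 + - m r)"
      using arith[OF mrc] by blast+
    moreover    have "(3 / 2 + m r) * (3 / 2 + m r) = (3 / 2 + - m r) * (3 / 2 + - m r)"
      using trichotomy_square[OF t1 n] trichotomy_square[OF t2 n'] by simp
    ultimately show False by blast
  qed
  have pq': "q \<noteq> p" "q \<noteq> - p" "p \<noteq> q" "p \<noteq> - q" using pq by auto
  show "m p = - (1 / 2)" by (rule key) (use pq pq' in \<open>simp_all add: sg_def\<close>)
  show "m q = - (1 / 2)" by (rule key) (use pq pq' in \<open>simp_all add: sg_def\<close>)
qed

lemma spin_dd:
  assumes x: "x \<in> V s" "x \<noteq> 0" "wt m x" and m: "\<forall>p\<in>idx. m p = 1 / 2 \<or> m p = - (1 / 2)"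
  shows "dd m = 1"
proof -
  have ex: "\<exists>p\<in>idx. \<bar>p\<bar> = i \<and> m p = 1 / 2" if i: "i \<in> idx" "i > 0" for i
  proof (cases "m i = 1 / 2")
    case True
    then show ?thesis using i by (intro bexI[of _ i]) auto
  next
    case False
    then have "m i = - (1 / 2)" using bspec[OF m i(1)] by blast
    then have "m (- i) = 1 / 2" using wt_odd[OF x(3,2) i(1)] by simp
    then show ?thesis using i by (intro bexI[of _ "- i"]) auto
  qed
  have "1 \<in> idx" "2 \<in> idx" by (auto simp: idx_def)
  then obtain p q where p: "p \<in> idx" "\<bar>p\<bar> = 1" "m p = 1 / 2" and q: "q \<in> idx" "\<bar>q\<bar> = 2" "m q = 1 / 2"
    using ex[of 1] ex[of 2] by auto
  have pq: "p \<noteq> q" "p \<noteq> - q" "\<bar>p\<bar> \<noteq> \<bar>q\<bar>" using p q by auto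
  have sum: "m p + m q = 1" unfolding p(3) q(3) by simp
  have "dd m \<noteq> - 1"
  proof
    assume "dd m = - 1"
    then have "br (X p q) x \<noteq> 0" using weight_trichotomy(2)[OF x p(1) q(1) pq(1,2)] sum by simp
    from spin_raise(1)[OF x(1,3) m p(1) q(1) pq(3) this] show False using p by simp
  qed
  then show ?thesis
    using weight_trichotomy(1)[OF x p(1) q(1) pq(1,2)] sum by (auto simp: minus_equation_iff)
qed

lemma spin_proportional:
  assumes x: "x \<in> V s" "x \<noteq> 0" "wt m x" "\<forall>p\<in>idx. m p = 1 / 2 \<or> m p = - (1 / 2)"
    and v: "v \<in> V s" "wt m v"
  shows "\<exists>c. v = smul c x"
  using weight_space_one_dim[OF x(1-3) v] spin_dd[OF x] by simp

lemma wt_cong: "wt m x \<Longrightarrow> (\<And>i. i \<in> idx \<Longrightarrow> m i = m' i) \<Longrightarrow> wt m' x"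
  by (simp add: wt_def)

lemma raise_step:
  assumes x: "x \<in> V s" "x \<noteq> 0" "wt (wl l) x" "l \<in> set even_signs"
    and pq: "p \<in> idx" "q \<in> idx" "\<bar>p\<bar> \<noteq> \<bar>q\<bar>" "raises l p q"
    and l': "\<And>i. i \<in> idx \<Longrightarrow> sv l' i = sv l i + 2 * (isg i p + isg i q)"
  shows "br (X p q) x \<in> V s \<and> br (X p q) x \<noteq> 0 \<and> wt (wl l') (br (X p q) x)"
proof (intro conjI)
  show "br (X p q) x \<in> V s" using V_br_X x pq by blast
  have spin: "\<forall>p\<in>idx. wl l p = (1 / 2 :: 'k) \<or> wl l p = - (1 / 2 :: 'k)" using wl_values x by blast
  have "dd (wl l) = 1" by (rule spin_dd[OF x(1-3) spin])
  moreover have "wl l p = - (1 / 2 :: 'k)" "wl l q = - (1 / 2 :: 'k)"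
    using pq(4) wl_eq_minus_half x(4) pq unfolding raises_def by blast+
  moreover have "p \<noteq> q" "p \<noteq> - q" using pq by auto
  ultimately show "br (X p q) x \<noteq> 0"
    using weight_trichotomy(2)[OF x(1-3) pq(1,2)] by simp
  show "wt (wl l') (br (X p q) x)"
    by (rule wt_cong[OF wt_shift[OF x(3) pq(1,2)]]) (simp add: wl_shift[OF l'])
qed

lemma span_half_spin:
  assumes x: "x \<in> V s" "x \<noteq> 0" "wt (wl l) x" "l \<in> set even_signs"
  shows "span {x \<in> V s. \<exists>l\<in>set even_signs. wt (wl l) x} = V s"
proof -
  define \<Phi> where "\<Phi> m \<longleftrightarrow> (\<exists>l\<in>set even_signs. \<forall>i\<in>idx. m i = (wl l i :: 'k))" for m
  have "span {x \<in> V s. \<exists>m. \<Phi> m \<and> wt m x} = V s"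
  proof (rule weights_closed[OF x(1-3)])
    show "\<Phi> (wl l)" using x \<Phi>_def by blast
    fix m x p q assume x: "x \<in> V s" "wt m x" and "\<Phi> m"
      and pq: "p \<in> idx" "q \<in> idx" "p \<noteq> q" "p \<noteq> - q" and ne: "br (X p q) x \<noteq> 0"
    then obtain l where l: "l \<in> set even_signs" "\<forall>i\<in>idx. m i = wl l i" unfolding \<Phi>_def by blast
    have apq: "\<bar>p\<bar> \<noteq> \<bar>q\<bar>" using pq by (simp add: abs_eq_iff)
    have "\<forall>p\<in>idx. m p = 1 / 2 \<or> m p = - (1 / 2)" using wl_values l by auto
    from spin_raise[OF x this pq(1,2) apq ne] have "raises l p q"
      using l pq wl_eq_minus_half[OF l(1)] unfolding raises_def by auto
    then have "list_ex (\<lambda>l'. list_all (\<lambda>i. sv l' i = sv l i + 2 * (isg i p + isg i q)) [1, 2, 3, 4, 5]) even_signs"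
      using raise_table l(1) pq(1,2) apq unfolding list_all_iff set_idxs by blast
    then obtain l' where l': "l' \<in> set even_signs"
        "list_all (\<lambda>i. sv l' i = sv l i + 2 * (isg i p + isg i q)) [1, 2, 3, 4, 5]"
      unfolding list_ex_iff by blast
    have "m i + sg i p + sg i q = wl l' i" if "i \<in> idx" for i
      using bspec[OF l(2) that] by (simp add: wl_shift[OF shift_idx[OF l'(2) that]])
    then show "\<Phi> (\<lambda>i. m i + sg i p + sg i q)" unfolding \<Phi>_def using l'(1) by blast
  qed
  moreover have "{x \<in> V s. \<exists>m. \<Phi> m \<and> wt m x} = {x \<in> V s. \<exists>l\<in>set even_signs. wt (wl l) x}"
    unfolding \<Phi>_def using wt_cong by blast
  ultimately show ?thesis by simp
qed

text \<open>
  Pairing the equation \<open>[\<xi>, a'] + [a, \<eta>] = 0\<close> with \<open>g \<in> g0\<close> gives the hypothesis \<open>eq\<close>. For the diagonal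
  elements it forces the functional to vanish on the two vectors themselves; a root vector as
  in \<open>reach\<close> leaves a single term of the four, whence it vanishes on each other weight space.
\<close>

lemma half_vanishes:
  assumes e: "e = 1 \<or> e = - 1"
    and y: "\<And>u. u \<in> set (pat e) \<union> set (pat (- e)) \<Longrightarrow> y u \<in> V s \<and> y u \<noteq> 0 \<and> wt (wl u) (y u)"
    and eq: "\<And>g. g \<in> g0 \<Longrightarrow> kf \<zeta> (br g (y [1, 1, 1, e, e])) + kf \<zeta> (br g (y [- 1, - 1, - 1, - e, e])) =
      kf \<zeta>' (br g (y [1, 1, 1, - e, - e])) + kf \<zeta>' (br g (y [- 1, - 1, - 1, e, - e]))"
    and v: "v \<in> V s"
  shows "kf \<zeta> v = 0"
proof -
  let ?u1 = "[1, 1, 1, e, e]" and ?u2 = "[- 1, - 1, - 1, - e, e]"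
  let ?v1 = "[1, 1, 1, - e, - e]" and ?v2 = "[- 1, - 1, - 1, e, - e]"
  have sets: "set (pat e) = {?u1, ?u2}" "set (pat (- e)) = {?v1, ?v2}" by (auto simp: pat_def)
  have ee: "- e = 1 \<or> - e = - 1" using e by auto
  have evn: "u \<in> set even_signs" if "u \<in> set (pat e) \<union> set (pat (- e))" for u
    using that pat_even[OF e] pat_even[OF ee] by blast
  define a b c d where "a = kf \<zeta> (y ?u1)" and "b = kf \<zeta> (y ?u2)" and "c = kf \<zeta>' (y ?v1)" and "d = kf \<zeta>' (y ?v2)"
  have Y: "y ?u1 \<in> V s" "y ?u2 \<in> V s" "y ?v1 \<in> V s" "y ?v2 \<in> V s"
    "wt (wl ?u1) (y ?u1)" "wt (wl ?u2) (y ?u2)" "wt (wl ?v1) (y ?v1)" "wt (wl ?v2) (y ?v2)"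
    using y sets by auto
  have h: "wl ?u1 i * a + wl ?u2 i * b = wl ?v1 i * c + wl ?v2 i * d" if i: "i \<in> idx" for i
    using eq[OF X_g0[of i "- i"]] i Y(5-8) by (simp add: wt_def kf_scale a_def b_def c_def d_def)
  have H: "of_int (sv ?u1 i) * a + of_int (sv ?u2 i) * b = of_int (sv ?v1 i) * c + of_int (sv ?v2 i) * d"
    if "i \<in> idx" for i
    using h[OF that] unfolding wl_def times_divide_eq_left add_divide_distrib[symmetric] divide_cancel_right by simp
  have "s * (a + b) = s * (c + d)"
    using eq[OF z(1)] Y(1-4) by (simp add: V_def kf_scale a_def b_def c_def d_def distrib_left)
  then have 0: "a + b = c + d" using s(1) by simp
  have "1 \<in> idx" "4 \<in> idx" "5 \<in> idx" by (auto simp: idx_def)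
  then have "a - b = c - d" "of_int e * (a - b) = - (of_int e * (c - d))" "of_int e * (a + b) = - (of_int e * (c + d))"
    using H[of 1] H[of 4] H[of 5] by (simp_all add: sv_def algebra_simps)
  then have "a - b = c - d" "a - b = - (c - d)" "a + b = - (c + d)" using e by auto
  then have "a - b = 0" "a + b = 0" using 0 eq_neg_zero by blast+
  then have ab: "a = 0" "b = 0" by simp_all
  have T0: "kf \<zeta> (y u) = 0" if "u \<in> set (pat e)" for u using that ab sets by (auto simp: a_def b_def)
  have spin: "\<forall>p\<in>idx. wl l p = (1 / 2 :: 'k) \<or> wl l p = - (1 / 2 :: 'k)" if "l \<in> set even_signs" for l
    using wl_values that by blast
  have vanish: "kf \<zeta> v = 0" if v: "v \<in> V s" "wt (wl l) v" and l: "l \<in> set even_signs" for v l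
  proof (cases "l \<in> set (pat e)")
    case True
    then have yl: "y l \<in> V s" "y l \<noteq> 0" "wt (wl l) (y l)" using y[of l] by auto
    obtain c where "v = smul c (y l)" using spin_proportional[OF yl spin[OF l] v] by blast
    then show ?thesis using T0[OF True] by (simp add: kf_scale)
  next
    case False
    obtain u p q where u: "u \<in> set (pat e)" "p \<in> idx" "q \<in> idx" "\<bar>p\<bar> \<noteq> \<bar>q\<bar>" "raises u p q"
      "\<forall>v\<in>set (pat e) \<union> set (pat (- e)). v \<noteq> u \<longrightarrow> \<not> raises v p q"
      "\<forall>i\<in>idx. sv l i = sv u i + 2 * (isg i p + isg i q)"
      using reach[OF e l False] by blast
    have yu: "y u \<in> V s" "y u \<noteq> 0" "wt (wl u) (y u)" "u \<in> set even_signs" using y[of u] u(1) evn by auto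
    note w = raise_step[OF yu u(2-5) bspec[OF u(7)]]
    have other: "br (X p q) (y v) = 0" if v: "v \<in> set (pat e) \<union> set (pat (- e))" "v \<noteq> u" for v
    proof (rule ccontr)
      assume ne: "br (X p q) (y v) \<noteq> 0"
      have "wl v p = - (1 / 2 :: 'k)" "wl v q = - (1 / 2 :: 'k)"
        using spin_raise[OF _ _ spin[OF evn[OF v(1)]] u(2-4) ne] y[OF v(1)] by blast+
      then have "raises v p q" using wl_eq_minus_half[OF evn[OF v(1)]] u unfolding raises_def by blast
      then show False using u(6) v by blast
    qed
    have neq: "?u1 \<noteq> ?u2" "?v1 \<noteq> ?u1" "?v1 \<noteq> ?u2" "?v2 \<noteq> ?u1" "?v2 \<noteq> ?u2" using e by auto
    have u12: "u = ?u1 \<or> u = ?u2" using u(1) sets by simp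
    have "?v1 \<noteq> u" "?v2 \<noteq> u" using u12 neq by blast+
    then have "br (X p q) (y ?v1) = 0" "br (X p q) (y ?v2) = 0"
      by (auto intro!: other simp only: sets)
    then have sum0: "kf \<zeta> (br (X p q) (y ?u1)) + kf \<zeta> (br (X p q) (y ?u2)) = 0"
      using eq[OF X_g0[OF u(2,3)]] by simp
    have "kf \<zeta> (br (X p q) (y u)) = 0"
    proof (cases "u = ?u1")
      case True
      then have "br (X p q) (y ?u2) = 0" using neq(1) neq(1)[symmetric] by (intro other) (simp_all only: sets, blast+)
      then show ?thesis using sum0 True by simp
    next
      case False
      then have "br (X p q) (y ?u1) = 0" by (intro other) (simp_all only: sets, blast+)
      then show ?thesis using sum0 u12 False by simp
    qed
    moreover obtain c where "v = smul c (br (X p q) (y u))"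
      using spin_proportional[of "br (X p q) (y u)" "wl l" v] w spin[OF l] v by blast
    ultimately show ?thesis by (simp add: kf_scale)
  qed
  obtain x where "x \<in> V s" "x \<noteq> 0" "wt (wl ?u1) x" "?u1 \<in> set even_signs"
    using y[of ?u1] evn[of ?u1] sets by auto
  then have "v \<in> span {x \<in> V s. \<exists>l\<in>set even_signs. wt (wl l) x}" using span_half_spin v by simp
  then show ?thesis
  proof (induction rule: span_induct_alt)
    case (step c x y)
    then have "kf \<zeta> x = 0" using vanish by blast
    then show ?case using step by (simp add: kf_add kf_scale)
  qed simp
qed

lemma injective_pair_from_highest:
  assumes x: "x \<in> V s" "x \<noteq> 0" "wt (wl [1, 1, 1, 1, 1]) x"
  shows "\<exists>a\<in>V s. \<exists>a'\<in>V s. \<forall>\<xi>\<in>V (- s). \<forall>\<eta>\<in>V (- s). br \<xi> a' + br a \<eta> = 0 \<longrightarrow> \<xi> = 0 \<and> \<eta> = 0"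
proof -
  interpret o: framed_pair smul L br Bs h ev \<sigma> z g0 g1 "- s" X by (rule opposite_framed)
  have mem: "[1, 1, 1, 1, 1] \<in> set even_signs" "[- 1, - 1, 1, 1, 1] \<in> set even_signs"
    by (auto simp: even_signs_def)
  have id: "- 1 \<in> idx" "- 2 \<in> idx" "- 3 \<in> idx" "- 4 \<in> idx" "- 5 \<in> idx" by (auto simp: idx_def)
  have r: "raises [1, 1, 1, 1, 1] (- 1) (- 2)" "raises [1, 1, 1, 1, 1] (- 4) (- 5)"
    "raises [- 1, - 1, 1, 1, 1] (- 3) (- 4)" "raises [- 1, - 1, 1, 1, 1] (- 3) (- 5)"
    by (simp_all add: raises_def sv_def)
  obtain w where w: "w \<in> V s" "w \<noteq> 0" "wt (wl [- 1, - 1, 1, 1, 1]) w"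
    using raise_step[OF x mem(1) id(1,2) _ r(1), of "[- 1, - 1, 1, 1, 1]"]
      shift_idx[of "[- 1, - 1, 1, 1, 1]" "[1, 1, 1, 1, 1]" "- 1" "- 2"] by (auto simp: sv_def isg_def)
  obtain x2 where x2: "x2 \<in> V s" "x2 \<noteq> 0" "wt (wl [- 1, - 1, - 1, - 1, 1]) x2"
    using raise_step[OF w mem(2) id(3,4) _ r(3), of "[- 1, - 1, - 1, - 1, 1]"]
      shift_idx[of "[- 1, - 1, - 1, - 1, 1]" "[- 1, - 1, 1, 1, 1]" "- 3" "- 4"] by (auto simp: sv_def isg_def)
  obtain x3 where x3: "x3 \<in> V s" "x3 \<noteq> 0" "wt (wl [1, 1, 1, - 1, - 1]) x3"
    using raise_step[OF x mem(1) id(4,5) _ r(2), of "[1, 1, 1, - 1, - 1]"]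
      shift_idx[of "[1, 1, 1, - 1, - 1]" "[1, 1, 1, 1, 1]" "- 4" "- 5"] by (auto simp: sv_def isg_def)
  obtain x4 where x4: "x4 \<in> V s" "x4 \<noteq> 0" "wt (wl [- 1, - 1, - 1, 1, - 1]) x4"
    using raise_step[OF w mem(2) id(3,5) _ r(4), of "[- 1, - 1, - 1, 1, - 1]"]
      shift_idx[of "[- 1, - 1, - 1, 1, - 1]" "[- 1, - 1, 1, 1, 1]" "- 3" "- 5"] by (auto simp: sv_def isg_def)
  define y :: "int list \<Rightarrow> 'g" where "y u = (if u = [1, 1, 1, 1, 1] then x else if u = [- 1, - 1, - 1, - 1, 1] then x2
    else if u = [1, 1, 1, - 1, - 1] then x3 else x4)" for u
  have y: "y u \<in> V s \<and> y u \<noteq> 0 \<and> wt (wl u) (y u)" if "u \<in> set (pat 1) \<union> set (pat (- 1))" for u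
    using that x x2 x3 x4 by (auto simp: y_def pat_def)
  let ?a = "x + x2" and ?a' = "x3 + x4"
  have "\<xi> = 0 \<and> \<eta> = 0" if \<xi>: "\<xi> \<in> V (- s)" and \<eta>: "\<eta> \<in> V (- s)" and 0: "br \<xi> ?a' + br ?a \<eta> = 0" for \<xi> \<eta>
  proof -
    have eq: "kf \<xi> (br g ?a') = kf \<eta> (br g ?a)" for g
    proof -
      have "kf (br \<xi> ?a') g + kf (br ?a \<eta>) g = kf (br \<xi> ?a' + br ?a \<eta>) g" by (rule kf_add(1)[symmetric])
      also have "\<dots> = 0" unfolding 0 by simp
      finally have "kf (br \<xi> ?a') g - kf (br \<eta> ?a) g = 0" by (simp only: br_anti[of ?a \<eta>] kf_neg) simp
      then have "kf \<xi> (br ?a' g) = kf \<eta> (br ?a g)" by (simp only: kf_invariant) simp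
      then have "- kf \<xi> (br g ?a') = - kf \<eta> (br g ?a)" by (simp only: br_anti[of ?a' g] br_anti[of ?a g] kf_neg)
      then show ?thesis by simp
    qed
    have eq1: "kf \<xi> (br g (y [1, 1, 1, - 1, - 1])) + kf \<xi> (br g (y [- 1, - 1, - 1, - (- 1), - 1])) =
      kf \<eta> (br g (y [1, 1, 1, - (- 1), - (- 1)])) + kf \<eta> (br g (y [- 1, - 1, - 1, - 1, - (- 1)]))" for g
      using eq[of g] by (simp add: y_def br_linear kf_add)
    have eq2: "kf \<eta> (br g (y [1, 1, 1, 1, 1])) + kf \<eta> (br g (y [- 1, - 1, - 1, - 1, 1])) =
      kf \<xi> (br g (y [1, 1, 1, - 1, - 1])) + kf \<xi> (br g (y [- 1, - 1, - 1, 1, - 1]))" for g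
      using eq[of g] by (simp add: y_def br_linear kf_add)
    have "kf \<xi> v = 0" if "v \<in> V s" for v
      by (rule half_vanishes[of "- 1" y \<xi> \<eta>, OF _ _ eq1 that]) (use y in auto)
    moreover have "kf \<eta> v = 0" if "v \<in> V s" for v
      by (rule half_vanishes[of 1 y \<eta> \<xi>, OF _ _ eq2 that]) (use y in auto)
    ultimately show ?thesis using o.kf_nondegenerate_V[of \<xi>] o.kf_nondegenerate_V[of \<eta>] \<xi> \<eta> by simp
  qed
  moreover have "?a \<in> V s" "?a' \<in> V s" using x x2 x3 x4 subspace_V subspace_add by blast+
  ultimately show ?thesis by blast
qed

text \<open>Renaming the basis of the ten-dimensional space turns any spin weight into \<open>(1/2, 1/2, 1/2, 1/2, 1/2)\<close>.\<close>

lemma relabel: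
  assumes \<theta>: "\<And>p. p \<in> idx \<Longrightarrow> \<theta> p \<in> idx" "\<And>p. p \<in> idx \<Longrightarrow> \<theta> (- p) = - \<theta> p" "inj_on \<theta> idx"
  shows "framed_pair smul L br Bs h ev \<sigma> z g0 g1 s (\<lambda>p q. X (\<theta> p) (\<theta> q))"
proof (intro framed_pair.intro graded_pair_axioms framed_pair_axioms.intro)
  have surj: "\<theta> ` idx = idx" using \<theta> by (intro endo_inj_surj) auto
  have "{X (\<theta> p) (\<theta> q) | p q. p \<in> idx \<and> q \<in> idx} = (\<lambda>(p, q). X p q) ` (\<theta> ` idx \<times> \<theta> ` idx)" by auto
  also have "\<dots> = {X p q | p q. p \<in> idx \<and> q \<in> idx}" unfolding surj by auto
  finally show "g0 = span (insert z {X (\<theta> p) (\<theta> q) | p q. p \<in> idx \<and> q \<in> idx})" using X_span by simp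
  have eq: "\<theta> p = - \<theta> q \<longleftrightarrow> p = - q" if "p \<in> idx" "q \<in> idx" for p q
    using \<theta>(2)[OF that(2)] inj_onD[OF \<theta>(3), of p "- q"] that by auto
  fix p q assume pq: "p \<in> idx" "q \<in> idx"
  show "X (\<theta> p) (\<theta> q) \<in> g0" using X_g0 \<theta> pq by blast
  show "X (\<theta> q) (\<theta> p) = - X (\<theta> p) (\<theta> q)" using X_anti \<theta> pq by blast
  show "X (\<theta> p) (\<theta> q) \<noteq> 0" if "p \<noteq> q" using X_ne \<theta> pq that inj_onD[OF \<theta>(3), of p q] by blast
  fix r t assume "r \<in> idx" "t \<in> idx"
  then show "br (X (\<theta> p) (\<theta> q)) (X (\<theta> r) (\<theta> t)) =
      (if q = - r then X (\<theta> p) (\<theta> t) else 0) - (if p = - r then X (\<theta> q) (\<theta> t) else 0)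
        + (if q = - t then X (\<theta> r) (\<theta> p) else 0) - (if p = - t then X (\<theta> r) (\<theta> q) else 0)"
    using pq \<theta>(1) by (simp add: X_br eq)
qed

lemma injective_pair:
  assumes x: "x \<in> V s" "x \<noteq> 0" "wt m x" and m: "\<forall>p\<in>idx. m p = 1 / 2 \<or> m p = - (1 / 2)"
  shows "\<exists>a\<in>V s. \<exists>a'\<in>V s. \<forall>\<xi>\<in>V (- s). \<forall>\<eta>\<in>V (- s). br \<xi> a' + br a \<eta> = 0 \<longrightarrow> \<xi> = 0 \<and> \<eta> = 0"
proof -
  define \<theta> :: "int \<Rightarrow> int" where "\<theta> p = (if m \<bar>p\<bar> = 1 / 2 then p else - p)" for p
  have odd: "m (- p) = - m p" if "p \<in> idx" for p using wt_odd[OF x(3,2) that] .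
  interpret r: framed_pair smul L br Bs h ev \<sigma> z g0 g1 s "\<lambda>p q. X (\<theta> p) (\<theta> q)"
    by (rule relabel) (auto simp: \<theta>_def inj_on_def abs_if split: if_splits)
  have "r.wt (wl [1, 1, 1, 1, 1]) x"
    unfolding r.wt_def
  proof
    fix i assume i: "i \<in> idx"
    have abs: "\<bar>i\<bar> \<in> idx" using i by (auto simp: idx_def)
    have ti: "\<theta> i \<in> idx" "\<theta> (- i) = - \<theta> i" using i by (auto simp: \<theta>_def)
    have "m (\<theta> i) = (if i > 0 then 1 / 2 else - (1 / 2))"
    proof (cases "i > 0")
      case True
      then show ?thesis using bspec[OF m i] odd[OF i] by (auto simp: \<theta>_def)
    next
      case False
      have mi: "m i = - m (- i)" using odd[of "- i"] i by simp
      show ?thesis using False bspec[OF m, of "- i"] i mi by (auto simp: \<theta>_def abs_if)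
    qed
    also have "\<dots> = wl [1, 1, 1, 1, 1] i"
    proof -
      have "nat (\<bar>i\<bar> - 1) < 5" using i by (auto simp: idx_def)
      then have "[1, 1, 1, 1, 1 :: int] ! nat (\<bar>i\<bar> - 1) = 1" by (auto simp: less_Suc_eq numeral_eq_Suc)
      then show ?thesis using i by (auto simp: wl_def sv_def abs_if split: if_splits)
    qed
    finally show "br (X (\<theta> i) (\<theta> (- i))) x = smul (wl [1, 1, 1, 1, 1] i) x"
      using x(3) ti by (simp add: wt_def)
  qed
  then show ?thesis by (rule r.injective_pair_from_highest[OF x(1,2)])
qed

end

section \<open>The Lie algebra of type \<open>E\<^sub>6\<close>\<close>

text \<open>Roots as lists of their six coordinates, so that reflections can be computed.\<close>

definition root_of_list :: "int list \<Rightarrow> nat \<Rightarrow> int" where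
  "root_of_list l j = (if j \<in> {1..6} then l ! (j - 1) else 0)"

definition reflect :: "int list \<Rightarrow> nat \<Rightarrow> int list" where
  "reflect l i = l[i - 1 := l ! (i - 1) - sum_list (map (\<lambda>j. l ! (j - 1) * E6_cartan i j) [1, 2, 3, 4, 5, 6])]"

fun walk :: "int list \<Rightarrow> nat list \<Rightarrow> int list list" where
  "walk l [] = [l]"
| "walk l (i # is) = l # walk (reflect l i) is"

definition height_code :: "int list \<Rightarrow> int" where
  "height_code l = sum_list (map (\<lambda>j. l ! (j - 1) * 10 ^ (j - 1)) [1, 2, 3, 4, 5, 6])"

text \<open>A word in the simple reflections that leads from the first simple root through \<open>67\<close> different roots.\<close>

definition root_word :: "nat list" where
  "root_word = [1, 3, 1, 3, 1, 4, 1, 2, 1, 5, 1, 2, 1, 6, 1, 2, 1, 4, 1, 5, 1, 3, 4, 2, 2, 4, 5, 6, 3, 1, 4, 3, 2, 4, 5, 4,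
     2, 3, 1, 2, 1, 5, 1, 2, 1, 3, 2, 4, 2, 4, 2, 4, 5, 6, 2, 3, 1, 2, 1, 4, 1, 3, 5, 3, 1, 5, 6, 1, 3, 6, 5, 4, 2, 2, 4,
     3, 1, 5, 4, 2, 3, 4]"

definition root_walk :: "int list list" where
  "root_walk = walk [1, 0, 0, 0, 0, 0] root_word"

lemma root_walk_codes: "length (remdups (map height_code root_walk)) = 67"
  by code_simp

lemma atLeastAtMost_1_6: "{1..6 :: nat} = {1, 2, 3, 4, 5, 6}"
  by auto

lemma reflect_root:
  assumes "length l = 6" "i \<in> {1..6}" "root_of_list l \<in> E6_roots"
  shows "root_of_list (reflect l i) \<in> E6_roots" "length (reflect l i) = 6"
proof -
  have "(root_of_list l)(i := root_of_list l i - (\<Sum>j = 1..6. root_of_list l j * E6_cartan i j)) \<in> E6_roots"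
    by (rule E6_roots.reflection) (use assms in auto)
  also have "(root_of_list l)(i := root_of_list l i - (\<Sum>j = 1..6. root_of_list l j * E6_cartan i j))
      = root_of_list (reflect l i)"
  proof
    fix j
    have "(\<Sum>j = 1..6. root_of_list l j * E6_cartan i j) =
        sum_list (map (\<lambda>j. l ! (j - 1) * E6_cartan i j) [1, 2, 3, 4, 5, 6])"
      unfolding atLeastAtMost_1_6 by (simp add: root_of_list_def)
    then show "((root_of_list l)(i := root_of_list l i - (\<Sum>j = 1..6. root_of_list l j * E6_cartan i j))) j
      = root_of_list (reflect l i) j"
      using assms(1,2) by (auto simp: root_of_list_def reflect_def nth_list_update)
  qed
  finally show "root_of_list (reflect l i) \<in> E6_roots" .
  show "length (reflect l i) = 6" using assms by (simp add: reflect_def)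
qed

lemma walk_roots:
  assumes "length l = 6" "root_of_list l \<in> E6_roots" "set w \<subseteq> {1..6}"
  shows "x \<in> set (walk l w) \<Longrightarrow> root_of_list x \<in> E6_roots"
  using assms
proof (induction w arbitrary: l)
  case (Cons i w)
  have i: "i \<in> {1..6}" and w: "set w \<subseteq> {1..6}" using Cons.prems by auto
  note r = reflect_root[OF Cons.prems(2) i Cons.prems(3)]
  from Cons.prems(1) consider "x = l" | "x \<in> set (walk (reflect l i) w)" by auto
  then show ?case
  proof cases
    case 1
    then show ?thesis using Cons.prems by simp
  next
    case 2
    then show ?thesis by (rule Cons.IH[OF _ r(2,1) w])
  qed
qed simp

lemma root_walk_roots: "x \<in> set root_walk \<Longrightarrow> root_of_list x \<in> E6_roots"
proof -
  have eq: "root_of_list [1, 0, 0, 0, 0, 0] = (\<lambda>j. of_bool (j = 1))"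
  proof
    fix j :: nat
    consider "j \<in> {1, 2, 3, 4, 5, 6}" | "j \<notin> {1..6}" unfolding atLeastAtMost_1_6 by blast
    then show "root_of_list [1, 0, 0, 0, 0, 0] j = of_bool (j = 1)"
      by cases (auto simp: root_of_list_def)
  qed
  have "root_of_list [1, 0, 0, 0, 0, 0] \<in> E6_roots"
    unfolding eq by (rule E6_roots.simple_root) simp
  moreover have "set root_word \<subseteq> {1..6}" by (simp add: root_word_def)
  moreover have "length [1, 0, 0, 0, 0, 0 :: int] = 6" by simp
  moreover assume "x \<in> set root_walk"
  ultimately show "root_of_list x \<in> E6_roots"
    unfolding root_walk_def by (metis walk_roots)
qed

lemma height_code_sum: "height_code l = (\<Sum>i = 1..6. root_of_list l i * 10 ^ (i - 1))"
  unfolding atLeastAtMost_1_6 by (simp add: height_code_def root_of_list_def)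

locale closed_lie_algebra = lie_algebra smul L br
  for smul :: "'k::{alg_closed_field, field_char_0} \<Rightarrow> 'g::ab_group_add \<Rightarrow> 'g" and L br
begin

sublocale closed_vector_space smul
  by unfold_locales

lemma br_zero: "x \<in> L \<Longrightarrow> br 0 x = 0" "x \<in> L \<Longrightarrow> br x 0 = 0"
  using br_scale_left[of 0 x 0] br_scale_right[of x 0 0] subspace_0[OF subspace_carrier] by simp_all

lemma root_linear:
  assumes H: "H \<subseteq> L" "subspace H" and "root H \<beta>"
  shows "h \<in> H \<Longrightarrow> k \<in> H \<Longrightarrow> \<beta> (h + k) = \<beta> h + \<beta> k" "h \<in> H \<Longrightarrow> \<beta> (smul c h) = c * \<beta> h"
proof -
  obtain x where x: "x \<in> L" "x \<noteq> 0" "\<forall>h\<in>H. br h x = smul (\<beta> h) x" using assms(3) by (auto simp: root_def)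
  show "\<beta> (h + k) = \<beta> h + \<beta> k" if hk: "h \<in> H" "k \<in> H"
  proof -
    have "br (h + k) x = br h x + br k x" using hk H x by (intro br_add_left) auto
    then have "smul (\<beta> (h + k)) x = smul (\<beta> h + \<beta> k) x"
      using x hk subspace_add[OF H(2) hk] by (simp add: scale_left_distrib)
    then show ?thesis using x by simp
  qed
  show "\<beta> (smul c h) = c * \<beta> h" if h: "h \<in> H"
  proof -
    have "br (smul c h) x = smul c (br h x)" using h H x by (intro br_scale_left) auto
    then have "smul (\<beta> (smul c h)) x = smul (c * \<beta> h) x"
      using x h subspace_scale[OF H(2) h] by simp
    then show ?thesis using x by simp
  qed
qed

text \<open>
  An element \<open>h\<close> of the Cartan subalgebra on which the simple roots take the values \<open>1, 10, 100, \<dots>\<close>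
  separates enough roots to bound the dimension from below, and its eigenvalues are integers.
\<close>

lemma integral_element:
  assumes fd: finite_dimensional and cartan: "cartan_subalgebra H" and E6: "roots_of_type_E6 H"
  obtains h Bs ev where "h \<in> L" "finite Bs" "independent Bs" "span Bs = L"
    "\<forall>b\<in>Bs. br h b = smul (of_int (ev b)) b" "\<exists>b\<in>Bs. ev b \<noteq> 0" "card Bs \<ge> 67"
proof -
  have H: "subspace H" "H \<subseteq> L" "\<And>h k. h \<in> H \<Longrightarrow> k \<in> H \<Longrightarrow> br h k = 0"
    "\<And>h. h \<in> H \<Longrightarrow> span {x \<in> L. \<exists>c. br h x = smul c x} = L"
    using cartan by (auto simp: cartan_subalgebra_def)
  obtain S where S: "finite S" "L = span S" using fd by (auto simp: finite_dimensional_def)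
  from E6 obtain \<alpha> :: "nat \<Rightarrow> 'g \<Rightarrow> 'k"
    where \<alpha>: "(\<forall>c. (\<forall>h\<in>H. (\<Sum>i = 1..6. c i * \<alpha> i h) = 0) \<longrightarrow> (\<forall>i\<in>{1..6}. c i = 0)) \<and>
      (\<forall>\<beta>. root H \<beta> \<longleftrightarrow> (\<exists>m\<in>E6_roots. \<forall>h\<in>H. \<beta> h = (\<Sum>i = 1..6. of_int (m i) * \<alpha> i h)))"
    unfolding roots_of_type_E6_def by (elim exE)
  have ind: "\<And>c. (\<forall>h\<in>H. (\<Sum>i = 1..6. c i * \<alpha> i h) = 0) \<Longrightarrow> \<forall>i\<in>{1..6}. c i = 0"
    and roots: "\<And>\<beta>. root H \<beta> \<longleftrightarrow> (\<exists>m\<in>E6_roots. \<forall>h\<in>H. \<beta> h = (\<Sum>i = 1..6. of_int (m i) * \<alpha> i h))"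
    by (rule conjunct1[OF \<alpha>, THEN spec, THEN mp], assumption) (rule conjunct2[OF \<alpha>, THEN spec])
  have \<alpha>_root: "root H (\<alpha> i)" if i: "i \<in> {1..6}" for i
  proof -
    have *: "\<alpha> i h = (\<Sum>j = 1..6. of_int (of_bool (j = i)) * \<alpha> j h)" for h
    proof -
      have "(\<Sum>j = 1..6. of_int (of_bool (j = i)) * \<alpha> j h) = (\<Sum>j = 1..6. if j = i then \<alpha> i h else 0)"
        by (rule sum.cong) auto
      then show ?thesis using i by simp
    qed
    show ?thesis unfolding roots by (rule bexI[OF _ E6_roots.simple_root[OF i]], rule ballI, rule *)
  qed
  have "\<exists>g. Vector_Spaces.linear smul (*) g \<and> (\<forall>h\<in>H. g h = \<alpha> i h)" if i: "i \<in> {1..6}" for i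
  proof -
    obtain g where "Vector_Spaces.linear smul (*) g" "\<And>x. x \<in> H \<Longrightarrow> g x = \<alpha> i x"
      by (rule extend_functional[OF H(1), of "\<alpha> i", OF root_linear[OF H(2,1) \<alpha>_root[OF i]]]) auto
    then show ?thesis by blast
  qed
  then obtain g where g: "\<And>i. i \<in> {1..6} \<Longrightarrow> Vector_Spaces.linear smul (*) (g i)"
    "\<And>i h. i \<in> {1..6} \<Longrightarrow> h \<in> H \<Longrightarrow> g i h = \<alpha> i h" by metis
  have "\<exists>h\<in>H. \<forall>i\<in>{1..6}. g i h = of_int (10 ^ (i - 1))"
  proof (rule independent_functionals_surj[OF _ H(1) g(1)])
    fix c assume c: "\<And>h. h \<in> H \<Longrightarrow> (\<Sum>i = 1..6. c i * g i h) = 0"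
    show "\<forall>i\<in>{1..6}. c i = 0"
    proof (rule ind, rule ballI)
      fix h assume h: "h \<in> H"
      have "(\<Sum>i = 1..6. c i * \<alpha> i h) = (\<Sum>i = 1..6. c i * g i h)" by (rule sum.cong) (simp_all add: g h)
      then show "(\<Sum>i = 1..6. c i * \<alpha> i h) = 0" using c[OF h] by simp
    qed
  qed auto
  then obtain h where h: "h \<in> H" "\<And>i. i \<in> {1..6} \<Longrightarrow> \<alpha> i h = of_int (10 ^ (i - 1))" using g by auto
  have hL: "h \<in> L" using h H by blast
  have val: "(\<Sum>i = 1..6. of_int (m i) * \<alpha> i h) = of_int (\<Sum>i = 1..6. m i * 10 ^ (i - 1))" for m
    unfolding of_int_sum by (rule sum.cong) (simp_all add: h)
  have integral: "\<exists>n. c = of_int n" if x: "x \<in> L" "x \<noteq> 0" "br h x = smul c x" for c x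
  proof -
    let ?W = "{x \<in> L. br h x = smul c x}"
    have sub: "subspace ?W"
      using subspace_0[OF subspace_carrier] subspace_add[OF subspace_carrier] subspace_scale[OF subspace_carrier] hL
      by (intro subspaceI) (auto simp: br_zero br_add_right br_scale_right scale_right_distrib mult.commute)
    have comm: "br a (br b y) = br b (br a y)" if "a \<in> H" "b \<in> H" "y \<in> L" for a b y
    proof -
      have L: "a \<in> L" "b \<in> L" using that H by auto
      have "br (y + a) (y + a) = 0" "br a a = 0" "br y y = 0"
        using br_self subspace_add[OF subspace_carrier] L that by blast+
      then have ya: "br y a = - br a y"
        using L that subspace_add[OF subspace_carrier, of y a] by (simp add: br_add_left br_add_right eq_neg_iff_add_eq_0 add.commute)
      have "br b (br y a) = - br b (br a y)"
        using br_scale_right[of b "br a y" "- 1"] L that br_closed by (simp add: ya)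
      moreover have "br y (br a b) = 0" using H(3)[OF that(1,2)] br_zero(2)[OF that(3)] by simp
      ultimately show ?thesis using jacobi[OF L(1,2) that(3)] by simp
    qed
    have "\<exists>v\<in>?W. v \<noteq> 0 \<and> (\<forall>f\<in>br ` H. \<exists>c. f v = smul c v)"
    proof (rule common_eigenvector_exists[OF sub _ S(1)])
      show "?W \<noteq> {0}" using x by blast
      show "?W \<subseteq> span S" using S by auto
      fix f v assume f: "f \<in> br ` H" and v: "v \<in> ?W"
      then obtain k where k: "k \<in> H" "f = br k" by blast
      have kL: "k \<in> L" using k H by blast
      show "f v \<in> ?W"
        using v k kL hL comm[OF h(1) k(1), of v] by (simp add: br_closed br_scale_right)
      show "f (smul c v) = smul c (f v)" for c using v k kL by (simp add: br_scale_right)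
      show "f (v + w) = f v + f w" if "w \<in> ?W" for w using v that k kL by (simp add: br_add_right)
      show "f (g v) = g (f v)" if "g \<in> br ` H" for g using that k v comm by auto
    qed
    then obtain v where v: "v \<in> L" "v \<noteq> 0" "br h v = smul c v" "\<And>k. k \<in> H \<Longrightarrow> \<exists>c. br k v = smul c v" by auto
    then obtain \<beta> where \<beta>: "\<And>k. k \<in> H \<Longrightarrow> br k v = smul (\<beta> k) v" by metis
    have c: "c = \<beta> h" using \<beta>[OF h(1)] v by simp
    show ?thesis
    proof (cases "\<exists>k\<in>H. \<beta> k \<noteq> 0")
      case True
      then have "root H \<beta>" using v \<beta> by (auto simp: root_def)
      then obtain m where "m \<in> E6_roots" "\<forall>h\<in>H. \<beta> h = (\<Sum>i = 1..6. of_int (m i) * \<alpha> i h)"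
        using roots by blast
      then have "c = of_int (\<Sum>i = 1..6. m i * 10 ^ (i - 1))" unfolding c val[symmetric] using h(1) by blast
      then show ?thesis by blast
    next
      case False
      then have "c = of_int 0" using c h by simp
      then show ?thesis by blast
    qed
  qed
  obtain Bs where Bs: "Bs \<subseteq> {x \<in> L. \<exists>c. br h x = smul c x}" "independent Bs"
    "{x \<in> L. \<exists>c. br h x = smul c x} \<subseteq> span Bs" "card Bs = dim {x \<in> L. \<exists>c. br h x = smul c x}"
    by (rule basis_exists)
  have span_Bs: "span Bs = L"
    using span_minimal[OF Bs(3) subspace_span] H(4)[OF h(1)] span_minimal[OF _ subspace_carrier, of Bs] Bs(1) by auto
  have finB: "finite Bs" using independent_span_bound[OF S(1) Bs(2)] span_superset[of Bs] span_Bs S by blast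
  have "\<exists>n. br h b = smul (of_int n) b" if b: "b \<in> Bs" for b
  proof -
    obtain c where c: "b \<in> L" "br h b = smul c b" using Bs b by blast
    have "b \<noteq> 0" using Bs(2) b dependent_zero by blast
    then show ?thesis using integral[OF c(1) _ c(2)] c by blast
  qed
  then obtain ev where ev: "\<And>b. b \<in> Bs \<Longrightarrow> br h b = smul (of_int (ev b)) b" by metis
  have BL: "b \<in> Bs \<Longrightarrow> b \<in> L" for b using Bs by blast
  have expand: "br h (\<Sum>b\<in>A. smul (r b) b) = (\<Sum>b\<in>A. smul (r b * of_int (ev b)) b) \<and> (\<Sum>b\<in>A. smul (r b) b) \<in> L"
    if "A \<subseteq> Bs" for r A
    using finite_subset[OF that finB] that
  proof (induction A rule: finite_induct)
    case empty
    then show ?case using br_zero hL subspace_0[OF subspace_carrier] by simp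
  next
    case (insert b A)
    then have b: "b \<in> L" "smul (r b) b \<in> L" using BL subspace_scale[OF subspace_carrier] by auto
    with insert show ?case
      using hL by (simp add: br_add_right br_scale_right ev subspace_add[OF subspace_carrier])
  qed
  have occurs: "n \<in> ev ` Bs" if x: "x \<in> L" "x \<noteq> 0" "br h x = smul (of_int n) x" for n x
  proof -
    let ?r = "representation Bs x"
    have xs: "(\<Sum>b\<in>Bs. smul (?r b) b) = x" using sum_representation_eq[OF Bs(2) _ finB subset_refl] x span_Bs by simp
    have "(\<Sum>b\<in>Bs. smul (?r b * of_int (ev b)) b) = smul (of_int n) (\<Sum>b\<in>Bs. smul (?r b) b)"
      using expand[of Bs ?r] x by (simp add: xs)
    then have sum0: "(\<Sum>b\<in>Bs. smul (?r b * of_int (ev b) - of_int n * ?r b) b) = 0"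
      by (simp add: scale_left_diff_distrib sum_subtractf scale_sum_right)
    have z: "?r b * of_int (ev b) - of_int n * ?r b = 0" if "b \<in> Bs" for b
      by (rule independentD[OF Bs(2) finB subset_refl sum0 that])
    have "\<exists>b\<in>Bs. ?r b \<noteq> 0"
    proof (rule ccontr)
      assume "\<not> ?thesis"
      then have "(\<Sum>b\<in>Bs. smul (?r b) b) = 0" by (intro sum.neutral) auto
      then show False using xs x by simp
    qed
    then obtain b where b: "b \<in> Bs" "?r b \<noteq> 0" by blast
    then have "of_int (ev b) = (of_int n :: 'k)" using z[OF b(1)] by (simp add: mult.commute)
    then show ?thesis using b by auto
  qed
  have "height_code ` set root_walk \<subseteq> ev ` Bs"
  proof safe
    fix l assume l: "l \<in> set root_walk"
    define \<beta> where "\<beta> k = (\<Sum>i = 1..6. of_int (root_of_list l i) * \<alpha> i k)" for k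
    have "root H \<beta>" unfolding roots using root_walk_roots[OF l] \<beta>_def by blast
    then obtain x where x: "x \<in> L" "x \<noteq> 0" "br h x = smul (\<beta> h) x" using h(1) by (auto simp: root_def)
    have "\<beta> h = of_int (height_code l)" unfolding \<beta>_def val height_code_sum ..
    then show "height_code l \<in> ev ` Bs" using occurs[OF x(1,2)] x(3) by simp
  qed
  moreover have "card (height_code ` set root_walk) = 67"
    using root_walk_codes by (simp add: length_remdups_card_conv del: set_map) simp
  ultimately have card: "67 \<le> card (ev ` Bs)" using card_mono[of "ev ` Bs" "height_code ` set root_walk"] finB by simp
  then have c67: "card Bs \<ge> 67" using card_image_le[OF finB, of ev] by linarith
  have "\<exists>b\<in>Bs. ev b \<noteq> 0"
  proof (rule ccontr)
    assume "\<not> ?thesis"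
    then have "ev ` Bs \<subseteq> {0}" by auto
    from card_mono[OF _ this] card show False by simp
  qed
  moreover have "\<forall>b\<in>Bs. br h b = smul (of_int (ev b)) b" using ev by blast
  ultimately show thesis using that[OF hL finB Bs(2) span_Bs _ _ c67] by blast
qed

end

text \<open>
  If neither \<open>V s\<close> nor \<open>V (-s)\<close> has spin weights, then \<open>L\<close> is spanned by \<open>45\<close> elements \<open>X p q\<close>, the element \<open>z\<close> and
  ten vectors from each of the two.
\<close>

lemma root_pairs_card: "length (filter (\<lambda>(p, q). p < q) (List.product idxs idxs)) = 45"
  by code_simp

lemma (in framed_pair) injective_pair_exists:
  assumes "card Bs \<ge> 67"
  shows "\<exists>t. t \<noteq> 0 \<and> g1 = {x + y | x y. x \<in> V t \<and> y \<in> V (- t)} \<and> V (- t) \<noteq> {0} \<and>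
    (\<exists>a\<in>V t. \<exists>a'\<in>V t. \<forall>\<xi>\<in>V (- t). \<forall>\<eta>\<in>V (- t). br \<xi> a' + br a \<eta> = 0 \<longrightarrow> \<xi> = 0 \<and> \<eta> = 0)"
proof -
  interpret o: framed_pair smul L br Bs h ev \<sigma> z g0 g1 "- s" X by (rule opposite_framed)
  let ?small = "\<lambda>t. \<exists>A. finite A \<and> card A \<le> 10 \<and> V t \<subseteq> span A"
  let ?spin = "\<lambda>t. \<exists>x m. x \<in> V t \<and> x \<noteq> 0 \<and> wt m x \<and> (\<forall>p\<in>idx. m p = 1 / 2 \<or> m p = - (1 / 2))"
  have small0: "?small t" if "V t = {0}" for t
    by (rule exI[of _ "{}"]) (simp add: that)
  have "?small s \<or> ?spin s"
  proof (cases "V s = {0}")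
    case True
    then show ?thesis by (intro disjI1 small0)
  qed (rule zero_or_vector_or_spin)
  moreover have "?small (- s) \<or> ?spin (- s)"
  proof (cases "V (- s) = {0}")
    case True
    then show ?thesis by (intro disjI1 small0)
  qed (rule o.zero_or_vector_or_spin)
  moreover have "\<not> (?small s \<and> ?small (- s))"
  proof
    assume "?small s \<and> ?small (- s)"
    then obtain A A' where A: "finite A" "card A \<le> 10" "V s \<subseteq> span A"
      and A': "finite A'" "card A' \<le> 10" "V (- s) \<subseteq> span A'" by blast
    let ?Q = "set (filter (\<lambda>(p, q). p < q) (List.product idxs idxs))"
    let ?P = "(\<lambda>(p, q). X p q) ` ?Q"
    let ?S = "insert z ?P \<union> (A \<union> A')"
    have "X p q \<in> span ?S" if pq: "p \<in> idx" "q \<in> idx" for p q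
    proof -
      consider "p < q" | "q < p" | "p = q" by linarith
      then show ?thesis
      proof cases
        case 1
        then have "X p q \<in> ?P" using pq by (force simp: set_idxs)
        then show ?thesis by (intro span_base) blast
      next
        case 2
        then have "X q p \<in> ?P" using pq by (force simp: set_idxs)
        then have "- X q p \<in> span ?S" by (intro span_neg span_base) blast
        then show ?thesis using X_anti[OF pq(2,1)] by simp
      next
        case 3
        then show ?thesis using X_self pq span_zero by simp
      qed
    qed
    then have "g0 \<subseteq> span ?S" unfolding X_span
      by (intro span_minimal subspace_span) (auto intro: span_base)
    moreover have "V s \<subseteq> span ?S" "V (- s) \<subseteq> span ?S"
      using A(3) A'(3) span_mono[of A ?S] span_mono[of A' ?S] by blast+
    ultimately have sub: "g0 \<subseteq> span ?S" "V s \<subseteq> span ?S" "V (- s) \<subseteq> span ?S" by blast+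
    have L: "L \<subseteq> span ?S"
    proof
      fix x assume "x \<in> L"
      then obtain u v where uv: "u \<in> g0" "v \<in> g1" "x = u + v" by (rule decompose)
      obtain a b where ab: "a \<in> V s" "b \<in> V (- s)" "v = a + b" using g1_split[OF uv(2)] .
      show "x \<in> span ?S" unfolding uv(3) ab(3)
        by (intro span_add) (rule subsetD[OF sub(1) uv(1)] subsetD[OF sub(2) ab(1)] subsetD[OF sub(3) ab(2)])+
    qed
    have fin: "finite ?S" using A(1) A'(1) by simp
    have "Bs \<subseteq> span ?S" using span_superset[of Bs] L unfolding basis(3) by (rule subset_trans)
    from independent_span_bound[OF fin basis(2) this] have "card Bs \<le> card ?S" by (rule conjunct2)
    also have "\<dots> \<le> card (insert z ?P) + (card A + card A')"
      using card_Un_le[of "insert z ?P" "A \<union> A'"] card_Un_le[of A A'] by linarith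
    also have "card (insert z ?P) \<le> card ?P + 1" by (simp add: card_insert_if)
    also have "card ?P \<le> card ?Q" by (rule card_image_le) simp
    also have "card ?Q \<le> 45" using card_length[of "filter (\<lambda>(p, q). p < q) (List.product idxs idxs)"]
      unfolding root_pairs_card .
    finally show False using A(2) A'(2) assms by linarith
  qed
  ultimately consider "?spin s" | "?spin (- s)" by blast
  then show ?thesis
  proof cases
    case 1
    then obtain x m where x: "x \<in> V s" "x \<noteq> 0" "wt m x" "\<forall>p\<in>idx. m p = 1 / 2 \<or> m p = - (1 / 2)"
      by (elim exE conjE) (rule that)
    have ne: "V (- s) \<noteq> {0}"
    proof
      assume V0: "V (- s) = {0}"
      have "kf x y = 0" if "y \<in> V (- s)" for y
      proof -
        have "y = 0" using that unfolding V0 by (rule singletonD)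
        then show ?thesis by (simp only: kf_zero)
      qed
      from kf_nondegenerate_V[OF x(1) this] x(2) show False by (rule notE[rotated])
    qed
    show ?thesis
    proof (rule exI, rule conjI)
      show "s \<noteq> 0" by (rule s(1))
      show "g1 = {x + y | x y. x \<in> V s \<and> y \<in> V (- s)} \<and> V (- s) \<noteq> {0} \<and>
        (\<exists>a\<in>V s. \<exists>a'\<in>V s. \<forall>\<xi>\<in>V (- s). \<forall>\<eta>\<in>V (- s). br \<xi> a' + br a \<eta> = 0 \<longrightarrow> \<xi> = 0 \<and> \<eta> = 0)"
        by (rule conjI[OF s(2) conjI[OF ne injective_pair[OF x]]])
    qed
  next
    case 2
    then obtain x m where x: "x \<in> V (- s)" "x \<noteq> 0" "wt m x" "\<forall>p\<in>idx. m p = 1 / 2 \<or> m p = - (1 / 2)"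
      by (elim exE conjE) (rule that)
    have ne: "V (- (- s)) \<noteq> {0}"
    proof
      assume V0: "V (- (- s)) = {0}"
      have "kf x y = 0" if "y \<in> V (- (- s))" for y
      proof -
        have "y = 0" using that unfolding V0 by (rule singletonD)
        then show ?thesis by (simp only: kf_zero)
      qed
      from o.kf_nondegenerate_V[OF x(1) this] x(2) show False by (rule notE[rotated])
    qed
    show ?thesis
    proof (rule exI, rule conjI)
      show "- s \<noteq> 0" by (rule o.s(1))
      show "g1 = {x + y | x y. x \<in> V (- s) \<and> y \<in> V (- (- s))} \<and> V (- (- s)) \<noteq> {0} \<and>
        (\<exists>a\<in>V (- s). \<exists>a'\<in>V (- s). \<forall>\<xi>\<in>V (- (- s)). \<forall>\<eta>\<in>V (- (- s)). br \<xi> a' + br a \<eta> = 0 \<longrightarrow> \<xi> = 0 \<and> \<eta> = 0)"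
        by (rule conjI[OF o.s(2) conjI[OF ne o.injective_pair[OF x]]])
    qed
  qed
qed

section \<open>A frame of \<open>so\<^sub>1\<^sub>0\<close>\<close>

text \<open>The skew matrix that corresponds to \<open>u \<wedge> v\<close> under the standard form.\<close>

definition od :: "'k::field^'a::finite \<Rightarrow> 'k^'a \<Rightarrow> 'k^'a^'a" where
  "od u v = (\<chi> i j. u $ i * v $ j - v $ i * u $ j)"

lemma dot_form_linear:
  "dot_form (u + v) w = dot_form u w + dot_form v w" "dot_form w (u + v) = dot_form w u + dot_form w v"
  "dot_form (u - v) w = dot_form u w - dot_form v w" "dot_form w (u - v) = dot_form w u - dot_form w v"
  "dot_form (c *s u) w = c * dot_form u w" "dot_form w (c *s u) = c * dot_form w u"
  "dot_form 0 w = 0" "dot_form w 0 = 0"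
  by (simp_all add: dot_form_def algebra_simps sum.distrib sum_subtractf sum_distrib_left)

lemma dot_form_sum: "dot_form w (\<Sum>i\<in>I. f i) = (\<Sum>i\<in>I. dot_form w (f i))"
  by (induction I rule: infinite_finite_induct) (auto simp: dot_form_linear)

lemma dot_form_sym: "dot_form u v = dot_form v u"
  by (simp add: dot_form_def mult.commute)

lemma od_vec: "od u v *v x = dot_form v x *s u - dot_form u x *s v"
proof (simp only: vec_eq_iff, rule allI)
  fix i
  have "(od u v *v x) $ i = (\<Sum>j\<in>UNIV. u $ i * (v $ j * x $ j) - v $ i * (u $ j * x $ j))"
    unfolding matrix_vector_mult_def od_def by (simp add: algebra_simps)
  then show "(od u v *v x) $ i = (dot_form v x *s u - dot_form u x *s v) $ i"
    by (simp add: sum_subtractf sum_distrib_left[symmetric] dot_form_def mult.commute)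
qed

lemma od_so: "od u v \<in> so_algebra dot_form"
  by (simp add: so_algebra_def od_vec dot_form_linear dot_form_sym[of _ u] dot_form_sym[of _ v] algebra_simps)

lemma od_anti: "od v u = - od u v"
  by (simp add: od_def vec_eq_iff)

lemma commutator_od:
  "commutator (od u v) (od w y) = mat_scale (dot_form v w) (od u y) - mat_scale (dot_form u w) (od v y)
    + mat_scale (dot_form v y) (od w u) - mat_scale (dot_form u y) (od w v)"
proof -
  have "commutator (od u v) (od w y) *v x = (mat_scale (dot_form v w) (od u y) - mat_scale (dot_form u w) (od v y)
    + mat_scale (dot_form v y) (od w u) - mat_scale (dot_form u y) (od w v)) *v x" for x
    by (simp add: commutator_def matrix_vector_mult_diff_rdistrib matrix_vector_mult_add_rdistrib
        matrix_vector_mul_assoc[symmetric] mat_scale_mult_vec od_vec dot_form_linear dot_form_sym[of w v]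
        dot_form_sym[of w u] dot_form_sym[of y v] dot_form_sym[of y u] vec_eq_iff algebra_simps)
  then show ?thesis by (simp add: matrix_eq)
qed

lemma sum_idx: "(\<Sum>p\<in>idx. F p) = (\<Sum>i = 1..5. F i + F (- i))" for F :: "int \<Rightarrow> 'b::comm_monoid_add"
proof -
  have idx: "idx = {1..5} \<union> uminus ` {1..5}" by (auto simp: idx_def image_iff)
  have "(\<Sum>p\<in>idx. F p) = (\<Sum>p = 1..5. F p) + (\<Sum>p\<in>uminus ` {1..5}. F p)"
    unfolding idx by (rule sum.union_disjoint) auto
  also have "(\<Sum>p\<in>uminus ` {1..5}. F p) = (\<Sum>i = 1..5. F (- i))"
    by (rule sum.reindex[unfolded o_def]) simp
  finally show ?thesis by (simp add: sum.distrib)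
qed

text \<open>The isotropic vectors are \<open>d + \<iota> d'\<close> and \<open>(d - \<iota> d') / 2\<close> for five pairs \<open>d, d'\<close> of unit vectors, with \<open>\<iota>\<^sup>2 = -1\<close>.\<close>

lemma isotropic_basis:
  obtains w :: "int \<Rightarrow> 'k::{alg_closed_field, field_char_0}^10" where
    "\<And>p q. p \<in> idx \<Longrightarrow> q \<in> idx \<Longrightarrow> dot_form (w p) (w q) = (if p = - q then 1 else 0)"
    "\<And>x. (\<Sum>p\<in>idx. dot_form (w (- p)) x *s w p) = x"
proof -
  have "card ({1..5 :: int} \<times> (UNIV :: bool set)) = card (UNIV :: 10 set)"
    by (simp add: card_cartesian_product)
  then obtain g where g: "bij_betw g ({1..5 :: int} \<times> (UNIV :: bool set)) (UNIV :: 10 set)"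
    using finite_same_card_bij[of "{1..5 :: int} \<times> (UNIV :: bool set)" "UNIV :: 10 set"] by auto
  obtain \<iota> :: 'k where \<iota>: "\<iota> ^ 2 = - 1" using nth_root_exists[of 2 "- 1 :: 'k"] by auto
  then have ii: "\<iota> * \<iota> = - 1" by (simp add: power2_eq_square)
  define d where "d i c = (axis (g (i, c)) 1 :: 'k^10)" for i c
  have dx: "dot_form (d i c) x = x $ g (i, c)" for i c x
    by (simp add: dot_form_def d_def axis_def if_distrib if_distribR cong: if_cong)
  have dd: "dot_form (d i c) (d j c') = (if i = j \<and> c = c' then 1 else 0)" if "i \<in> {1..5}" "j \<in> {1..5}" for i j c c'
  proof -
    have "g (i, c) = g (j, c') \<longleftrightarrow> i = j \<and> c = c'"
      using inj_on_eq_iff[OF bij_betw_imp_inj_on[OF g], of "(i, c)" "(j, c')"] that by auto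
    then show ?thesis unfolding dx by (simp add: d_def axis_def)
  qed
  define w where "w p = (if p > 0 then d p False + \<iota> *s d p True
    else (1 / 2) *s (d (- p) False - \<iota> *s d (- p) True))" for p
  have "dot_form (w p) (w q) = (if p = - q then 1 else 0)" if pq: "p \<in> idx" "q \<in> idx" for p q
  proof -
    have D: "dot_form (d i True) (d j False) = 0" "dot_form (d i False) (d j True) = 0"
      "dot_form (d i True) (d j True) = (if i = j then 1 else 0)" "dot_form (d i False) (d j False) = (if i = j then 1 else 0)"
      if "i \<in> {1..5}" "j \<in> {1..5}" for i j using dd[OF that] by simp_all
    have r: "p > 0 \<Longrightarrow> p \<in> {1..5}" "\<not> p > 0 \<Longrightarrow> - p \<in> {1..5}" "q > 0 \<Longrightarrow> q \<in> {1..5}" "\<not> q > 0 \<Longrightarrow> - q \<in> {1..5}"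
      using pq by (auto simp: idx_def)
    show ?thesis
    proof (cases "p > 0"; cases "q > 0")
      assume a: "p > 0" "q > 0"
      then show ?thesis using D[OF r(1)[OF a(1)] r(3)[OF a(2)]] by (simp add: w_def dot_form_linear ii)
    next
      assume a: "p > 0" "\<not> q > 0"
      then show ?thesis using D[OF r(1)[OF a(1)] r(4)[OF a(2)]] by (simp add: w_def dot_form_linear ii)
    next
      assume a: "\<not> p > 0" "q > 0"
      then show ?thesis using D[OF r(2)[OF a(1)] r(3)[OF a(2)]] by (auto simp: w_def dot_form_linear ii)
    next
      assume a: "\<not> p > 0" "\<not> q > 0"
      moreover have "p \<noteq> - q" using a r by auto
      ultimately show ?thesis using D[OF r(2)[OF a(1)] r(4)[OF a(2)]] by (simp add: w_def dot_form_linear ii)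
    qed
  qed
  moreover have "(\<Sum>p\<in>idx. dot_form (w (- p)) x *s w p) = x" for x
  proof -
    have "dot_form (w (- i)) x *s w i + dot_form (w (- (- i))) x *s w (- i) =
        (\<Sum>c\<in>UNIV. x $ g (i, c) *s axis (g (i, c)) 1)" if i: "i \<in> {1..5}" for i
    proof -
      have iit: "\<iota> * (\<iota> * t) = - t" for t using ii by (simp add: mult.assoc[symmetric])
      show ?thesis using i
        by (simp add: w_def dot_form_linear dx d_def[symmetric] UNIV_bool vec_eq_iff algebra_simps add_divide_distrib)
          (simp add: iit)
    qed
    then have "(\<Sum>p\<in>idx. dot_form (w (- p)) x *s w p) = (\<Sum>i = 1..5. \<Sum>c\<in>UNIV. x $ g (i, c) *s axis (g (i, c)) 1)"
      unfolding sum_idx by (intro sum.cong) auto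
    also have "\<dots> = (\<Sum>ic\<in>{1..5} \<times> UNIV. x $ g ic *s axis (g ic) 1)"
      by (simp add: sum.cartesian_product)
    also have "\<dots> = (\<Sum>k\<in>UNIV. x $ k *s axis k 1)"
      by (rule sum.reindex_bij_betw[OF g])
    also have "\<dots> = x" by (rule basis_expansion)
    finally show ?thesis .
  qed
  ultimately show thesis using that by blast
qed

lemma so_expansion:
  fixes w :: "int \<Rightarrow> 'k::field_char_0^'a::finite"
  assumes w: "\<And>x. (\<Sum>p\<in>idx. dot_form (w (- p)) x *s w p) = x" and A: "A \<in> so_algebra dot_form"
  shows "A = (\<Sum>p\<in>idx. \<Sum>q\<in>idx. mat_scale (dot_form (w (- p)) (A *v w (- q)) / 2) (od (w p) (w q)))"
proof -
  define c where "c p q = dot_form (w (- p)) (A *v w (- q))" for p q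
  have skew: "c q p = - c p q" for p q
  proof -
    have "dot_form (A *v w (- p)) (w (- q)) + dot_form (w (- p)) (A *v w (- q)) = 0"
      using A by (simp add: so_algebra_def)
    then show ?thesis by (simp add: c_def dot_form_sym[of "w (- q)"] eq_neg_iff_add_eq_0)
  qed
  have mvsum: "(\<Sum>p\<in>I. f p) *v x = (\<Sum>p\<in>I. f p *v x)" for I :: "int set" and f :: "int \<Rightarrow> 'k^'a^'a" and x
    by (induction I rule: infinite_finite_induct) (auto simp: matrix_vector_mult_add_rdistrib)
  have Asum: "A *v (\<Sum>p\<in>I. f p) = (\<Sum>p\<in>I. A *v f p)" for I :: "int set" and f
    by (induction I rule: infinite_finite_induct) (auto simp: matrix_vector_right_distrib)
  have "(\<Sum>p\<in>idx. \<Sum>q\<in>idx. mat_scale (c p q / 2) (od (w p) (w q))) *v x = A *v x" for x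
  proof -
    have half: "(t / 2) *s v + (t / 2) *s v = t *s v" for t :: 'k and v :: "'k^'a" by (simp add: vec_eq_iff)
    let ?T = "\<Sum>p\<in>idx. \<Sum>q\<in>idx. (c p q * dot_form (w q) x / 2) *s w p"
    have "(\<Sum>p\<in>idx. \<Sum>q\<in>idx. mat_scale (c p q / 2) (od (w p) (w q))) *v x
      = (\<Sum>p\<in>idx. \<Sum>q\<in>idx. (c p q * dot_form (w q) x / 2) *s w p + (c q p * dot_form (w p) x / 2) *s w q)"
      unfolding mvsum
    proof (intro sum.cong refl)
      fix p q
      show "mat_scale (c p q / 2) (od (w p) (w q)) *v x =
        (c p q * dot_form (w q) x / 2) *s w p + (c q p * dot_form (w p) x / 2) *s w q"
        unfolding skew[of q p] by (simp add: mat_scale_mult_vec od_vec vec_eq_iff algebra_simps)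
    qed
    also have "\<dots> = ?T + (\<Sum>p\<in>idx. \<Sum>q\<in>idx. (c q p * dot_form (w p) x / 2) *s w q)"
      by (simp add: sum.distrib)
    also have "(\<Sum>p\<in>idx. \<Sum>q\<in>idx. (c q p * dot_form (w p) x / 2) *s w q) = ?T" by (rule sum.swap)
    also have "?T + ?T = (\<Sum>p\<in>idx. \<Sum>q\<in>idx. (c p q * dot_form (w q) x) *s w p)"
      unfolding sum.distrib[symmetric] by (simp only: half)
    also have "\<dots> = (\<Sum>p\<in>idx. dot_form (w (- p)) (A *v (\<Sum>q\<in>idx. dot_form (w q) x *s w (- q))) *s w p)"
      by (simp add: Asum dot_form_sum c_def vec.scale_sum_left matrix_vector_mult_scaleR vector_scalar_commute dot_form_linear mult.commute)
    also have "(\<Sum>q\<in>idx. dot_form (w q) x *s w (- q)) = (\<Sum>q\<in>idx. dot_form (w (- q)) x *s w q)"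
      by (rule sum.reindex_bij_witness[of _ uminus uminus]) auto
    finally show ?thesis by (simp only: w)
  qed
  then show ?thesis unfolding c_def[symmetric] by (simp add: matrix_eq)
qed

section \<open>Reducibility for \<open>E\<^sub>6\<close> and the three cases together\<close>

context closed_lie_algebra
begin

lemma commuting_variety_reducible_E6:
  assumes fd: finite_dimensional and simple: simple
    and cartan: "cartan_subalgebra H" and E6: "roots_of_type_E6 H"
    and \<sigma>: "involutory_automorphism smul L br \<sigma>"
    and f: "lie_isomorphism smul (plus_part L \<sigma>) br so10_t1_scale so10_t1_carrier so10_t1_bracket f"
  shows "commuting_variety_reducible smul br (minus_part L \<sigma>)"
proof -
  obtain h Bs ev where h: "h \<in> L" and Bs: "finite Bs" "independent Bs" "span Bs = L"
    and ev: "\<forall>b\<in>Bs. br h b = smul (of_int (ev b)) b" "\<exists>b\<in>Bs. ev b \<noteq> 0" and card: "card Bs \<ge> 67"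
    by (rule integral_element[OF fd cartan E6]) (rule that)
  \<comment> \<open>bracket and involution are extended to the ambient space through a projection onto \<open>L\<close>\<close>
  have vsp: "vector_space_pair smul smul" by (intro vector_space_pair.intro vector_space_axioms)
  obtain \<pi> where \<pi>: "Vector_Spaces.linear smul smul \<pi>" "\<And>b. b \<in> Bs \<Longrightarrow> \<pi> b = b" "range \<pi> = span (id ` Bs)"
    using vector_space_pair.linear_independent_extend_subspace[OF vsp Bs(2), of id] by auto
  interpret \<pi>: Vector_Spaces.linear smul smul \<pi> by (rule \<pi>(1))
  have \<pi>L: "\<pi> x \<in> L" for x using \<pi>(3) Bs(3) by auto
  have \<pi>_id: "\<pi> x = x" if "x \<in> L" for x
  proof -
    have "x \<in> span Bs" using that Bs by simp
    then show ?thesis by (induction rule: span_induct_alt) (simp_all add: \<pi>.zero \<pi>.add \<pi>.scale \<pi>(2))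
  qed
  define b' \<sigma>' where "b' x y = br (\<pi> x) (\<pi> y)" and "\<sigma>' x = \<sigma> (\<pi> x)" for x y
  have b'_L: "b' x y = br x y" if "x \<in> L" "y \<in> L" for x y using that by (simp add: b'_def \<pi>_id)
  have \<sigma>'_L: "\<sigma>' x = \<sigma> x" if "x \<in> L" for x using that by (simp add: \<sigma>'_def \<pi>_id)
  have sig: "\<And>x. x \<in> L \<Longrightarrow> \<sigma> x \<in> L" "\<And>x y. x \<in> L \<Longrightarrow> y \<in> L \<Longrightarrow> \<sigma> (x + y) = \<sigma> x + \<sigma> y"
    "\<And>c x. x \<in> L \<Longrightarrow> \<sigma> (smul c x) = smul c (\<sigma> x)"
    "\<And>x y. x \<in> L \<Longrightarrow> y \<in> L \<Longrightarrow> \<sigma> (br x y) = br (\<sigma> x) (\<sigma> y)" "\<And>x. x \<in> L \<Longrightarrow> \<sigma> (\<sigma> x) = x"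
    using \<sigma> by (auto simp: involutory_automorphism_def lie_isomorphism_def dest: bij_betwE)
  interpret T: total_lie_algebra smul L b'
    by unfold_locales
      (simp_all add: subspace_carrier b'_def br_closed \<pi>L \<pi>.add \<pi>.scale br_add_left br_add_right br_scale_left
        br_scale_right br_self \<pi>_id jacobi)
  interpret S: integral_simple_lie_algebra smul L b' Bs h ev
  proof
    fix I assume I: "subspace I" "I \<subseteq> L" and "\<And>x y. x \<in> L \<Longrightarrow> y \<in> I \<Longrightarrow> b' x y \<in> I"
    then have "\<forall>x\<in>L. \<forall>y\<in>I. br x y \<in> I" by (metis b'_L subsetD)
    then have "ideal I" using I by (simp add: ideal_def)
    then show "I = {0} \<or> I = L" using simple by (simp add: simple_def)
  next
    show "b' h b = smul (of_int (ev b)) b" if "b \<in> Bs" for b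
      using bspec[OF ev(1) that] b'_L[OF h, of b] that Bs span_base by auto
  qed (use Bs h ev(2) in auto)
  define g0 g1 where "g0 = plus_part L \<sigma>" and "g1 = minus_part L \<sigma>"
  have g0: "g0 = {x \<in> L. \<sigma>' x = x}" and g1: "g1 = {x \<in> L. \<sigma>' x = - x}"
    unfolding g0_def g1_def plus_part_def minus_part_def using \<sigma>'_L by auto
  have g0L: "x \<in> L" if "x \<in> g0" for x using that by (simp add: g0)
  have sub0: "subspace g0"
    unfolding g0_def plus_part_def using subspace_carrier sig(2,3) sig(3)[of 0 0]
    by (intro subspaceI) (auto simp: subspace_0 subspace_add subspace_scale)
  have br0: "b' x y \<in> g0" if "x \<in> g0" "y \<in> g0" for x y
    using that sig(4) br_closed b'_L by (auto simp: g0_def plus_part_def)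
  have F: "bij_betw f g0 so10_t1_carrier" "\<And>x y. x \<in> g0 \<Longrightarrow> y \<in> g0 \<Longrightarrow> f (x + y) = f x + f y"
    "\<And>c x. x \<in> g0 \<Longrightarrow> f (smul c x) = so10_t1_scale c (f x)"
    "\<And>x y. x \<in> g0 \<Longrightarrow> y \<in> g0 \<Longrightarrow> f (b' x y) = so10_t1_bracket (f x) (f y)"
  proof -
    have f': "bij_betw f g0 so10_t1_carrier \<and> (\<forall>x\<in>g0. \<forall>y\<in>g0. f (x + y) = f x + f y) \<and>
      (\<forall>c. \<forall>x\<in>g0. f (smul c x) = so10_t1_scale c (f x)) \<and>
      (\<forall>x\<in>g0. \<forall>y\<in>g0. f (br x y) = so10_t1_bracket (f x) (f y))"
      using f unfolding lie_isomorphism_def g0_def[symmetric] .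
    show "bij_betw f g0 so10_t1_carrier" "\<And>x y. x \<in> g0 \<Longrightarrow> y \<in> g0 \<Longrightarrow> f (x + y) = f x + f y"
      "\<And>c x. x \<in> g0 \<Longrightarrow> f (smul c x) = so10_t1_scale c (f x)"
      using f' by blast+
    show "f (b' x y) = so10_t1_bracket (f x) (f y)" if "x \<in> g0" "y \<in> g0" for x y
      using f' that b'_L[OF g0L[OF that(1)] g0L[OF that(2)]] by simp
  qed
  have f_inj: "x = y" if "x \<in> g0" "y \<in> g0" "f x = f y" for x y
    using F(1) that by (auto simp: bij_betw_def inj_on_def)
  have f0: "f 0 = 0" using F(2)[of 0 0] subspace_0[OF sub0] by simp
  have f_neg: "f (- x) = - f x" if "x \<in> g0" for x
    using F(2)[of x "- x"] that subspace_neg[OF sub0 that] f0 by (simp add: eq_neg_iff_add_eq_0 add.commute)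
  have f_diff: "f (x - y) = f x - f y" if "x \<in> g0" "y \<in> g0" for x y
    using F(2)[of x "- y"] that subspace_neg[OF sub0 that(2)] f_neg[OF that(2)] by simp
  have f_sum: "(\<Sum>i\<in>I. u i) \<in> g0 \<and> f (\<Sum>i\<in>I. u i) = (\<Sum>i\<in>I. f (u i))"
    if "\<And>i. i \<in> I \<Longrightarrow> u i \<in> g0" for u and I :: "int set"
    using that by (induction I rule: infinite_finite_induct)
      (auto simp: F(2) f0 subspace_0[OF sub0] subspace_add[OF sub0])
  obtain w :: "int \<Rightarrow> 'k^10" where w: "\<And>p q. p \<in> idx \<Longrightarrow> q \<in> idx \<Longrightarrow> dot_form (w p) (w q) = (if p = - q then 1 else 0)"
    "\<And>x. (\<Sum>p\<in>idx. dot_form (w (- p)) x *s w p) = x"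
  proof (rule isotropic_basis)
    fix w :: "int \<Rightarrow> 'k^10"
    assume "\<And>p q. p \<in> idx \<Longrightarrow> q \<in> idx \<Longrightarrow> dot_form (w p) (w q) = (if p = - q then 1 else 0)"
      and "\<And>x. (\<Sum>p\<in>idx. dot_form (w (- p)) x *s w p) = x"
    then show thesis by (rule that)
  qed
  define X where "X p q = inv_into g0 f (od (w p) (w q), 0)" for p q
  define z where "z = inv_into g0 f (0, 1)"
  have so0: "0 \<in> so_algebra dot_form"
    by (simp add: so_algebra_def dot_form_linear)
  have inv: "inv_into g0 f (A, c) \<in> g0 \<and> f (inv_into g0 f (A, c)) = (A, c)" if "A \<in> so_algebra dot_form" for A c
  proof -
    have "(A, c) \<in> so10_t1_carrier" using that by (simp add: so10_t1_carrier_def)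
    then show ?thesis
      using inv_into_into[of "(A, c)" f g0] f_inv_into_f[of "(A, c)" f g0] F(1) by (simp add: bij_betw_def)
  qed
  have X0: "X p q \<in> g0" and fX: "f (X p q) = (od (w p) (w q), 0)" for p q
    using inv[OF od_so] by (auto simp: X_def)
  have z0: "z \<in> g0" and fz: "f z = (0, 1)" using inv[OF so0] by (auto simp: z_def)
  have ms: "mat_scale 1 A = A" "mat_scale 0 A = 0" for A :: "'k^10^10" by (simp_all add: mat_scale_def vec_eq_iff)
  have X_anti: "X q p = - X p q" for p q
    by (rule f_inj) (simp_all add: X0 subspace_neg[OF sub0] f_neg fX od_anti[of "w q"])
  have X_br: "b' (X p q) (X r t) =
      (if q = - r then X p t else 0) - (if p = - r then X q t else 0)
        + (if q = - t then X r p else 0) - (if p = - t then X r q else 0)"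
    if "p \<in> idx" "q \<in> idx" "r \<in> idx" "t \<in> idx" for p q r t
  proof (rule f_inj)
    have if0: "(if P then X a b else 0) \<in> g0" for P a b using X0 subspace_0[OF sub0] by simp
    have fif: "f (if P then X a b else 0) = (if P then (od (w a) (w b), 0) else 0)" for P a b by (simp add: fX f0)
    show "b' (X p q) (X r t) \<in> g0" by (intro br0 X0)
    show "(if q = - r then X p t else 0) - (if p = - r then X q t else 0)
        + (if q = - t then X r p else 0) - (if p = - t then X r q else 0) \<in> g0"
      by (intro subspace_diff[OF sub0] subspace_add[OF sub0] if0)
    have "f ((if q = - r then X p t else 0) - (if p = - r then X q t else 0)
        + (if q = - t then X r p else 0) - (if p = - t then X r q else 0)) =
      (if q = - r then (od (w p) (w t), 0) else 0) - (if p = - r then (od (w q) (w t), 0) else 0)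
        + (if q = - t then (od (w r) (w p), 0) else 0) - (if p = - t then (od (w r) (w q), 0) else 0)"
      by (simp only: f_diff F(2) fif if0 subspace_diff[OF sub0] subspace_add[OF sub0])
    also have "\<dots> = (commutator (od (w p) (w q)) (od (w r) (w t)), 0)"
      using that by (simp add: commutator_od w(1) ms zero_prod_def)
    finally show "f (b' (X p q) (X r t)) = f ((if q = - r then X p t else 0) - (if p = - r then X q t else 0)
        + (if q = - t then X r p else 0) - (if p = - t then X r q else 0))"
      by (simp add: F(4) X0 fX so10_t1_bracket_def)
  qed
  have X_ne: "X p q \<noteq> 0" if pq: "p \<in> idx" "q \<in> idx" "p \<noteq> q" for p q
  proof
    assume "X p q = 0"
    then have "od (w p) (w q) = 0" using fX[of p q] f0 by (simp add: zero_prod_def)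
    then have "od (w p) (w q) *v w (- q) = 0" by simp
    then have "dot_form (w (- p)) (od (w p) (w q) *v w (- q)) = 0" by (simp add: dot_form_linear)
    moreover have "q \<noteq> p" using pq by simp
    ultimately show False using pq w(1)[of q "- q"] w(1)[of p "- q"] w(1)[of "- p" p] w(1)[of "- p" q]
      by (simp add: od_vec dot_form_linear)
  qed
  have z_central: "b' z x = 0" if "x \<in> g0" for x
    by (rule f_inj) (use that z0 br0 subspace_0[OF sub0] in \<open>simp_all add: F(4) fz f0 so10_t1_bracket_def commutator_def zero_prod_def\<close>)
  have z_ne: "z \<noteq> 0" using fz f0 by (auto simp: zero_prod_def)
  have span_X: "g0 = span (insert z {X p q | p q. p \<in> idx \<and> q \<in> idx})" (is "_ = span ?G")
  proof
    show "span ?G \<subseteq> g0" using sub0 z0 X0 by (intro span_minimal) auto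
    show "g0 \<subseteq> span ?G"
    proof
      fix y assume y: "y \<in> g0"
      obtain A c where Ac: "f y = (A, c)" by (cases "f y")
      then have A: "A \<in> so_algebra dot_form"
        using bij_betwE[OF F(1)] y by (force simp: so10_t1_carrier_def)
      define k where "k p q = dot_form (w (- p)) (A *v w (- q)) / 2" for p q
      let ?u = "\<lambda>p. \<Sum>q\<in>idx. smul (k p q) (X p q)"
      let ?y = "(\<Sum>p\<in>idx. ?u p) + smul c z"
      have kX: "smul (k p q) (X p q) \<in> g0" "f (smul (k p q) (X p q)) = (mat_scale (k p q) (od (w p) (w q)), 0)" for p q
        using X0 by (simp_all add: subspace_scale[OF sub0] F(3) fX so10_t1_scale_def pair_scale_def)
      have u: "?u p \<in> g0" "f (?u p) = (\<Sum>q\<in>idx. (mat_scale (k p q) (od (w p) (w q)), 0))" for p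
        using f_sum[of idx "\<lambda>q. smul (k p q) (X p q)"] kX by simp_all
      have uu: "(\<Sum>p\<in>idx. ?u p) \<in> g0" "f (\<Sum>p\<in>idx. ?u p) = (\<Sum>p\<in>idx. \<Sum>q\<in>idx. (mat_scale (k p q) (od (w p) (w q)), 0))"
        using f_sum[of idx ?u] u by simp_all
      have pair_sum: "(\<Sum>i\<in>I. (v i, 0 :: 'k)) = (\<Sum>i\<in>I. v i, 0)" for v :: "int \<Rightarrow> 'k^10^10" and I
        by (induction I rule: infinite_finite_induct) (auto simp: zero_prod_def)
      have "f (\<Sum>p\<in>idx. ?u p) = (A, 0)"
        unfolding uu(2) pair_sum using so_expansion[OF w(2) A] by (simp add: k_def)
      moreover have cz: "smul c z \<in> g0" "f (smul c z) = (0, c)"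
        using z0 by (simp_all add: subspace_scale[OF sub0] F(3) fz so10_t1_scale_def pair_scale_def mat_scale_def vec_eq_iff)
      ultimately have "f ?y = f y" using uu(1) by (simp add: F(2) Ac)
      then have "y = ?y" using f_inj[OF y subspace_add[OF sub0 uu(1) cz(1)]] by simp
      also have "?y \<in> span ?G"
        by (intro span_add span_sum span_scale span_base) auto
      finally show "y \<in> span ?G" .
    qed
  qed
  have perfect: "g0 \<subseteq> span (insert z {b' x y | x y. x \<in> g0 \<and> y \<in> g0})" (is "_ \<subseteq> span ?D")
  proof -
    have br_D: "b' x y \<in> span ?D" if "x \<in> g0" "y \<in> g0" for x y using that by (intro span_base) blast
    have "X p q \<in> span ?D" if pq: "p \<in> idx" "q \<in> idx" for p q
    proof -
      consider "p = q" | "q = - p" | "p \<noteq> q" "p \<noteq> - q" by fastforce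
      then show ?thesis
      proof cases
        case 1
        then have "X p q = - X p q" using X_anti[of p q] by simp
        then have "X p q + X p q = 0" by (simp only: eq_neg_iff_add_eq_0)
        then have "smul (1 + 1) (X p q) = 0" by (simp only: scale_left_distrib scale_one)
        then have "X p q = 0" by simp
        then show ?thesis by (simp add: span_zero)
      next
        case 3
        have "b' (X p (- p)) (X p q) = X p q" using 3 pq by (subst X_br) auto
        then show ?thesis using br_D[OF X0 X0, of p "- p" p q] by simp
      next
        case 2
        obtain r where r: "r \<in> idx" "r \<noteq> p" "r \<noteq> - p" by (rule idx_avoid[of p p p])
        then have pr: "p \<noteq> r" "p \<noteq> - r" by auto
        have 1: "b' (X p r) (X (- r) (- p)) = X p (- p) + X r (- r)"
          using X_br[of p r "- r" "- p"] pq r pr X_anti[of r "- r"] by simp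
        have 2: "b' (X p (- r)) (X r (- p)) = X p (- p) - X r (- r)"
          using X_br[of p "- r" r "- p"] pq r pr by simp
        have "X p (- p) = smul (1 / 2) (b' (X p r) (X (- r) (- p)) + b' (X p (- r)) (X r (- p)))"
          unfolding 1 2 using scale_left_distrib[of "1 / 2" "1 / 2" "X p (- p)"] by (simp add: scale_right_distrib)
        also have "\<dots> \<in> span ?D" by (intro span_scale span_add br_D X0)
        finally show ?thesis using \<open>q = - p\<close> by simp
      qed
    qed
    then show ?thesis
      unfolding span_X by (intro span_minimal subspace_span) (auto intro: span_base)
  qed
  interpret P: centered_pair smul L b' Bs h ev \<sigma>' z g0 g1
  proof (rule centered_pair.intro[OF S.integral_simple_lie_algebra_axioms], rule centered_pair_axioms.intro)
    show "Vector_Spaces.linear smul smul \<sigma>'"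
      by (simp add: Vector_Spaces.linear_iff vector_space_axioms \<sigma>'_def \<pi>.add \<pi>.scale sig \<pi>L)
  qed (use g0 g1 z0 z_ne z_central perfect in \<open>auto simp: \<sigma>'_def b'_def sig \<pi>L \<pi>_id br_closed\<close>)
  obtain s where s: "s \<noteq> 0" "g1 = {x + y | x y. x \<in> P.V s \<and> y \<in> P.V (- s)}" by (rule P.weight_of_z)
  interpret Q: framed_pair smul L b' Bs h ev \<sigma>' z g0 g1 s X
    by (intro framed_pair.intro graded_pair.intro P.centered_pair_axioms graded_pair_axioms.intro framed_pair_axioms.intro)
      (rule s X0 X_anti X_br span_X X_ne; assumption)+
  from Q.injective_pair_exists[OF card] obtain t where t':
    "t \<noteq> 0 \<and> g1 = {x + y | x y. x \<in> P.V t \<and> y \<in> P.V (- t)} \<and> P.V (- t) \<noteq> {0} \<and>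
    (\<exists>a\<in>P.V t. \<exists>a'\<in>P.V t. \<forall>\<xi>\<in>P.V (- t). \<forall>\<eta>\<in>P.V (- t). b' \<xi> a' + b' a \<eta> = 0 \<longrightarrow> \<xi> = 0 \<and> \<eta> = 0)"
    by (rule exE)
  note t = conjunct1[OF t'] conjunct1[OF conjunct2[OF t']] conjunct1[OF conjunct2[OF conjunct2[OF t']]]
  from conjunct2[OF conjunct2[OF conjunct2[OF t']]] obtain a where a1: "a \<in> P.V t"
    and ex: "\<exists>a'\<in>P.V t. \<forall>\<xi>\<in>P.V (- t). \<forall>\<eta>\<in>P.V (- t). b' \<xi> a' + b' a \<eta> = 0 \<longrightarrow> \<xi> = 0 \<and> \<eta> = 0"
    by (rule bexE)
  from ex obtain a' where a2: "a' \<in> P.V t"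
    and inj': "\<forall>\<xi>\<in>P.V (- t). \<forall>\<eta>\<in>P.V (- t). b' \<xi> a' + b' a \<eta> = 0 \<longrightarrow> \<xi> = 0 \<and> \<eta> = 0"
    by (rule bexE)
  note a = a1 a2
  have inj: "\<xi> = 0 \<and> \<eta> = 0" if "\<xi> \<in> P.V (- t)" "\<eta> \<in> P.V (- t)" "b' \<xi> a' + b' a \<eta> = 0" for \<xi> \<eta>
    using bspec[OF bspec[OF inj' that(1)] that(2)] that(3) by (rule mp)
  have VL: "P.V u \<subseteq> L" for u by (rule subsetI, rule P.g1_L, rule P.V_g1)
  have eq: "br x y = b' x y" if "x \<in> P.V u" "y \<in> P.V v" for x y u v
    using b'_L[OF subsetD[OF VL that(1)] subsetD[OF VL that(2)]] by simp
  show ?thesis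
    unfolding g1_def[symmetric]
  proof (rule graded_commuting_variety_reducible[OF P.subspace_V VL P.subspace_V VL _ _ _ Bs(1) _ t(3) a _ t(2)])
    show "P.V t \<inter> P.V (- t) = {0}"
    proof (intro equalityI subsetI)
      show "x \<in> {0}" if "x \<in> P.V t \<inter> P.V (- t)" for x
        using P.V_Int_V[OF t(1) IntD1[OF that] IntD2[OF that]] by simp
      show "x \<in> P.V t \<inter> P.V (- t)" if "x \<in> {0}" for x
        using that subspace_0[OF P.subspace_V] by (simp only: singleton_iff) (intro IntI, assumption+)
    qed
    show "br x y = 0" if "x \<in> P.V t" "y \<in> P.V t" for x y
      using eq[OF that] P.br_V_V[OF t(1) that] by simp
    show "br x y = 0" if "x \<in> P.V (- t)" "y \<in> P.V (- t)" for x y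
      using eq[OF that] P.br_V_V[OF _ that] t(1) by simp
    show "P.V (- t) \<subseteq> span Bs" unfolding Bs(3) by (rule VL)
    show "\<xi> = 0 \<and> \<eta> = 0" if "\<xi> \<in> P.V (- t)" "\<eta> \<in> P.V (- t)" "br \<xi> a' + br a \<eta> = 0" for \<xi> \<eta>
      using inj[OF that(1,2)] that(3) eq[OF that(1) a(2)] eq[OF a(1) that(2)] by simp
  qed
qed

end

theorem mainTheorem3:
  fixes smul :: "'k::{alg_closed_field, field_char_0} \<Rightarrow> 'g::ab_group_add \<Rightarrow> 'g"
    and L :: "'g set" and br :: "'g \<Rightarrow> 'g \<Rightarrow> 'g" and \<sigma> :: "'g \<Rightarrow> 'g"
    and B :: "'k^'v::finite \<Rightarrow> 'k^'v \<Rightarrow> 'k" and Vp Vm :: "('k^'v) set" and S :: "'k^'v^'v"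
    and n :: nat
  shows
   "(CARD('p::finite) \<noteq> CARD('q::finite) \<longrightarrow>
       commuting_variety_reducible mat_scale commutator
         (minus_part sl_algebra (conjugation (block_sign_matrix :: 'k^('p + 'q)^('p + 'q)))))
    \<and>
    (odd n \<and> n \<ge> 3 \<and> CARD('v) = 2 * n \<and>
     nondegenerate_symmetric_form B \<and>
     isotropic_subspace B Vp \<and> isotropic_subspace B Vm \<and>
     Vp \<inter> Vm = {0} \<and> {u + w | u w. u \<in> Vp \<and> w \<in> Vm} = UNIV \<and>
     (\<forall>u\<in>Vp. S *v u = u) \<and> (\<forall>w\<in>Vm. S *v w = - w) \<longrightarrow>
       commuting_variety_reducible mat_scale commutator
         (minus_part (so_algebra B) (conjugation S)))
    \<and>
    (simple_lie_algebra_E6 smul L br \<and>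
     involutory_automorphism smul L br \<sigma> \<and>
     (\<exists>f. lie_isomorphism smul (plus_part L \<sigma>) br
            so10_t1_scale so10_t1_carrier so10_t1_bracket f) \<longrightarrow>
       commuting_variety_reducible smul br (minus_part L \<sigma>))"
proof (intro conjI impI)
  assume "CARD('p) \<noteq> CARD('q)"
  then show "commuting_variety_reducible mat_scale commutator
    (minus_part sl_algebra (conjugation (block_sign_matrix :: 'k^('p + 'q)^('p + 'q))))"
    by (rule commuting_variety_reducible_sl)
next
  assume "odd n \<and> n \<ge> 3 \<and> CARD('v) = 2 * n \<and>
     nondegenerate_symmetric_form B \<and>
     isotropic_subspace B Vp \<and> isotropic_subspace B Vm \<and>
     Vp \<inter> Vm = {0} \<and> {u + w | u w. u \<in> Vp \<and> w \<in> Vm} = UNIV \<and>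
     (\<forall>u\<in>Vp. S *v u = u) \<and> (\<forall>w\<in>Vm. S *v w = - w)"
  then show "commuting_variety_reducible mat_scale commutator (minus_part (so_algebra B) (conjugation S))"
    by (elim conjE) (rule commuting_variety_reducible_so)
next
  assume E6: "simple_lie_algebra_E6 smul L br \<and> involutory_automorphism smul L br \<sigma> \<and>
     (\<exists>f. lie_isomorphism smul (plus_part L \<sigma>) br so10_t1_scale so10_t1_carrier so10_t1_bracket f)"
  then obtain f H where "lie_algebra smul L br"
    and fs: "lie_algebra.finite_dimensional smul L" "lie_algebra.simple smul L br"
      "lie_algebra.cartan_subalgebra smul L br H" "lie_algebra.roots_of_type_E6 smul L br H"
      "involutory_automorphism smul L br \<sigma>"
      "lie_isomorphism smul (plus_part L \<sigma>) br so10_t1_scale so10_t1_carrier so10_t1_bracket f"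
    unfolding simple_lie_algebra_E6_def by blast
  then interpret closed_lie_algebra smul L br by (intro closed_lie_algebra.intro)
  show "commuting_variety_reducible smul br (minus_part L \<sigma>)"
    by (rule commuting_variety_reducible_E6[OF fs])
qed

end
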